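(* Let $(W,S)$ be a right-angled Coxeter system (with $S$ finite). For all integers $m\ge 2$ and all $n\ge 5$ (including $n=\infty$), the hypergraph index of the $(m,n)$-duplex $(W_2(m,n),S_2)$ is the same as the hypergraph index of $(W,S)$.
   Context: Coxeter systems: $W=\langle S\mid (st)^{m_{st}}=1\rangle$ with $S$ finite, $m_{ss}=1$ and $m_{st}=m_{ts}\in\{2,3,\dots\}\cup\{\infty\}$ for $s\neq t$ ($\infty$ meaning that $st$ has infinite order). The system is right-angled if $m_{st}\in\{2,\infty\}$ for all distinct $s,t$. Duplex: for a right-angled Coxeter system $(W,S)$, an integer $m\ge2$ and $n\in\{5,6,\dots\}\cup\{\infty\}$, the $(m,n)$-duplex $(W_2(m,n),S_2)$ is the Coxeter system with $S_2=\{u',u''\mid u\in S\}$ (two disjoint copies of $S$), with $m_{u'u''}=m$ for all $u\in S$; and for $u\ne v$ in $S$, all of $m_{u'v'},m_{u'v''},m_{u''v'},m_{u''v''}$ equal $2$ if $m_{uv}=2$, and equal $n$ if $m_{uv}=\infty$. For $T\subseteq S$, $W_T=\langle T\rangle$, and $(W_T,T)$ is a Coxeter system. $T$ is spherical if $W_T$ is finite and nonspherical otherwise; minimal nonspherical if it is nonspherical but all its proper subsets are spherical; irreducible if it has no nontrivial partition into two disjoint commuting subsets; affine if $(W_T,T)$ is affine, i.e. $T$ is the set of reflections in the faces of a compact polytope in Euclidean space. For $A,B\subseteq S$, $A\times B$ denotes $A\cup B$ where $A$ and $B$ are disjoint commuting subsets of $S$. Hypergraph index (for any Coxeter system $(W,S)$):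 The wide subsets $\Omega(S)$ are the maximal elements (under inclusion) of the collection of subsets of $S$ of the form $A\times B$ such that either $A$ and $B$ are both nonspherical, or $A$ is irreducible affine of cardinality $\ge 3$ and $B$ is spherical (possibly empty). The slab subsets $\Psi(S)$ are the maximal elements of the collection of subsets of $S$ of the form $A\times K$ where $A$ is minimal nonspherical, $K$ is a nonempty spherical subset commuting with $A$, and there is no $T\in\Omega(S)$ with $A\times K\subseteq T$. Put $\Lambda_{-1}(S)=\varnothing$ and $\Lambda_0(S)=\Omega(S)\cup\Psi(S)$. For $i\ge 0$ and $T,T'\in\Lambda_i(S)$, write $T\equiv_i T'$ if there are $T=T_0,T_1,\dots,T_k=T'$ in $\Lambda_i(S)$ with $T_j\cap T_{j+1}$ nonspherical for $0\le j<k$; then $\Lambda_{i+1}(S)$ is the set of all unions $\bigcup_{T\in C}T$ with $C$ an $\equiv_i$-equivalence class in $\Lambda_i(S)$. The hypergraph index is $h(W,S)=h\in\mathbb{N}\cup\{0\}$ if $S\in\Lambda_h(S)\setminus\Lambda_{h-1}(S)$ and $\Omega(S)\neq\varnothing$; if no such $h$ exists, or $\Omega(S)=\varnothing$, then $h(W,S)=\infty$. *)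

theory Defs
  imports
    "HOL-Analysis.Analysis"
    "HOL-Library.Extended_Nat"
    "HOL-Algebra.Generated_Groups"
    "HOL-Algebra.Bij"
begin

section \<open>Group presentations\<close>

text \<open>The letter \<open>(x, True)\<close> stands for the generator \<open>x\<close> and \<open>(x, False)\<close> for its formal inverse.\<close>

type_synonym 'a word = "('a \<times> bool) list"

abbreviation words_over :: "'a set \<Rightarrow> 'a word set" where
  "words_over X \<equiv> lists (X \<times> UNIV)"

inductive pres_eq :: "'a set \<Rightarrow> 'a word set \<Rightarrow> 'a word \<Rightarrow> 'a word \<Rightarrow> bool"
  for X :: "'a set" and R :: "'a word set" where
  refl: "w \<in> words_over X \<Longrightarrow> pres_eq X R w w"
| sym: "pres_eq X R v w \<Longrightarrow> pres_eq X R w v"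
| trans: "pres_eq X R u v \<Longrightarrow> pres_eq X R v w \<Longrightarrow> pres_eq X R u w"
| cancel: "u \<in> words_over X \<Longrightarrow> v \<in> words_over X \<Longrightarrow> x \<in> X
    \<Longrightarrow> pres_eq X R (u @ [(x, e), (x, \<not> e)] @ v) (u @ v)"
| relator: "u \<in> words_over X \<Longrightarrow> v \<in> words_over X \<Longrightarrow> r \<in> R \<Longrightarrow> r \<in> words_over X
    \<Longrightarrow> pres_eq X R (u @ r @ v) (u @ v)"

definition pres_class :: "'a set \<Rightarrow> 'a word set \<Rightarrow> 'a word \<Rightarrow> 'a word set" where
  "pres_class X R w = {v. pres_eq X R w v}"

definition presented_group :: "'a set \<Rightarrow> 'a word set \<Rightarrow> 'a word set monoid" where
  "presented_group X R =
    \<lparr>carrier = pres_class X R ` words_over X,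
     monoid.mult = (\<lambda>A B. \<Union>v\<in>A. \<Union>w\<in>B. pres_class X R (v @ w)),
     one = pres_class X R []\<rparr>"


section \<open>Coxeter systems\<close>

text \<open>A Coxeter system is given by its generating set \<open>S\<close> and its Coxeter matrix \<open>M\<close>;
  values of \<open>M\<close> outside \<open>S\<close> are irrelevant.\<close>

definition coxeter_matrix :: "'a set \<Rightarrow> ('a \<Rightarrow> 'a \<Rightarrow> enat) \<Rightarrow> bool" where
  "coxeter_matrix S M \<longleftrightarrow> finite S \<and> (\<forall>s\<in>S. M s s = 1) \<and>
    (\<forall>s\<in>S. \<forall>t\<in>S. s \<noteq> t \<longrightarrow> M s t = M t s \<and> 2 \<le> M s t)"

definition right_angled :: "'a set \<Rightarrow> ('a \<Rightarrow> 'a \<Rightarrow> enat) \<Rightarrow> bool" where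
  "right_angled S M \<longleftrightarrow> (\<forall>s\<in>S. \<forall>t\<in>S. s \<noteq> t \<longrightarrow> M s t \<in> {2, \<infinity>})"

definition coxeter_relators :: "'a set \<Rightarrow> ('a \<Rightarrow> 'a \<Rightarrow> enat) \<Rightarrow> 'a word set" where
  "coxeter_relators S M =
    {concat (replicate k [(s, True), (t, True)]) | s t k. s \<in> S \<and> t \<in> S \<and> M s t = enat k}"

definition coxeter_group :: "'a set \<Rightarrow> ('a \<Rightarrow> 'a \<Rightarrow> enat) \<Rightarrow> 'a word set monoid" where
  "coxeter_group S M = presented_group S (coxeter_relators S M)"

definition cox_gen :: "'a set \<Rightarrow> ('a \<Rightarrow> 'a \<Rightarrow> enat) \<Rightarrow> 'a \<Rightarrow> 'a word set" where
  "cox_gen S M s = pres_class S (coxeter_relators S M) [(s, True)]"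

text \<open>The underlying set of the special subgroup \<open>W\<^sub>T\<close>.\<close>

definition special_subgroup :: "'a set \<Rightarrow> ('a \<Rightarrow> 'a \<Rightarrow> enat) \<Rightarrow> 'a set \<Rightarrow> 'a word set set" where
  "special_subgroup S M T = generate (coxeter_group S M) (cox_gen S M ` T)"

definition spherical :: "'a set \<Rightarrow> ('a \<Rightarrow> 'a \<Rightarrow> enat) \<Rightarrow> 'a set \<Rightarrow> bool" where
  "spherical S M T \<longleftrightarrow> T \<subseteq> S \<and> finite (special_subgroup S M T)"

definition nonspherical :: "'a set \<Rightarrow> ('a \<Rightarrow> 'a \<Rightarrow> enat) \<Rightarrow> 'a set \<Rightarrow> bool" where
  "nonspherical S M T \<longleftrightarrow> T \<subseteq> S \<and> infinite (special_subgroup S M T)"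

definition minimal_nonspherical :: "'a set \<Rightarrow> ('a \<Rightarrow> 'a \<Rightarrow> enat) \<Rightarrow> 'a set \<Rightarrow> bool" where
  "minimal_nonspherical S M T \<longleftrightarrow> nonspherical S M T \<and> (\<forall>U. U \<subset> T \<longrightarrow> spherical S M U)"

definition disjoint_commuting :: "'a set \<Rightarrow> ('a \<Rightarrow> 'a \<Rightarrow> enat) \<Rightarrow> 'a set \<Rightarrow> 'a set \<Rightarrow> bool" where
  "disjoint_commuting S M A B \<longleftrightarrow> A \<subseteq> S \<and> B \<subseteq> S \<and> A \<inter> B = {} \<and>
    (\<forall>a\<in>A. \<forall>b\<in>B. cox_gen S M a \<otimes>\<^bsub>coxeter_group S M\<^esub> cox_gen S M b =
                  cox_gen S M b \<otimes>\<^bsub>coxeter_group S M\<^esub> cox_gen S M a)"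

definition irreducible_subset :: "'a set \<Rightarrow> ('a \<Rightarrow> 'a \<Rightarrow> enat) \<Rightarrow> 'a set \<Rightarrow> bool" where
  "irreducible_subset S M T \<longleftrightarrow> T \<subseteq> S \<and>
    \<not> (\<exists>A B. A \<noteq> {} \<and> B \<noteq> {} \<and> A \<union> B = T \<and> disjoint_commuting S M A B)"


section \<open>Affine subsets\<close>

text \<open>For a closed affine subspace \<open>H\<close>, the point \<open>closest_point H x\<close> is the orthogonal projection
  of \<open>x\<close> to \<open>H\<close>, so this is the orthogonal reflection in \<open>H\<close>.\<close>

definition reflection_in :: "'b::euclidean_space set \<Rightarrow> 'b \<Rightarrow> 'b" where
  "reflection_in H x = 2 *\<^sub>R closest_point H x - x"

definition facet_reflections :: "'b::euclidean_space set \<Rightarrow> ('b \<Rightarrow> 'b) set" where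
  "facet_reflections P =
    {restrict (reflection_in (affine hull F)) (affine hull P) | F. F facet_of P}"

definition facet_reflection_group :: "'b::euclidean_space set \<Rightarrow> ('b \<Rightarrow> 'b) monoid" where
  "facet_reflection_group P = (BijGroup (affine hull P))
    \<lparr>carrier := generate (BijGroup (affine hull P)) (facet_reflections P)\<rparr>"

text \<open>The ambient Euclidean space is \<open>affine hull P\<close>, in which \<open>P\<close> has nonempty interior
  \<open>rel_interior P\<close>. A polytope of dimension \<open>d\<close> has at least \<open>d + 1\<close> facets (if \<open>d \<ge> 1\<close>), so its
  dimension is less than the number of generators; hence up to isometry every polytope that can
  occur lies in \<open>real ^ 'a\<close>, where \<open>'a\<close> is the type of the generators. That \<open>W\<^sub>T\<close> acts as a
  Coxeter group of which the facets of \<open>P\<close> carry the fundamental reflections means that \<open>P\<close> is a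
  chamber: translates of its interior by distinct group elements are disjoint.\<close>

definition affine_subset :: "'a::finite set \<Rightarrow> ('a \<Rightarrow> 'a \<Rightarrow> enat) \<Rightarrow> 'a set \<Rightarrow> bool" where
  "affine_subset S M T \<longleftrightarrow> T \<subseteq> S \<and>
    (\<exists>(P :: (real ^ 'a) set) \<phi>. polytope P \<and> P \<noteq> {} \<and>
      (\<forall>g \<in> carrier (facet_reflection_group P).
        g \<noteq> \<one>\<^bsub>facet_reflection_group P\<^esub> \<longrightarrow> g ` rel_interior P \<inter> rel_interior P = {}) \<and>
      \<phi> \<in> iso ((coxeter_group S M)\<lparr>carrier := special_subgroup S M T\<rparr>)
               (facet_reflection_group P) \<and>
      \<phi> ` (cox_gen S M ` T) = facet_reflections P)"


section \<open>The hypergraph index\<close>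

definition maximal_sets :: "'a set set \<Rightarrow> 'a set set" where
  "maximal_sets \<C> = {T \<in> \<C>. \<forall>U\<in>\<C>. T \<subseteq> U \<longrightarrow> U = T}"

definition wide_subsets :: "'a::finite set \<Rightarrow> ('a \<Rightarrow> 'a \<Rightarrow> enat) \<Rightarrow> 'a set set" where
  "wide_subsets S M = maximal_sets
    {A \<union> B | A B. disjoint_commuting S M A B \<and>
      (nonspherical S M A \<and> nonspherical S M B \<or>
       irreducible_subset S M A \<and> affine_subset S M A \<and> 3 \<le> card A \<and> spherical S M B)}"

definition slab_subsets :: "'a::finite set \<Rightarrow> ('a \<Rightarrow> 'a \<Rightarrow> enat) \<Rightarrow> 'a set set" where
  "slab_subsets S M = maximal_sets
    {A \<union> K | A K. disjoint_commuting S M A K \<and> minimal_nonspherical S M A \<and>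
      K \<noteq> {} \<and> spherical S M K \<and> \<not> (\<exists>T\<in>wide_subsets S M. A \<union> K \<subseteq> T)}"

definition overlap_equiv ::
    "'a set \<Rightarrow> ('a \<Rightarrow> 'a \<Rightarrow> enat) \<Rightarrow> 'a set set \<Rightarrow> ('a set \<times> 'a set) set" where
  "overlap_equiv S M \<L> = {(T, U). T \<in> \<L> \<and> U \<in> \<L> \<and> nonspherical S M (T \<inter> U)}\<^sup>*"

text \<open>The index is shifted by one: \<open>Lambda_shift S M k\<close> is \<open>\<Lambda>\<^sub>i(S)\<close> for \<open>i = k - 1\<close>.\<close>

fun Lambda_shift :: "'a::finite set \<Rightarrow> ('a \<Rightarrow> 'a \<Rightarrow> enat) \<Rightarrow> nat \<Rightarrow> 'a set set" where
  "Lambda_shift S M 0 = {}"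
| "Lambda_shift S M (Suc 0) = wide_subsets S M \<union> slab_subsets S M"
| "Lambda_shift S M (Suc (Suc k)) =
    (let \<L> = Lambda_shift S M (Suc k) in Union ` (\<L> // overlap_equiv S M \<L>))"

definition hypergraph_index :: "'a::finite set \<Rightarrow> ('a \<Rightarrow> 'a \<Rightarrow> enat) \<Rightarrow> enat" where
  "hypergraph_index S M =
    (if wide_subsets S M \<noteq> {} \<and> (\<exists>h. S \<in> Lambda_shift S M (Suc h) - Lambda_shift S M h)
     then enat (THE h. S \<in> Lambda_shift S M (Suc h) - Lambda_shift S M h)
     else \<infinity>)"


section \<open>Duplexes\<close>

text \<open>The two copies \<open>u'\<close> and \<open>u''\<close> of \<open>u\<close> are \<open>(u, False)\<close> and \<open>(u, True)\<close>.\<close>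

definition duplex_gens :: "'a set \<Rightarrow> ('a \<times> bool) set" where
  "duplex_gens S = S \<times> UNIV"

text \<open>This is meant for right-angled \<open>M\<close>, so that off-diagonal values other than \<open>2\<close> are \<open>\<infinity>\<close>.\<close>

definition duplex_matrix ::
    "nat \<Rightarrow> enat \<Rightarrow> ('a \<Rightarrow> 'a \<Rightarrow> enat) \<Rightarrow> 'a \<times> bool \<Rightarrow> 'a \<times> bool \<Rightarrow> enat" where
  "duplex_matrix m n M = (\<lambda>(u, i) (v, j).
    if u = v then (if i = j then 1 else enat m)
    else if M u v = 2 then 2 else n)"

lemma coxeter_matrix_duplex:
  assumes "coxeter_matrix S M" "2 \<le> m" "2 \<le> n"
  shows "coxeter_matrix (duplex_gens S) (duplex_matrix m n M)"
proof -
  have "(2::enat) \<le> enat m"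
    using assms(2) by (simp add: numeral_eq_enat)
  then show ?thesis
    using assms by (auto simp: coxeter_matrix_def duplex_gens_def duplex_matrix_def)
qed

end

theory Submission
  imports Defs
begin

text \<open>
  Doubling a right-angled system hardly changes which sets are nonspherical. If \<open>u\<close> and \<open>v\<close> have label
  \<open>\<infinity>\<close> in \<open>S\<close>, then their copies in the duplex include the triple \<open>u'\<close>, \<open>v'\<close>, \<open>u''\<close>, in which two labels equal
  \<open>n \<ge> 5\<close>, and such a triple generates an infinite group. Pairwise commuting generators, on the other hand,
  double to commuting dihedral groups of order \<open>2 m\<close>. So doubles of nonspherical sets and projections of
  nonspherical sets are nonspherical (\<open>nonspherical_doubled\<close>, \<open>nonspherical_fst\<close>). Everything else about
  the duplex follows from these two facts and from the commutation of generators.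

  The Tits representation shows that generators with a label other than \<open>2\<close> do not commute, and that
  generators with a label of at least \<open>5\<close> satisfy no braid relation of length three or four. Averaging an
  inner product over a finite special subgroup shows that the Tits form is positive on the span of its
  connected sets of generators, which fails at the vector
  \<open>e\<^sub>s + \<surd>2 e\<^sub>t + e\<^sub>u\<close> if the labels of \<open>s, t\<close> and of \<open>t, u\<close> are at least \<open>5\<close>
  (\<open>nonspherical_hyperbolic_triple\<close>). The same vector, formed from outward unit normals of a polytope,
  shows that an affine subset contains no such triple (\<open>affine_subset_no_hyperbolic_triple\<close>): the chamber
  condition bounds the angles between the walls through the signs of a few roots. Since an
  irreducible set with at least three generators contains such a triple in both systems, affine
  subsets contribute no wide subsets. The wide subsets of the duplex are then the doubles of the wide
  subsets of \<open>S\<close> (\<open>wide_subsets_duplex\<close>).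

  Slabs do not correspond in this way: one slab of \<open>S\<close> has several counterparts in the duplex, and for
  finite \<open>n\<close> there are also slabs over paths of three generators of \<open>S\<close>. They matter little, however. A slab
  with minimal nonspherical factor \<open>A\<close> is the union of \<open>A\<close> and its link, and it overlaps another set in a
  nonspherical set only if that set contains \<open>A\<close>. So it never connects sets that do not overlap already,
  and all it does is add the link of \<open>A\<close> to a set that contains \<open>A\<close>. Hence the members of \<open>\<Lambda>\<^sub>i\<close> that
  contain a wide subset can be computed from the wide subsets alone, with each set replaced by a hull that contains the links of all its minimal
  nonspherical subsets (\<open>Lambda_shift_decomposition\<close>), and these hulls commute with doubling
  (\<open>hull_of_doubled\<close>). If there are wide subsets at all, then \<open>S\<close> itself is not a slab, so the slabs that
  never merge do not affect the index either.
\<close>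

section \<open>Groups given by generators and relations\<close>

lemma pres_eq_words:
  assumes "pres_eq X R v w"
  shows "v \<in> words_over X" "w \<in> words_over X"
  using assms by (induction) auto

lemma pres_eq_context:
  assumes "pres_eq X R v w" "a \<in> words_over X" "b \<in> words_over X"
  shows "pres_eq X R (a @ v @ b) (a @ w @ b)"
  using assms
proof (induction rule: pres_eq.induct)
  case (refl w)
  then show ?case by (intro pres_eq.refl) auto
next
  case (sym v w)
  then show ?case by (simp add: pres_eq.sym)
next
  case (trans u v w)
  then show ?case using pres_eq.trans by metis
next
  case (cancel u v x e)
  then show ?case using pres_eq.cancel[of "a @ u" X "v @ b" x R e] by simp
next
  case (relator u v r)
  then show ?case using pres_eq.relator[of "a @ u" X "v @ b" r R] by simp
qed

lemma pres_eq_append: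
  assumes "pres_eq X R v v'" "pres_eq X R w w'"
  shows "pres_eq X R (v @ w) (v' @ w')"
proof -
  have "pres_eq X R ([] @ v @ w) ([] @ v' @ w)"
    using pres_eq_context[OF assms(1), of "[]" w] pres_eq_words[OF assms(2)] by simp
  moreover have "pres_eq X R (v' @ w @ []) (v' @ w' @ [])"
    using pres_eq_context[OF assms(2), of "v'" "[]"] pres_eq_words[OF assms(1)] by simp
  ultimately show ?thesis using pres_eq.trans by fastforce
qed

lemma pres_class_eq_iff:
  assumes "w \<in> words_over X"
  shows "pres_class X R v = pres_class X R w \<longleftrightarrow> pres_eq X R v w"
proof
  assume eq: "pres_class X R v = pres_class X R w"
  have "w \<in> pres_class X R w" using assms by (simp add: pres_class_def pres_eq.refl)
  then have "w \<in> pres_class X R v" by (simp only: eq)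
  then show "pres_eq X R v w" by (simp add: pres_class_def)
next
  assume vw: "pres_eq X R v w"
  have "pres_eq X R v u \<longleftrightarrow> pres_eq X R w u" for u
    using pres_eq.trans[OF vw] pres_eq.trans[OF pres_eq.sym[OF vw]] by blast
  then show "pres_class X R v = pres_class X R w" by (simp add: pres_class_def)
qed

lemma carrier_presented_group:
  "carrier (presented_group X R) = pres_class X R ` words_over X"
  by (simp add: presented_group_def)

lemma one_presented_group: "\<one>\<^bsub>presented_group X R\<^esub> = pres_class X R []"
  by (simp add: presented_group_def)

lemma mult_presented_group:
  assumes "v \<in> words_over X" "w \<in> words_over X"
  shows "pres_class X R v \<otimes>\<^bsub>presented_group X R\<^esub> pres_class X R w = pres_class X R (v @ w)"
proof -
  have eq: "pres_class X R (v' @ w') = pres_class X R (v @ w)"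
    if "v' \<in> pres_class X R v" "w' \<in> pres_class X R w" for v' w'
  proof -
    have "pres_eq X R (v' @ w') (v @ w)"
      using pres_eq.sym[OF pres_eq_append[of X R v v' w w']] that by (simp add: pres_class_def)
    moreover have "v @ w \<in> words_over X" using assms by auto
    ultimately show ?thesis by (simp add: pres_class_eq_iff)
  qed
  have ne: "pres_class X R v \<noteq> {}" "pres_class X R w \<noteq> {}"
    using assms by (auto simp: pres_class_def intro: pres_eq.refl)
  have "(\<Union>a\<in>pres_class X R v. \<Union>b\<in>pres_class X R w. pres_class X R (a @ b)) =
      (\<Union>a\<in>pres_class X R v. \<Union>b\<in>pres_class X R w. pres_class X R (v @ w))"
    by (intro SUP_cong HOL.refl eq)
  also have "\<dots> = pres_class X R (v @ w)" using ne by simp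
  finally show ?thesis by (simp add: presented_group_def)
qed

lemma pres_eq_inverse_word:
  assumes "w \<in> words_over X"
  shows "pres_eq X R (rev (map (\<lambda>(x, e). (x, \<not> e)) w) @ w) []"
  using assms
proof (induction w)
  case Nil
  then show ?case by (auto intro: pres_eq.refl)
next
  case (Cons p w)
  obtain x e where p: "p = (x, e)" by (cases p)
  let ?i = "rev (map (\<lambda>(x, e). (x, \<not> e)) w)"
  have "w \<in> words_over X" "x \<in> X" using Cons.hyps p by simp_all
  moreover from this have "?i \<in> words_over X" by (fastforce simp: in_lists_conv_set)
  ultimately have "pres_eq X R (?i @ [(x, \<not> e), (x, \<not> \<not> e)] @ w) (?i @ w)"
    by (intro pres_eq.cancel)
  then show ?case using Cons p pres_eq.trans by fastforce
qed

lemma group_presented_group: "group (presented_group X R)"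
proof (rule groupI)
  fix A B C
  assume "A \<in> carrier (presented_group X R)" "B \<in> carrier (presented_group X R)"
    "C \<in> carrier (presented_group X R)"
  then obtain u v w where "u \<in> words_over X" "A = pres_class X R u" "v \<in> words_over X"
    "B = pres_class X R v" "w \<in> words_over X" "C = pres_class X R w"
    by (auto simp: carrier_presented_group)
  then show "A \<otimes>\<^bsub>presented_group X R\<^esub> B \<otimes>\<^bsub>presented_group X R\<^esub> C =
      A \<otimes>\<^bsub>presented_group X R\<^esub> (B \<otimes>\<^bsub>presented_group X R\<^esub> C)"
    by (simp add: mult_presented_group)
next
  fix A assume "A \<in> carrier (presented_group X R)"
  then obtain w where w: "w \<in> words_over X" "A = pres_class X R w"
    by (auto simp: carrier_presented_group)
  let ?i = "rev (map (\<lambda>(x, e). (x, \<not> e)) w)"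
  have i: "?i \<in> words_over X" using w by (fastforce simp: in_lists_conv_set)
  have "pres_class X R (?i @ w) = pres_class X R []"
    using pres_eq_inverse_word[OF w(1), of R] by (subst pres_class_eq_iff) auto
  then show "\<exists>B\<in>carrier (presented_group X R).
      B \<otimes>\<^bsub>presented_group X R\<^esub> A = \<one>\<^bsub>presented_group X R\<^esub>"
    using i w by (intro bexI[of _ "pres_class X R ?i"])
      (auto simp: mult_presented_group one_presented_group carrier_presented_group)
next
  fix A B assume "A \<in> carrier (presented_group X R)" "B \<in> carrier (presented_group X R)"
  then obtain v w where "v \<in> words_over X" "A = pres_class X R v" "w \<in> words_over X"
    "B = pres_class X R w"
    by (auto simp: carrier_presented_group)
  then show "A \<otimes>\<^bsub>presented_group X R\<^esub> B \<in> carrier (presented_group X R)"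
    by (simp add: mult_presented_group carrier_presented_group del: in_lists_conv_set)
next
  show "\<one>\<^bsub>presented_group X R\<^esub> \<in> carrier (presented_group X R)"
    by (auto simp: carrier_presented_group one_presented_group)
next
  fix A assume "A \<in> carrier (presented_group X R)"
  then obtain v where "v \<in> words_over X" "A = pres_class X R v"
    by (auto simp: carrier_presented_group)
  then show "\<one>\<^bsub>presented_group X R\<^esub> \<otimes>\<^bsub>presented_group X R\<^esub> A = A"
    using mult_presented_group[of "[]" X v R] by (simp add: one_presented_group)
qed

section \<open>Groups generated by involutions\<close>

context group
begin

text \<open>Involutions need no inverses, so stability under right multiplication by the generators is enough
  to bound the generated subgroup from above.\<close>

lemma generate_subset_right_closed:
  assumes "X \<subseteq> carrier G" "\<And>x. x \<in> X \<Longrightarrow> x \<otimes> x = \<one>" "Y \<subseteq> carrier G" "\<one> \<in> Y"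
    and closed: "\<And>x y. x \<in> X \<Longrightarrow> y \<in> Y \<Longrightarrow> y \<otimes> x \<in> Y"
  shows "generate G X \<subseteq> Y"
proof
  fix g assume g: "g \<in> generate G X"
  then have "\<forall>y\<in>Y. y \<otimes> g \<in> Y"
  proof (induction rule: generate.induct)
    case one
    then show ?case using assms(3) by (auto simp: subset_iff)
  next
    case (incl h)
    then show ?case using closed by blast
  next
    case (inv h)
    then have "inv h = h" using assms(1,2) by (simp add: inv_equality subset_iff)
    then show ?case using closed inv by auto
  next
    case (eng h1 h2)
    have "y \<otimes> (h1 \<otimes> h2) = y \<otimes> h1 \<otimes> h2" if "y \<in> Y" for y
      using that assms(3) eng generate_in_carrier[OF assms(1)] by (simp add: m_assoc subset_iff)
    then show ?case using eng by simp
  qed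
  moreover have "g \<in> carrier G" using generate_in_carrier[OF assms(1) g] .
  ultimately show "g \<in> Y" using assms(4) by (metis l_one)
qed

lemma generate_commutes:
  assumes "X \<subseteq> carrier G" "\<And>x. x \<in> X \<Longrightarrow> x \<otimes> x = \<one>" "g \<in> generate G X"
    and "y \<in> carrier G" "\<And>x. x \<in> X \<Longrightarrow> x \<otimes> y = y \<otimes> x"
  shows "g \<otimes> y = y \<otimes> g"
  using assms(3)
proof (induction rule: generate.induct)
  case (inv h)
  then have "inv h = h" using assms(1,2) by (simp add: inv_equality subset_iff)
  then show ?case using assms(5) inv by simp
next
  case (eng h1 h2)
  have c: "h1 \<in> carrier G" "h2 \<in> carrier G" using eng generate_in_carrier[OF assms(1)] by auto
  have "h1 \<otimes> h2 \<otimes> y = h1 \<otimes> (y \<otimes> h2)" using c assms(4) eng by (simp add: m_assoc)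
  also have "\<dots> = h1 \<otimes> y \<otimes> h2" using c assms(4) by (simp add: m_assoc)
  also have "\<dots> = y \<otimes> (h1 \<otimes> h2)" using c assms(4) eng by (simp add: m_assoc)
  finally show ?case .
qed (use assms in auto)

text \<open>Elements of the first subgroup can be moved to the left past those of the second, so every element
  is a product of one factor from each.\<close>

lemma finite_generate_commuting_Un:
  assumes X: "X \<subseteq> carrier G" "\<And>x. x \<in> X \<Longrightarrow> x \<otimes> x = \<one>" "finite (generate G X)"
    and Z: "Z \<subseteq> carrier G" "\<And>x. x \<in> Z \<Longrightarrow> x \<otimes> x = \<one>" "finite (generate G Z)"
    and comm: "\<And>x z. x \<in> X \<Longrightarrow> z \<in> Z \<Longrightarrow> x \<otimes> z = z \<otimes> x"
  shows "finite (generate G (X \<union> Z))"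
proof -
  let ?Y = "(\<lambda>(g, h). g \<otimes> h) ` (generate G X \<times> generate G Z)"
  note cX = generate_in_carrier[OF X(1)] and cZ = generate_in_carrier[OF Z(1)]
  have "generate G (X \<union> Z) \<subseteq> ?Y"
  proof (rule generate_subset_right_closed)
    have "\<one> = \<one> \<otimes> \<one>" by simp
    then show "\<one> \<in> ?Y" by (force intro: generate.one)
    fix x y assume x: "x \<in> X \<union> Z" and "y \<in> ?Y"
    then obtain g h where gh: "y = g \<otimes> h" "g \<in> generate G X" "h \<in> generate G Z" by auto
    from x show "y \<otimes> x \<in> ?Y"
    proof
      assume "x \<in> X"
      moreover from this have "h \<otimes> x = x \<otimes> h"
        using generate_commutes[OF Z(1,2) gh(3), of x] comm X(1) by auto
      ultimately have "y \<otimes> x = (g \<otimes> x) \<otimes> h" using gh cX cZ X(1) by (simp add: m_assoc subset_iff)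
      moreover have "g \<otimes> x \<in> generate G X" using gh \<open>x \<in> X\<close> by (auto intro: generate.intros)
      ultimately show ?thesis using gh by auto
    next
      assume "x \<in> Z"
      then have "y \<otimes> x = g \<otimes> (h \<otimes> x)" using gh cX cZ Z(1) by (simp add: m_assoc subset_iff)
      moreover have "h \<otimes> x \<in> generate G Z" using gh \<open>x \<in> Z\<close> by (auto intro: generate.intros)
      ultimately show ?thesis using gh by auto
    qed
  next
    show "?Y \<subseteq> carrier G" using cX cZ by auto
  qed (use X(1,2) Z(1,2) in auto)
  then show ?thesis using X(3) Z(3) by (auto intro: finite_subset)
qed

text \<open>The group is dihedral: its elements are the powers of \<open>a b\<close> and their products with \<open>a\<close>, and the
  exponent counts modulo \<open>k\<close>. Right multiplication by \<open>b\<close> lowers the exponent, which is why exponents are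
  shifted by \<open>k\<close> below.\<close>

lemma finite_generate_two_involutions:
  assumes c: "a \<in> carrier G" "b \<in> carrier G" and inv: "a \<otimes> a = \<one>" "b \<otimes> b = \<one>"
    and pow: "(a \<otimes> b) [^] (k::nat) = \<one>" "k > 0"
  shows "finite (generate G {a, b})"
proof -
  let ?r = "\<lambda>i. (a \<otimes> b) [^] (i::nat)"
  let ?Y = "?r ` {..<k} \<union> (\<lambda>i. ?r i \<otimes> a) ` {..<k}"
  have r: "?r i \<in> carrier G" for i using c by simp
  have mod: "?r i = ?r (i mod k)" for i
  proof -
    have "?r i = (?r k) [^] (i div k) \<otimes> ?r (i mod k)"
      using c by (simp add: nat_pow_pow nat_pow_mult)
    then show ?thesis using pow c by simp
  qed
  have in_Y: "?r i \<in> ?Y" "?r i \<otimes> a \<in> ?Y" for i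
    using mod[of i] pow(2) by (auto simp: image_iff intro: bexI[of _ "i mod k"])
  have "generate G {a, b} \<subseteq> ?Y"
  proof (rule generate_subset_right_closed)
    show "\<one> \<in> ?Y" using in_Y(1)[of 0] by simp
    fix x y assume x: "x \<in> {a, b}" and "y \<in> ?Y"
    then obtain i where i: "y = ?r i \<or> y = ?r i \<otimes> a" by auto
    have "?r i \<otimes> b \<in> ?Y"
    proof -
      have "?r i = ?r (i + k)" using pow c by (simp flip: nat_pow_mult)
      also have "i + k = Suc (i + k - 1)" using pow(2) by simp
      finally have "?r i = ?r (i + k - 1) \<otimes> (a \<otimes> b)" by (simp only: nat_pow_Suc)
      then have "?r i \<otimes> b = ?r (i + k - 1) \<otimes> a"
        using c inv r[of "i + k - 1"] by (simp add: m_assoc)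
      then show ?thesis using in_Y(2)[of "i + k - 1"] by simp
    qed
    moreover have "?r i \<otimes> a \<otimes> a = ?r i" using c inv r by (simp add: m_assoc)
    moreover have "?r i \<otimes> a \<otimes> b = ?r (Suc i)" using c r by (simp add: m_assoc)
    ultimately show "y \<otimes> x \<in> ?Y" using x i in_Y(1)[of i] in_Y(1)[of "Suc i"] in_Y(2)[of i]
      by (elim insertE emptyE disjE) (simp_all only:)
  qed (use c inv in auto)
  then show ?thesis by (rule finite_subset) auto
qed

end


section \<open>Special subgroups of a Coxeter group\<close>

lemma group_coxeter_group: "group (coxeter_group S M)"
  by (simp add: coxeter_group_def group_presented_group)

lemma mult_coxeter_group:
  assumes "v \<in> words_over S" "w \<in> words_over S"
  shows "pres_class S (coxeter_relators S M) v \<otimes>\<^bsub>coxeter_group S M\<^esub>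
    pres_class S (coxeter_relators S M) w = pres_class S (coxeter_relators S M) (v @ w)"
  unfolding coxeter_group_def by (rule mult_presented_group[OF assms])

lemma cox_gen_in_carrier: "s \<in> S \<Longrightarrow> cox_gen S M s \<in> carrier (coxeter_group S M)"
  by (auto simp: coxeter_group_def carrier_presented_group cox_gen_def)

definition gen_word :: "'a list \<Rightarrow> 'a word" where
  "gen_word xs = map (\<lambda>x. (x, True)) xs"

lemma gen_word_in_words: "set xs \<subseteq> S \<Longrightarrow> gen_word xs \<in> words_over S"
  by (auto simp: gen_word_def)

lemma alternating_word_in_words:
  "s \<in> S \<Longrightarrow> t \<in> S \<Longrightarrow> concat (replicate k [(s, True), (t, True)]) \<in> words_over S"
  by (induction k) simp_all

lemma cox_gen_pow:
  assumes "s \<in> S" "t \<in> S"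
  shows "(cox_gen S M s \<otimes>\<^bsub>coxeter_group S M\<^esub> cox_gen S M t) [^]\<^bsub>coxeter_group S M\<^esub> k =
    pres_class S (coxeter_relators S M) (concat (replicate k [(s, True), (t, True)]))"
proof (induction k)
  case 0
  then show ?case by (simp add: coxeter_group_def one_presented_group)
next
  case (Suc k)
  have w: "concat (replicate k [(s, True), (t, True)]) \<in> words_over S"
    "[(s, True), (t, True)] \<in> words_over S"
    using alternating_word_in_words[OF assms] assms by simp_all
  have "cox_gen S M s \<otimes>\<^bsub>coxeter_group S M\<^esub> cox_gen S M t =
      pres_class S (coxeter_relators S M) [(s, True), (t, True)]"
    using assms mult_coxeter_group[of "[(s, True)]" S "[(t, True)]" M] by (simp add: cox_gen_def)
  moreover have "concat (replicate (Suc k) [(s, True), (t, True)]) =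
      concat (replicate k [(s, True), (t, True)]) @ [(s, True), (t, True)]"
    by (simp flip: replicate_append_same)
  ultimately show ?case using Suc mult_coxeter_group[OF w, of M] by simp
qed

lemma cox_gen_pow_eq_one:
  assumes "s \<in> S" "t \<in> S" "M s t = enat k"
  shows "(cox_gen S M s \<otimes>\<^bsub>coxeter_group S M\<^esub> cox_gen S M t) [^]\<^bsub>coxeter_group S M\<^esub> k =
    \<one>\<^bsub>coxeter_group S M\<^esub>"
proof -
  let ?r = "concat (replicate k [(s, True), (t, True)])"
  have r: "?r \<in> words_over S" using alternating_word_in_words[OF assms(1,2)] .
  have "?r \<in> coxeter_relators S M" using assms by (auto simp: coxeter_relators_def)
  then have "pres_eq S (coxeter_relators S M) ([] @ ?r @ []) ([] @ [])"
    using r by (intro pres_eq.relator) auto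
  then show ?thesis using assms r
    by (simp add: cox_gen_pow) (simp add: coxeter_group_def one_presented_group pres_class_eq_iff)
qed

lemma cox_gen_square:
  assumes "coxeter_matrix S M" "s \<in> S"
  shows "cox_gen S M s \<otimes>\<^bsub>coxeter_group S M\<^esub> cox_gen S M s = \<one>\<^bsub>coxeter_group S M\<^esub>"
proof -
  interpret group "coxeter_group S M" by (rule group_coxeter_group)
  have "M s s = enat 1" using assms by (simp add: coxeter_matrix_def one_enat_def)
  from cox_gen_pow_eq_one[where M = M, OF assms(2,2) this] show ?thesis
    using cox_gen_in_carrier[OF assms(2)] by simp
qed

lemma cox_gens_commute:
  assumes "coxeter_matrix S M" "s \<in> S" "t \<in> S" "M s t = 2"
  shows "cox_gen S M s \<otimes>\<^bsub>coxeter_group S M\<^esub> cox_gen S M t =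
    cox_gen S M t \<otimes>\<^bsub>coxeter_group S M\<^esub> cox_gen S M s"
proof -
  interpret group "coxeter_group S M" by (rule group_coxeter_group)
  let ?a = "cox_gen S M s" and ?b = "cox_gen S M t"
  have c: "?a \<in> carrier (coxeter_group S M)" "?b \<in> carrier (coxeter_group S M)"
    using assms by (auto intro: cox_gen_in_carrier)
  have "M s t = enat 2" using assms by (simp add: numeral_eq_enat)
  from cox_gen_pow_eq_one[where M = M, OF assms(2,3) this]
  have "(?a \<otimes>\<^bsub>coxeter_group S M\<^esub> ?b) \<otimes>\<^bsub>coxeter_group S M\<^esub> (?a \<otimes>\<^bsub>coxeter_group S M\<^esub> ?b) =
      \<one>\<^bsub>coxeter_group S M\<^esub>"
    using c by (simp add: numeral_2_eq_2)
  then have "inv\<^bsub>coxeter_group S M\<^esub> (?a \<otimes>\<^bsub>coxeter_group S M\<^esub> ?b) =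
      ?a \<otimes>\<^bsub>coxeter_group S M\<^esub> ?b"
    using c by (intro inv_equality) auto
  moreover have "inv\<^bsub>coxeter_group S M\<^esub> ?a = ?a" "inv\<^bsub>coxeter_group S M\<^esub> ?b = ?b"
    using c cox_gen_square[OF assms(1)] assms by (simp_all add: inv_equality)
  ultimately show ?thesis using c by (simp add: inv_mult_group)
qed

lemma spherical_subset:
  assumes "spherical S M T" "U \<subseteq> T"
  shows "spherical S M U"
proof -
  interpret group "coxeter_group S M" by (rule group_coxeter_group)
  have "special_subgroup S M U \<subseteq> special_subgroup S M T"
    unfolding special_subgroup_def using assms(2) by (intro mono_generate image_mono)
  then show ?thesis using assms unfolding spherical_def by (auto intro: finite_subset)
qed

lemma nonspherical_iff: "nonspherical S M T \<longleftrightarrow> T \<subseteq> S \<and> \<not> spherical S M T"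
  by (auto simp: nonspherical_def spherical_def)

lemma spherical_Un:
  assumes "coxeter_matrix S M" "spherical S M A" "spherical S M B" "disjoint_commuting S M A B"
  shows "spherical S M (A \<union> B)"
proof -
  interpret group "coxeter_group S M" by (rule group_coxeter_group)
  have S: "A \<subseteq> S" "B \<subseteq> S" using assms(2,3) by (auto simp: spherical_def)
  have "finite (generate (coxeter_group S M) (cox_gen S M ` A \<union> cox_gen S M ` B))"
  proof (rule finite_generate_commuting_Un)
    fix x z assume "x \<in> cox_gen S M ` A" "z \<in> cox_gen S M ` B"
    then show "x \<otimes>\<^bsub>coxeter_group S M\<^esub> z = z \<otimes>\<^bsub>coxeter_group S M\<^esub> x"
      using assms(4) by (auto simp: disjoint_commuting_def)
  qed (use assms(2,3) S in \<open>auto simp: spherical_def special_subgroup_def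
      intro!: cox_gen_square[OF assms(1)] cox_gen_in_carrier\<close>)
  then show ?thesis using S by (auto simp: spherical_def special_subgroup_def image_Un)
qed

lemma spherical_pair:
  assumes "coxeter_matrix S M" "s \<in> S" "t \<in> S" "M s t \<noteq> \<infinity>"
  shows "spherical S M {s, t}"
proof -
  interpret group "coxeter_group S M" by (rule group_coxeter_group)
  obtain k where k: "M s t = enat k" using assms(4) by auto
  have "k > 0"
  proof (cases "s = t")
    case True
    then show ?thesis using assms k by (simp add: coxeter_matrix_def one_enat_def)
  next
    case False
    then have "2 \<le> M s t" using assms by (simp add: coxeter_matrix_def)
    then show ?thesis using k by (simp add: numeral_eq_enat)
  qed
  then have "finite (generate (coxeter_group S M) {cox_gen S M s, cox_gen S M t})"
    using cox_gen_pow_eq_one[where M = M, OF assms(2,3) k] assms cox_gen_square[OF assms(1)]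
    by (intro finite_generate_two_involutions[where k = k]) (simp_all add: cox_gen_in_carrier)
  then show ?thesis using assms by (simp add: spherical_def special_subgroup_def)
qed

lemma spherical_singleton: "coxeter_matrix S M \<Longrightarrow> s \<in> S \<Longrightarrow> spherical S M {s}"
  using spherical_pair[of S M s s] by (simp add: coxeter_matrix_def one_enat_def)

text \<open>Positive words in \<open>T\<close> represent elements of \<open>W\<^sub>T\<close>; a finite \<open>W\<^sub>T\<close> therefore allows only finitely
  many linear maps as actions of such words.\<close>

lemma gen_word_in_special_subgroup:
  assumes "T \<subseteq> S" "set xs \<subseteq> T"
  shows "pres_class S (coxeter_relators S M) (gen_word xs) \<in> special_subgroup S M T"
  using assms(2)
proof (induction xs)
  case Nil
  then show ?case
    by (metis coxeter_group_def gen_word_def generate.one list.map(1) one_presented_group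
        special_subgroup_def)
next
  case (Cons x xs)
  then have "cox_gen S M x \<otimes>\<^bsub>coxeter_group S M\<^esub> pres_class S (coxeter_relators S M) (gen_word xs)
      \<in> special_subgroup S M T"
    unfolding special_subgroup_def by (auto intro: generate.intros)
  moreover have "cox_gen S M x \<otimes>\<^bsub>coxeter_group S M\<^esub>
      pres_class S (coxeter_relators S M) (gen_word xs) =
      pres_class S (coxeter_relators S M) (gen_word (x # xs))"
    using mult_coxeter_group[of "[(x, True)]" S "gen_word xs" M] gen_word_in_words[of xs S]
      Cons.prems assms(1)
    by (auto simp: cox_gen_def gen_word_def)
  ultimately show ?case by simp
qed


section \<open>The reflection representation\<close>

text \<open>The product of the two reflections is a rotation by \<open>2\<theta>\<close> in the plane of \<open>a\<close> and \<open>b\<close>. Iterating it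
  subtracts multiples of \<open>a\<close> and \<open>b\<close> whose coefficients \<open>q\<close> and \<open>p\<close> satisfy the recurrence of
  \<open>sin\<close> at multiples of \<open>\<theta>\<close>. So they are periodic with period \<open>k\<close>, and the recurrence forces their
  sums over a period to vanish.\<close>

lemma rotation_power_id:
  fixes f g :: "'v::real_vector \<Rightarrow> real" and a b :: 'v and k :: nat
  defines "\<theta> \<equiv> pi / real k"
  assumes k: "2 \<le> k"
    and f: "linear f" "f a = 1" "f b = - cos \<theta>" and g: "linear g" "g b = 1" "g a = - cos \<theta>"
  shows "(((\<lambda>x. x - (2 * f x) *\<^sub>R a) \<circ> (\<lambda>x. x - (2 * g x) *\<^sub>R b)) ^^ k) x = x"
proof -
  define c where "c = cos \<theta>"
  \<comment> \<open>the orbit of x; p j and q j are the values of g and f at the points where the next two reflections act\<close>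
  define P where "P j = (((\<lambda>x. x - (2 * f x) *\<^sub>R a) \<circ> (\<lambda>x. x - (2 * g x) *\<^sub>R b)) ^^ j) x" for j
  define p where "p j = g (P j)" for j
  define q where "q j = f (P j) + 2 * c * p j" for j
  have \<theta>: "0 < \<theta>" "\<theta> < pi" "2 * real k * \<theta> = 2 * pi"
    using k by (auto simp: \<theta>_def field_simps)
  have sin: "0 < sin \<theta>" using \<theta> by (intro sin_gt_zero)
  note lin = linear_diff[OF f(1)] linear_scale[OF f(1)] linear_diff[OF g(1)] linear_scale[OF g(1)]
  have P_Suc: "P (Suc j) = P j - (2 * p j) *\<^sub>R b - (2 * q j) *\<^sub>R a" for j
    by (simp add: P_def p_def q_def lin f c_def algebra_simps)
  have p_Suc: "p (Suc j) = 2 * c * q j - p j" for j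
    by (simp add: p_def P_Suc lin g) (simp add: p_def c_def algebra_simps)
  have q_Suc: "q (Suc j) = 2 * c * p (Suc j) - q j" for j
    by (simp add: q_def P_Suc lin f) (simp add: q_def c_def algebra_simps)
  have step: "2 * c * sin y = sin (y + \<theta>) + sin (y - \<theta>)" for y
    by (simp add: c_def sin_add sin_diff)
  have closed: "p j * sin \<theta> = sin ((2 * real j + 1) * \<theta>) * p 0 + sin (2 * real j * \<theta>) * f x \<and>
      q j * sin \<theta> = sin ((2 * real j + 2) * \<theta>) * p 0 + sin ((2 * real j + 1) * \<theta>) * f x" for j
  proof (induction j)
    case 0
    have "q 0 = f x + 2 * c * p 0" by (simp add: q_def P_def)
    then show ?case using step[of \<theta>] by (simp add: algebra_simps)
  next
    case (Suc j)
    have "p (Suc j) * sin \<theta> = 2 * c * (q j * sin \<theta>) - p j * sin \<theta>"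
      by (simp add: p_Suc algebra_simps)
    also have "\<dots> = sin ((2 * real (Suc j) + 1) * \<theta>) * p 0 + sin (2 * real (Suc j) * \<theta>) * f x"
      using Suc step[of "(2 * real j + 2) * \<theta>"] step[of "(2 * real j + 1) * \<theta>"]
      by (simp add: algebra_simps)
    finally have 1: "p (Suc j) * sin \<theta> =
      sin ((2 * real (Suc j) + 1) * \<theta>) * p 0 + sin (2 * real (Suc j) * \<theta>) * f x" .
    have "q (Suc j) * sin \<theta> = 2 * c * (p (Suc j) * sin \<theta>) - q j * sin \<theta>"
      by (simp add: q_Suc algebra_simps)
    also have "\<dots> = sin ((2 * real (Suc j) + 2) * \<theta>) * p 0 + sin ((2 * real (Suc j) + 1) * \<theta>) * f x"
      unfolding 1
      using Suc step[of "(2 * real j + 3) * \<theta>"] step[of "(2 * real j + 2) * \<theta>"]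
      by (simp add: algebra_simps)
    finally show ?case using 1 by blast
  qed
  have "p k * sin \<theta> = p 0 * sin \<theta>" "q k * sin \<theta> = q 0 * sin \<theta>"
    using closed[of k] closed[of 0] \<theta>(3) by (simp_all add: distrib_right sin_add)
  then have period: "p k = p 0" "q k = q 0" using sin by auto
  \<comment> \<open>sums over a full period do not change when shifted\<close>
  have shift: "(\<Sum>j<k. h (Suc j)) = (\<Sum>j<k. h j)" if "h k = h 0" for h :: "nat \<Rightarrow> real"
    using sum.lessThan_Suc[of h k] sum.lessThan_Suc_shift[of h k] that by simp
  have "(\<Sum>j<k. p j) + (\<Sum>j<k. p (Suc j)) = 2 * c * (\<Sum>j<k. q j)"
    by (simp add: p_Suc sum_subtractf sum_distrib_left)
  then have pq: "(\<Sum>j<k. p j) = c * (\<Sum>j<k. q j)" using shift[of p] period by simp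
  have "(\<Sum>j<k. q j) + (\<Sum>j<k. q (Suc j)) = 2 * c * (\<Sum>j<k. p (Suc j))"
    by (simp add: q_Suc sum_subtractf sum_distrib_left)
  then have qp: "(\<Sum>j<k. q j) = c * (\<Sum>j<k. p j)" using shift[of p] shift[of q] period by simp
  \<comment> \<open>the sums of p and of q over a period are c times each other, and c squared is less than 1\<close>
  have "(\<Sum>j<k. p j) * (1 - c\<^sup>2) = 0"
    using pq unfolding qp by (simp add: power2_eq_square algebra_simps)
  moreover have "1 - c\<^sup>2 = (sin \<theta>)\<^sup>2" by (simp add: c_def sin_squared_eq)
  ultimately have zero: "(\<Sum>j<k. p j) = 0" "(\<Sum>j<k. q j) = 0" using sin qp by auto
  have "P j = x - (2 * (\<Sum>i<j. p i)) *\<^sub>R b - (2 * (\<Sum>i<j. q i)) *\<^sub>R a" for j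
  proof (induction j)
    case 0
    then show ?case by (simp add: P_def)
  next
    case (Suc j)
    then show ?case by (simp only: P_Suc sum.lessThan_Suc) (simp add: algebra_simps)
  qed
  from this[of k] show ?thesis using zero by (simp add: P_def)
qed

text \<open>The entries of the matrix of the Tits form; \<open>tits_form M s\<close> is the product with the basis vector of
  \<open>s\<close>.\<close>

definition cox_coeff :: "('a \<Rightarrow> 'a \<Rightarrow> enat) \<Rightarrow> 'a \<Rightarrow> 'a \<Rightarrow> real" where
  "cox_coeff M s t = (if s = t then 1 else case M s t of enat k \<Rightarrow> - cos (pi / real k) | \<infinity> \<Rightarrow> - 1)"

definition tits_form :: "('a::finite \<Rightarrow> 'a \<Rightarrow> enat) \<Rightarrow> 'a \<Rightarrow> real ^ 'a \<Rightarrow> real" where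
  "tits_form M s v = (\<chi> t. cox_coeff M s t) \<bullet> v"

definition tits_reflection :: "('a::finite \<Rightarrow> 'a \<Rightarrow> enat) \<Rightarrow> 'a \<Rightarrow> real ^ 'a \<Rightarrow> real ^ 'a" where
  "tits_reflection M s v = v - (2 * tits_form M s v) *\<^sub>R axis s 1"

definition word_action :: "('a::finite \<Rightarrow> 'a \<Rightarrow> enat) \<Rightarrow> 'a word \<Rightarrow> real ^ 'a \<Rightarrow> real ^ 'a" where
  "word_action M w = foldr (\<lambda>(s, e) h. tits_reflection M s \<circ> h) w id"

lemma cox_coeff_self: "cox_coeff M s s = 1"
  by (simp add: cox_coeff_def)

lemma cox_coeff_sym:
  "coxeter_matrix S M \<Longrightarrow> s \<in> S \<Longrightarrow> t \<in> S \<Longrightarrow> cox_coeff M s t = cox_coeff M t s"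
  by (auto simp: cox_coeff_def coxeter_matrix_def)

text \<open>The coefficient decreases as the label grows, down to the limit \<open>- 1\<close> at \<open>\<infinity>\<close>.\<close>

lemma cox_coeff_upper_bound:
  assumes "s \<noteq> t" "enat j \<le> M s t" "0 < j"
  shows "cox_coeff M s t \<le> - cos (pi / real j)"
proof (cases "M s t")
  case (enat k)
  then have "j \<le> k" using assms by simp
  then have "cos (pi / real j) \<le> cos (pi / real k)"
    using assms by (intro cos_monotone_0_pi_le frac_le) (auto simp: field_simps)
  then show ?thesis using assms enat by (simp add: cox_coeff_def)
next
  case infinity
  then show ?thesis using assms by (simp add: cox_coeff_def)
qed

lemma cox_coeff_nonpos: "s \<noteq> t \<Longrightarrow> 2 \<le> M s t \<Longrightarrow> cox_coeff M s t \<le> 0"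
  using cox_coeff_upper_bound[of s t 2 M] by (simp add: numeral_eq_enat)

lemma cox_coeff_neg:
  assumes "s \<noteq> t" "2 \<le> M s t" "M s t \<noteq> 2"
  shows "cox_coeff M s t < 0"
proof -
  have "enat 3 \<le> M s t"
    using assms(2,3) by (cases "M s t") (auto simp: numeral_eq_enat)
  from cox_coeff_upper_bound[where M = M, OF assms(1) this] show ?thesis by (simp add: cos_60)
qed

text \<open>The bound \<open>- cos (\<pi> / 4)\<close> is what makes the label \<open>4\<close> the borderline in everything that follows:
  a path of two labels \<open>4\<close> is an affine diagram, a path of two larger labels is not.\<close>

lemma cox_coeff_large:
  assumes "s \<noteq> t" "5 \<le> M s t"
  shows "cox_coeff M s t < - sqrt 2 / 2"
proof -
  have "cos (pi / 4) < cos (pi / 5)"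
    by (intro cos_monotone_0_pi) (auto simp: field_simps)
  then show ?thesis
    using cox_coeff_upper_bound[of s t 5 M] assms by (simp add: cos_45 numeral_eq_enat)
qed

lemma linear_tits_form: "linear (tits_form M s)"
  unfolding tits_form_def by (rule bounded_linear.linear[OF bounded_linear_inner_right])

lemma tits_form_axis: "tits_form M s (axis t 1) = cox_coeff M s t"
  by (simp add: tits_form_def inner_axis)

lemma linear_tits_reflection: "linear (tits_reflection M s)"
proof -
  note lf = linear_add[OF linear_tits_form] linear_scale[OF linear_tits_form]
  show ?thesis
    by (rule linearI) (simp_all add: tits_reflection_def lf algebra_simps)
qed

lemma tits_reflection_involution: "tits_reflection M s (tits_reflection M s v) = v"
  by (simp add: tits_reflection_def linear_diff[OF linear_tits_form]
      linear_scale[OF linear_tits_form] tits_form_axis cox_coeff_self algebra_simps)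

lemma axis_one_component: "axis i 1 $ j = (if j = i then 1 else 0 :: real)"
  by (simp add: axis_def)

lemma word_action_simps:
  "word_action M [] = id"
  "word_action M ((s, e) # w) = tits_reflection M s \<circ> word_action M w"
  by (simp_all add: word_action_def)

lemma word_action_append: "word_action M (v @ w) = word_action M v \<circ> word_action M w"
  by (induction v) (auto simp: word_action_simps)

lemma linear_word_action: "linear (word_action M w)"
proof (induction w)
  case Nil
  then show ?case by (simp add: word_action_simps linear_id[unfolded id_def] id_def)
next
  case (Cons p w)
  obtain s e where "p = (s, e)" by (cases p)
  then show ?case using linear_compose[OF Cons linear_tits_reflection[of M s]]
    by (simp only: word_action_simps)
qed

text \<open>The reflections satisfy the Coxeter relations, so words act through the Coxeter group. The
  inequalities between group elements below are read off from the action on a single basis vector.\<close>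

lemma word_action_relator:
  assumes "coxeter_matrix S M" "r \<in> coxeter_relators S M"
  shows "word_action M r = id"
proof -
  obtain s t k where r: "r = concat (replicate k [(s, True), (t, True)])" "s \<in> S" "t \<in> S"
    "M s t = enat k"
    using assms(2) by (auto simp: coxeter_relators_def)
  have act: "word_action M (concat (replicate k [(s, True), (t, True)])) =
      (tits_reflection M s \<circ> tits_reflection M t) ^^ k" for k
    by (induction k) (auto simp: word_action_simps)
  show ?thesis
  proof (cases "s = t")
    case True
    then have "k = 1" using assms(1) r by (simp add: coxeter_matrix_def one_enat_def)
    with True show ?thesis using act[of k]
      by (auto simp: r(1) tits_reflection_involution)
  next
    case False
    then have "M t s = M s t" "2 \<le> M s t" using assms(1) r(2,3) by (simp_all add: coxeter_matrix_def)
    then have k: "2 \<le> k" "cox_coeff M s t = - cos (pi / real k)" "cox_coeff M t s = - cos (pi / real k)"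
      using False r by (simp_all add: numeral_eq_enat cox_coeff_def)
    have "((tits_reflection M s \<circ> tits_reflection M t) ^^ k) x = x" for x
      using rotation_power_id[where k = k and f = "tits_form M s" and a = "axis s 1"
          and g = "tits_form M t" and b = "axis t 1" and x = x] k
      by (simp only: linear_tits_form tits_form_axis cox_coeff_self flip: tits_reflection_def)
    then show ?thesis using act[of k] r(1) by auto
  qed
qed

lemma word_action_pres_eq:
  assumes "coxeter_matrix S M" "pres_eq S (coxeter_relators S M) v w"
  shows "word_action M v = word_action M w"
  using assms(2)
proof (induction rule: pres_eq.induct)
  case (cancel u v x e)
  then show ?case
    by (auto simp: word_action_append word_action_simps tits_reflection_involution fun_eq_iff)
next
  case (relator u v r)
  then show ?case using word_action_relator[OF assms(1)] by (simp add: word_action_append)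
qed simp_all

lemma word_action_class:
  assumes "coxeter_matrix S M" "w \<in> words_over S"
    and "pres_class S (coxeter_relators S M) v = pres_class S (coxeter_relators S M) w"
  shows "word_action M v = word_action M w"
  using word_action_pres_eq[OF assms(1)] pres_class_eq_iff[OF assms(2)] assms(3) by metis

text \<open>If \<open>M s t \<noteq> 2\<close> then \<open>s t\<close> and \<open>t s\<close> move the basis vector of \<open>s\<close> differently, because their
  effects on the coordinate \<open>t\<close> have opposite signs and are nonzero.\<close>

lemma cox_gens_commute_iff:
  fixes S :: "'a::finite set"
  assumes "coxeter_matrix S M" "s \<in> S" "t \<in> S" "s \<noteq> t"
  shows "cox_gen S M s \<otimes>\<^bsub>coxeter_group S M\<^esub> cox_gen S M t =
    cox_gen S M t \<otimes>\<^bsub>coxeter_group S M\<^esub> cox_gen S M s \<longleftrightarrow> M s t = 2"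
proof
  assume "cox_gen S M s \<otimes>\<^bsub>coxeter_group S M\<^esub> cox_gen S M t =
    cox_gen S M t \<otimes>\<^bsub>coxeter_group S M\<^esub> cox_gen S M s"
  then have "word_action M [(s, True), (t, True)] = word_action M [(t, True), (s, True)]"
    using assms mult_coxeter_group[of "[(s, True)]" S "[(t, True)]" M]
      mult_coxeter_group[of "[(t, True)]" S "[(s, True)]" M]
    by (intro word_action_class) (auto simp: cox_gen_def)
  then have "tits_reflection M s (tits_reflection M t (axis s 1)) $ t =
      tits_reflection M t (tits_reflection M s (axis s 1)) $ t"
    by (simp add: word_action_simps fun_eq_iff)
  moreover have "cox_coeff M s t = cox_coeff M t s" using cox_coeff_sym assms by metis
  ultimately have "cox_coeff M s t = 0"
    using assms(4) by (simp add: tits_reflection_def linear_diff[OF linear_tits_form]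
      linear_scale[OF linear_tits_form] tits_form_axis cox_coeff_self axis_one_component)
  then show "M s t = 2" using cox_coeff_neg[of s t M] assms by (auto simp: coxeter_matrix_def)
qed (use cox_gens_commute assms in metis)

text \<open>With \<open>C = - cox_coeff M s t\<close>, the two sides of the first relation act equally on the basis vector of
  \<open>s\<close> only if \<open>4 C\<^sup>2 = 1\<close>, those of the second only if \<open>C (2 C\<^sup>2 - 1) = 0\<close>. These are the labels \<open>3\<close>, and \<open>2\<close> or \<open>4\<close>.\<close>

lemma cox_gens_braid_neq:
  fixes S :: "'a::finite set"
  assumes "coxeter_matrix S M" "s \<in> S" "t \<in> S" "s \<noteq> t" "5 \<le> M s t"
  defines "G \<equiv> coxeter_group S M" and "a \<equiv> cox_gen S M s" and "b \<equiv> cox_gen S M t"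
  shows "a \<otimes>\<^bsub>G\<^esub> b \<otimes>\<^bsub>G\<^esub> a \<noteq> b \<otimes>\<^bsub>G\<^esub> a \<otimes>\<^bsub>G\<^esub> b"
    and "a \<otimes>\<^bsub>G\<^esub> b \<otimes>\<^bsub>G\<^esub> a \<otimes>\<^bsub>G\<^esub> b \<noteq> b \<otimes>\<^bsub>G\<^esub> a \<otimes>\<^bsub>G\<^esub> b \<otimes>\<^bsub>G\<^esub> a"
proof -
  define C where "C = - cox_coeff M s t"
  have C: "sqrt 2 / 2 < C" "cox_coeff M s t = - C" "cox_coeff M t s = - C"
    using cox_coeff_large[where M = M, OF assms(4,5)] cox_coeff_sym[OF assms(1-3)] by (auto simp: C_def)
  have "(sqrt 2 / 2)\<^sup>2 < C\<^sup>2" using C(1) by (intro power_strict_mono) auto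
  then have C2: "1 < 2 * C\<^sup>2" by (simp add: power_divide)
  have Cpos: "0 < C" using C(1) by (rule less_trans[rotated]) simp
  note mult = mult_coxeter_group[where S = S and M = M]
  have prod: "a \<otimes>\<^bsub>G\<^esub> b \<otimes>\<^bsub>G\<^esub> a = pres_class S (coxeter_relators S M) [(s, True), (t, True), (s, True)]"
    "b \<otimes>\<^bsub>G\<^esub> a \<otimes>\<^bsub>G\<^esub> b = pres_class S (coxeter_relators S M) [(t, True), (s, True), (t, True)]"
    "a \<otimes>\<^bsub>G\<^esub> b \<otimes>\<^bsub>G\<^esub> a \<otimes>\<^bsub>G\<^esub> b =
      pres_class S (coxeter_relators S M) [(s, True), (t, True), (s, True), (t, True)]"
    "b \<otimes>\<^bsub>G\<^esub> a \<otimes>\<^bsub>G\<^esub> b \<otimes>\<^bsub>G\<^esub> a =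
      pres_class S (coxeter_relators S M) [(t, True), (s, True), (t, True), (s, True)]"
    using assms(2,3) by (simp_all add: a_def b_def G_def cox_gen_def mult)
  let ?e = "axis s 1 :: real ^ 'a"
  note act = tits_reflection_def linear_diff[OF linear_tits_form] linear_add[OF linear_tits_form]
    linear_scale[OF linear_tits_form] tits_form_axis cox_coeff_self axis_one_component
  show "a \<otimes>\<^bsub>G\<^esub> b \<otimes>\<^bsub>G\<^esub> a \<noteq> b \<otimes>\<^bsub>G\<^esub> a \<otimes>\<^bsub>G\<^esub> b"
  proof
    assume "a \<otimes>\<^bsub>G\<^esub> b \<otimes>\<^bsub>G\<^esub> a = b \<otimes>\<^bsub>G\<^esub> a \<otimes>\<^bsub>G\<^esub> b"
    then have "word_action M [(s, True), (t, True), (s, True)] =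
        word_action M [(t, True), (s, True), (t, True)]"
      using assms(1-3) unfolding prod(1,2) by (intro word_action_class) simp_all
    then have "word_action M [(s, True), (t, True), (s, True)] ?e $ s =
        word_action M [(t, True), (s, True), (t, True)] ?e $ s" by simp
    then have "1 - 4 * C\<^sup>2 = 4 * C\<^sup>2 - 1"
      using assms(4) C(2,3) by (simp add: word_action_simps act power2_eq_square)
    then show False using C2 by simp
  qed
  show "a \<otimes>\<^bsub>G\<^esub> b \<otimes>\<^bsub>G\<^esub> a \<otimes>\<^bsub>G\<^esub> b \<noteq> b \<otimes>\<^bsub>G\<^esub> a \<otimes>\<^bsub>G\<^esub> b \<otimes>\<^bsub>G\<^esub> a"
  proof
    assume "a \<otimes>\<^bsub>G\<^esub> b \<otimes>\<^bsub>G\<^esub> a \<otimes>\<^bsub>G\<^esub> b = b \<otimes>\<^bsub>G\<^esub> a \<otimes>\<^bsub>G\<^esub> b \<otimes>\<^bsub>G\<^esub> a"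
    then have "word_action M [(s, True), (t, True), (s, True), (t, True)] =
        word_action M [(t, True), (s, True), (t, True), (s, True)]"
      using assms(1-3) unfolding prod(3,4) by (intro word_action_class) simp_all
    then have "word_action M [(s, True), (t, True), (s, True), (t, True)] ?e $ t =
        word_action M [(t, True), (s, True), (t, True), (s, True)] ?e $ t" by simp
    then have "C * (2 * C\<^sup>2 - 1) = 0"
      using assms(4) C(2,3) by (simp add: word_action_simps act power2_eq_square algebra_simps)
    then show False using C2 Cpos by simp
  qed
qed


section \<open>Infinite special subgroups\<close>

text \<open>The standard inner product is averaged over the finitely many maps by which \<open>W\<^sub>T\<close> acts. Invariance
  under the reflection of \<open>s\<close> then determines the product with the basis vector of \<open>s\<close> up to the
  factor \<open>Q (axis s 1) (axis s 1)\<close>. Hence on a connected set of generators \<open>Q\<close> is a positive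
  multiple of the Tits form, which must be positive definite there.\<close>

lemma spherical_invariant_inner_product:
  fixes S :: "'a::finite set"
  assumes "coxeter_matrix S M" "spherical S M T"
  shows "\<exists>Q :: real ^ 'a \<Rightarrow> real ^ 'a \<Rightarrow> real. (\<forall>u. linear (Q u)) \<and> (\<forall>u v. Q u v = Q v u) \<and>
    (\<forall>v. v \<noteq> 0 \<longrightarrow> 0 < Q v v) \<and>
    (\<forall>s\<in>T. \<forall>v. Q (axis s 1) v = tits_form M s v * Q (axis s 1) (axis s 1))"
proof -
  define A where "A = (word_action M \<circ> gen_word) ` {xs. set xs \<subseteq> T}"
  define Q where "Q u v = (\<Sum>h\<in>A. h u \<bullet> h v)" for u v
  have T: "T \<subseteq> S" "finite (special_subgroup S M T)" using assms(2) by (auto simp: spherical_def)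
  let ?c = "pres_class S (coxeter_relators S M)"
  have "A \<subseteq> (\<lambda>X. word_action M (SOME w. w \<in> words_over S \<and> X = ?c w)) ` special_subgroup S M T"
  proof
    fix h assume "h \<in> A"
    then obtain xs where xs: "h = word_action M (gen_word xs)" "set xs \<subseteq> T" by (auto simp: A_def)
    have w: "gen_word xs \<in> words_over S" using xs T by (intro gen_word_in_words) auto
    define w' where "w' = (SOME w. w \<in> words_over S \<and> ?c (gen_word xs) = ?c w)"
    have "w' \<in> words_over S \<and> ?c (gen_word xs) = ?c w'"
      unfolding w'_def by (rule someI[of "\<lambda>w. w \<in> words_over S \<and> ?c (gen_word xs) = ?c w" "gen_word xs"]) (use w in simp)
    then have "h = word_action M w'" using xs word_action_class[OF assms(1)] by metis
    moreover have "?c (gen_word xs) \<in> special_subgroup S M T"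
      using gen_word_in_special_subgroup[OF T(1) xs(2)] .
    ultimately show "h \<in> (\<lambda>X. word_action M (SOME w. w \<in> words_over S \<and> X = ?c w)) `
        special_subgroup S M T"
      unfolding w'_def by blast
  qed
  then have fin: "finite A" using T(2) by (rule finite_surj[rotated])
  \<comment> \<open>the summand of the identity makes the average positive definite\<close>
  have id: "id \<in> A"
    unfolding A_def by (rule image_eqI[of _ _ "[]"]) (auto simp: gen_word_def word_action_simps)
  have lin: "linear h" if "h \<in> A" for h using that linear_word_action by (auto simp: A_def)
  have comp: "h \<circ> tits_reflection M s \<in> A" if "h \<in> A" "s \<in> T" for h s
  proof -
    obtain xs where xs: "h = word_action M (gen_word xs)" "set xs \<subseteq> T"
      using \<open>h \<in> A\<close> by (auto simp: A_def)
    then have "h \<circ> tits_reflection M s = word_action M (gen_word (xs @ [s]))"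
      by (simp add: gen_word_def word_action_append word_action_simps)
    then show ?thesis using xs \<open>s \<in> T\<close> by (auto simp: A_def)
  qed
  have inv: "Q (tits_reflection M s u) (tits_reflection M s v) = Q u v" if "s \<in> T" for s u v
    unfolding Q_def
    by (rule sum.reindex_bij_witness[where i = "\<lambda>h. h \<circ> tits_reflection M s"
          and j = "\<lambda>h. h \<circ> tits_reflection M s"])
      (simp_all add: comp that fun_eq_iff tits_reflection_involution)
  show ?thesis
  proof (intro exI[of _ Q] conjI allI ballI impI)
    show lQ: "linear (Q u)" for u
    proof (rule linearI)
      show "Q u (v + w) = Q u v + Q u w" for v w
        unfolding Q_def sum.distrib[symmetric]
        by (intro sum.cong HOL.refl) (simp only: linear_add[OF lin] inner_add_right)
      show "Q u (r *\<^sub>R v) = r *\<^sub>R Q u v" for r v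
        unfolding Q_def scaleR_sum_right
        by (intro sum.cong HOL.refl) (simp only: linear_scale[OF lin] inner_scaleR_right real_scaleR_def)
    qed
    show sQ: "Q u v = Q v u" for u v by (simp add: Q_def inner_commute)
    show "0 < Q v v" if "v \<noteq> 0" for v
      unfolding Q_def using that fin id by (intro sum_pos2[of A id]) auto
    show "Q (axis s 1) v = tits_form M s v * Q (axis s 1) (axis s 1)" if "s \<in> T" for s v
    proof -
      have "tits_reflection M s (axis s 1) = - axis s 1"
        by (simp add: tits_reflection_def tits_form_axis cox_coeff_self)
          (simp add: scaleR_2)
      then have "Q (- axis s 1) (v - (2 * tits_form M s v) *\<^sub>R axis s 1) = Q (axis s 1) v"
        using inv[OF that, of "axis s 1" v] by (simp add: tits_reflection_def[of M s v])
      moreover have "Q (- u) w = - Q u w" for u w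
        using sQ[of "- u" w] sQ[of u w] linear_neg[OF lQ, of w u] by simp
      ultimately have "- (Q (axis s 1) v - 2 * tits_form M s v * Q (axis s 1) (axis s 1)) =
          Q (axis s 1) v"
        by (simp only: linear_diff[OF lQ] linear_scale[OF lQ] real_scaleR_def)
      then show ?thesis by linarith
    qed
  qed
qed

text \<open>The left side is \<open>\<bar>x + \<surd>2 y + z\<bar>\<^sup>2\<close> for unit vectors \<open>x\<close>, \<open>y\<close>, \<open>z\<close> with products \<open>\<alpha> = x y\<close>,
  \<open>\<beta> = y z\<close> and \<open>\<gamma> = x z\<close>. The weights \<open>1\<close>, \<open>\<surd>2\<close>, \<open>1\<close> span the radical of the affine diagram with
  labels \<open>4\<close>, \<open>4\<close>, so any larger labels make the value negative. It refutes both a finite group and a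
  Euclidean simplex.\<close>

lemma weighted_gram_sum_negative:
  fixes \<alpha> \<beta> \<gamma> :: real
  assumes "\<alpha> < - sqrt 2 / 2" "\<beta> < - sqrt 2 / 2" "\<gamma> \<le> 0"
  shows "4 + 2 * sqrt 2 * \<alpha> + 2 * sqrt 2 * \<beta> + 2 * \<gamma> < 0"
proof -
  have "sqrt 2 * \<alpha> < sqrt 2 * (- sqrt 2 / 2)" "sqrt 2 * \<beta> < sqrt 2 * (- sqrt 2 / 2)"
    using assms by (simp_all only: mult_less_cancel_left_pos real_sqrt_gt_0_iff zero_less_numeral)
  then have "sqrt 2 * \<alpha> < - 1" "sqrt 2 * \<beta> < - 1" by simp_all
  then show ?thesis using assms(3) by linarith
qed

text \<open>The sum of the two basis vectors is isotropic for the Tits form, which is therefore not positive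
  definite.\<close>

lemma nonspherical_infinite_pair:
  fixes S :: "'a::finite set"
  assumes "coxeter_matrix S M" "s \<in> S" "t \<in> S" "M s t = \<infinity>"
  shows "\<not> spherical S M {s, t}"
proof
  assume "spherical S M {s, t}"
  from spherical_invariant_inner_product[OF assms(1) this]
  obtain Q :: "real ^ 'a \<Rightarrow> real ^ 'a \<Rightarrow> real"
    where Q': "\<forall>u. linear (Q u)" "\<forall>u v. Q u v = Q v u" "\<forall>v. v \<noteq> 0 \<longrightarrow> 0 < Q v v"
    "\<forall>r\<in>{s, t}. \<forall>v. Q (axis r 1) v = tits_form M r v * Q (axis r 1) (axis r 1)"
    by (elim exE conjE)
  note Q = Q'(1)[rule_format] Q'(2)[rule_format] Q'(3)[rule_format] Q'(4)[rule_format]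
  have "s \<noteq> t" using assms by (auto simp: coxeter_matrix_def)
  let ?s = "axis s 1 :: real ^ 'a" and ?t = "axis t 1 :: real ^ 'a"
  have c: "cox_coeff M s t = - 1" using \<open>s \<noteq> t\<close> assms(4) by (simp add: cox_coeff_def)
  then have "cox_coeff M t s = - 1" using cox_coeff_sym[OF assms(1-3)] by simp
  then have st: "Q ?s ?t = - Q ?s ?s" "Q ?t ?s = - Q ?t ?t"
    using c Q(4)[of s ?t] Q(4)[of t ?s] by (simp_all add: tits_form_axis)
  have "Q (?s + ?t) (?s + ?t) = Q ?s ?s + Q ?s ?t + (Q ?t ?s + Q ?t ?t)"
    using Q(2)[of "?s + ?t" ?s] Q(2)[of "?s + ?t" ?t] by (simp add: linear_add[OF Q(1)])
  then have "Q (?s + ?t) (?s + ?t) = 0" using st by simp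
  moreover have "(?s + ?t) $ s \<noteq> 0 $ s" using \<open>s \<noteq> t\<close> by (simp add: axis_one_component)
  then have "?s + ?t \<noteq> 0" by metis
  ultimately show False using Q(3)[of "?s + ?t"] by simp
qed

lemma nonspherical_hyperbolic_triple:
  fixes S :: "'a::finite set"
  assumes "coxeter_matrix S M" "s \<in> S" "t \<in> S" "r \<in> S" "s \<noteq> t" "t \<noteq> r" "s \<noteq> r"
    and "5 \<le> M s t" "5 \<le> M t r"
  shows "\<not> spherical S M {s, t, r}"
proof
  assume "spherical S M {s, t, r}"
  from spherical_invariant_inner_product[OF assms(1) this]
  obtain Q :: "real ^ 'a \<Rightarrow> real ^ 'a \<Rightarrow> real"
    where Q': "\<forall>u. linear (Q u)" "\<forall>u v. Q u v = Q v u" "\<forall>v. v \<noteq> 0 \<longrightarrow> 0 < Q v v"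
    "\<forall>r\<in>{s, t, r}. \<forall>v. Q (axis r 1) v = tits_form M r v * Q (axis r 1) (axis r 1)"
    by (elim exE conjE)
  note Q = Q'(1)[rule_format] Q'(2)[rule_format] Q'(3)[rule_format] Q'(4)[rule_format]
  let ?s = "axis s 1 :: real ^ 'a" and ?t = "axis t 1 :: real ^ 'a" and ?r = "axis r 1 :: real ^ 'a"
  define \<alpha> \<beta> \<gamma> where "\<alpha> = cox_coeff M s t" and "\<beta> = cox_coeff M t r" and "\<gamma> = cox_coeff M s r"
  have coeffs: "\<alpha> < - sqrt 2 / 2" "\<beta> < - sqrt 2 / 2" "\<gamma> \<le> 0"
    using assms cox_coeff_large[of s t M] cox_coeff_large[of t r M] cox_coeff_nonpos[of s r M]
    by (auto simp: \<alpha>_def \<beta>_def \<gamma>_def coxeter_matrix_def)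
  moreover have "- sqrt 2 / 2 < 0" by simp
  ultimately have nz: "\<alpha> \<noteq> 0" "\<beta> \<noteq> 0" by linarith+
  define N where "N = Q ?s ?s"
  have st: "Q ?s ?t = \<alpha> * N" "Q ?s ?t = \<alpha> * Q ?t ?t"
    using Q(4)[of s ?t] Q(4)[of t ?s] Q(2)[of ?s ?t] cox_coeff_sym[OF assms(1-3)]
    by (simp_all add: tits_form_axis N_def \<alpha>_def)
  then have tt: "Q ?t ?t = N" using nz by simp
  have tr: "Q ?t ?r = \<beta> * N" "Q ?t ?r = \<beta> * Q ?r ?r"
    using Q(4)[of t ?r] Q(4)[of r ?t] Q(2)[of ?t ?r] cox_coeff_sym[OF assms(1,3,4)] tt
    by (simp_all add: tits_form_axis \<beta>_def)
  then have rr: "Q ?r ?r = N" using nz by simp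
  have sr: "Q ?s ?r = \<gamma> * N" using Q(4)[of s ?r] by (simp add: tits_form_axis N_def \<gamma>_def)
  \<comment> \<open>the weights of weighted_gram_sum_negative\<close>
  define v where "v = ?s + sqrt 2 *\<^sub>R ?t + ?r"
  have right: "Q u v = Q u ?s + sqrt 2 * Q u ?t + Q u ?r" for u
    unfolding v_def by (simp add: linear_add[OF Q(1)] linear_scale[OF Q(1)])
  have "Q v v = Q ?s v + sqrt 2 * Q ?t v + Q ?r v"
    using right[of v] Q(2)[of v ?s] Q(2)[of v ?t] Q(2)[of v ?r] by simp
  also have "\<dots> = N * (4 + 2 * sqrt 2 * \<alpha> + 2 * sqrt 2 * \<beta> + 2 * \<gamma>)"
  proof -
    have "Q ?s v = N + sqrt 2 * (\<alpha> * N) + \<gamma> * N" "Q ?t v = \<alpha> * N + sqrt 2 * N + \<beta> * N"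
      "Q ?r v = \<gamma> * N + sqrt 2 * (\<beta> * N) + N"
      using st(1) tr(1) tt rr sr Q(2)[of ?t ?s] Q(2)[of ?r ?t] Q(2)[of ?r ?s]
      by (simp_all add: right N_def)
    moreover have "sqrt 2 * (sqrt 2 * N) = 2 * N" by (simp flip: mult.assoc)
    ultimately show ?thesis by (simp add: algebra_simps)
  qed
  finally have Qv: "Q v v = N * (4 + 2 * sqrt 2 * \<alpha> + 2 * sqrt 2 * \<beta> + 2 * \<gamma>)" .
  have "0 < N" unfolding N_def by (intro Q(3)) (simp add: axis_eq_0_iff)
  then have "Q v v < 0"
    unfolding Qv by (intro mult_pos_neg weighted_gram_sum_negative coeffs)
  moreover have "v $ s \<noteq> 0 $ s" using assms(5,7) by (simp add: v_def axis_one_component)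
  then have "v \<noteq> 0" by metis
  ultimately show False using Q(3)[of v] by simp
qed


section \<open>Chambers of Euclidean reflection groups\<close>

text \<open>The outward unit normal \<open>e\<close> of a facet \<open>F\<close> of \<open>P\<close>, parallel to \<open>affine hull P\<close>.\<close>

definition facet_normal ::
    "'v::euclidean_space set \<Rightarrow> 'v set \<Rightarrow> 'v \<Rightarrow> real \<Rightarrow> bool" where
  "facet_normal P F e \<beta> \<longleftrightarrow> norm e = 1 \<and> F = P \<inter> {x. e \<bullet> x = \<beta>} \<and>
    (\<forall>x\<in>P. e \<bullet> x \<le> \<beta>) \<and> (\<forall>x\<in>rel_interior P. e \<bullet> x < \<beta>) \<and>
    (\<forall>x\<in>affine hull P. \<forall>t. x + t *\<^sub>R e \<in> affine hull P) \<and>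
    affine hull F = affine hull P \<inter> {x. e \<bullet> x = \<beta>}"

text \<open>Both sides are affine subspaces of codimension one in \<open>affine hull P\<close>.\<close>

lemma affine_hull_facet_eq:
  fixes P :: "'v::euclidean_space set"
  assumes "F facet_of P" "F = P \<inter> {x. e \<bullet> x = \<beta>}" "z \<in> P" "e \<bullet> z \<noteq> \<beta>"
  shows "affine hull F = affine hull P \<inter> {x. e \<bullet> x = \<beta>}"
proof (rule affine_dim_equal)
  let ?A = "affine hull P \<inter> {x. e \<bullet> x = \<beta>}"
  show aff: "affine ?A" using affine_affine_hull affine_hyperplane by (rule affine_Int)
  have F: "F \<noteq> {}" "aff_dim F = aff_dim P - 1" using assms(1) by (simp_all add: facet_of_def)
  have PA: "P \<subseteq> affine hull P" by (rule hull_subset)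
  then have FA: "F \<subseteq> ?A" unfolding assms(2) by blast
  then show "affine hull F \<subseteq> ?A" using aff by (rule hull_minimal)
  have "?A \<noteq> {}" using FA F(1) by blast
  moreover have "\<not> affine hull P \<subseteq> {x. e \<bullet> x = \<beta>}" using PA assms(3,4) by blast
  ultimately have "aff_dim ?A = aff_dim P - 1"
    by (simp only: aff_dim_affine_Int_hyperplane[OF affine_affine_hull] if_False aff_dim_affine_hull)
  then show "aff_dim (affine hull F) = aff_dim ?A" using F(2) by simp
  show "affine hull F \<noteq> {}" using F(1) by simp
  show "affine (affine hull F)" by (rule affine_affine_hull)
qed

text \<open>A minimal representation of \<open>P\<close> by half-spaces can be chosen such that the normals are parallel to
  \<open>affine hull P\<close>. The facets are cut out by the bounding hyperplanes of this representation.\<close>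

lemma facet_normal_exists:
  fixes P :: "'v::euclidean_space set"
  assumes "polytope P" "F facet_of P"
  shows "\<exists>e \<beta>. facet_normal P F e \<beta>"
proof -
  have "polyhedron P" using assms(1) by (rule polytope_imp_polyhedron)
  from this[unfolded polyhedron_Int_affine_parallel_minimal] obtain \<H>
    where H: "finite \<H>" "P = affine hull P \<inter> \<Inter>\<H>"
    and par': "\<forall>h\<in>\<H>. \<exists>a b. a \<noteq> 0 \<and> h = {x. a \<bullet> x \<le> b} \<and>
      (\<forall>x\<in>affine hull P. x + a \<in> affine hull P)"
    and min': "\<forall>\<H>'. \<H>' \<subset> \<H> \<longrightarrow> P \<subset> affine hull P \<inter> \<Inter>\<H>'"
    by (elim exE conjE)
  have min: "P \<subset> affine hull P \<inter> \<Inter>\<H>'" if "\<H>' \<subset> \<H>" for \<H>'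
    using min'[rule_format, OF that] .
  from par' obtain a b where ab': "\<forall>h\<in>\<H>. a h \<noteq> 0 \<and> h = {x. a h \<bullet> x \<le> b h} \<and>
      (\<forall>x\<in>affine hull P. x + a h \<in> affine hull P)"
    unfolding bchoice_iff by (elim exE)
  have ab: "a h \<noteq> 0 \<and> h = {x. a h \<bullet> x \<le> b h}" if "h \<in> \<H>" for h
    using bspec[OF ab' that] by (elim conjE) (rule conjI)
  have par: "x + a h \<in> affine hull P" if "h \<in> \<H>" "x \<in> affine hull P" for h x
    using bspec[OF ab' that(1)] that(2) by (elim conjE) (rule bspec)
  have interior: "rel_interior P = {x \<in> P. \<forall>h\<in>\<H>. a h \<bullet> x < b h}"
    by (rule rel_interior_polyhedron_explicit[OF H]) (fact ab, fact min)
  have "F facet_of P \<longleftrightarrow> (\<exists>h. h \<in> \<H> \<and> F = P \<inter> {x. a h \<bullet> x = b h})"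
    by (rule facet_of_polyhedron_explicit[OF H]) (fact ab, fact min)
  from iffD1[OF this assms(2)] obtain h where h: "h \<in> \<H>" "F = P \<inter> {x. a h \<bullet> x = b h}"
    by (elim exE conjE)
  define e \<beta> where "e = a h /\<^sub>R norm (a h)" and "\<beta> = b h / norm (a h)"
  have nz: "0 < norm (a h)" using conjunct1[OF ab[OF h(1)]] by simp
  have e: "e \<bullet> x = (a h \<bullet> x) / norm (a h)" for x by (simp add: e_def divide_inverse_commute)
  have eq: "(e \<bullet> x = \<beta>) = (a h \<bullet> x = b h)" "(e \<bullet> x \<le> \<beta>) = (a h \<bullet> x \<le> b h)"
    "(e \<bullet> x < \<beta>) = (a h \<bullet> x < b h)" for x
    using nz by (simp_all add: e \<beta>_def divide_right_mono divide_le_cancel divide_less_cancel)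
  have le: "\<forall>x\<in>P. e \<bullet> x \<le> \<beta>"
  proof
    fix x assume "x \<in> P"
    then have "x \<in> h" using equalityD1[OF H(2)] h(1) by blast
    then have "x \<in> {x. a h \<bullet> x \<le> b h}"
      by (rule subsetD[OF equalityD1[OF conjunct2[OF ab[OF h(1)]]]])
    then have "a h \<bullet> x \<le> b h" by (rule CollectD)
    then show "e \<bullet> x \<le> \<beta>" by (simp add: eq)
  qed
  have lt: "\<forall>x\<in>rel_interior P. e \<bullet> x < \<beta>"
  proof
    fix x assume "x \<in> rel_interior P"
    then have "a h \<bullet> x < b h" using h(1) by (simp add: interior)
    then show "e \<bullet> x < \<beta>" by (simp add: eq)
  qed
  have line: "\<forall>x\<in>affine hull P. \<forall>t. x + t *\<^sub>R e \<in> affine hull P"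
  proof (intro ballI allI)
    fix x t assume x: "x \<in> affine hull P"
    have "(1 - t / norm (a h)) *\<^sub>R x + (t / norm (a h)) *\<^sub>R (x + a h) \<in> affine hull P"
      using x par[OF h(1) x] by (intro mem_affine[OF affine_affine_hull]) auto
    also have "(1 - t / norm (a h)) *\<^sub>R x + (t / norm (a h)) *\<^sub>R (x + a h) = x + t *\<^sub>R e"
      by (simp add: e_def algebra_simps divide_inverse)
    finally show "x + t *\<^sub>R e \<in> affine hull P" .
  qed
  have "F \<noteq> {}" "F \<subseteq> P" using assms(2) by (simp_all add: facet_of_def facet_of_imp_subset)
  then have "P \<noteq> {}" by blast
  then have "rel_interior P \<noteq> {}"
    using rel_interior_eq_empty[OF polytope_imp_convex[OF assms(1)]] by simp
  then obtain z where z: "z \<in> rel_interior P" by (meson ex_in_conv)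
  have zP: "z \<in> P" using z rel_interior_subset[of P] by blast
  have Fe: "F = P \<inter> {x. e \<bullet> x = \<beta>}" using h(2) by (simp add: eq)
  have "affine hull F = affine hull P \<inter> {x. e \<bullet> x = \<beta>}"
    by (rule affine_hull_facet_eq[OF assms(2) Fe zP]) (use bspec[OF lt z] in simp)
  moreover have "norm e = 1" using nz by (simp add: e_def)
  moreover have "F = P \<inter> {x. e \<bullet> x = \<beta>}" by (rule Fe)
  ultimately have "facet_normal P F e \<beta>" using le lt line by (simp only: facet_normal_def)
  then show ?thesis by blast
qed

lemma reflection_in_facet:
  assumes "facet_normal P F e \<beta>" "x \<in> affine hull P"
  shows "reflection_in (affine hull F) x = x - (2 * (e \<bullet> x - \<beta>)) *\<^sub>R e"
proof -
  have ee: "e \<bullet> e = 1" using assms(1) by (simp add: facet_normal_def norm_eq_1)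
  define y where "y = x + (- (e \<bullet> x - \<beta>)) *\<^sub>R e"
  have "y \<in> affine hull P" using assms unfolding facet_normal_def y_def by blast
  moreover have "e \<bullet> y = \<beta>" by (simp add: y_def inner_add_right ee)
  ultimately have y: "y \<in> affine hull F" using assms(1) unfolding facet_normal_def by blast
  have "y = closest_point (affine hull F) x"
  proof (rule closest_point_unique)
    show "\<forall>z\<in>affine hull F. dist x y \<le> dist x z"
    proof
      fix z assume "z \<in> affine hull F"
      then have "e \<bullet> z = \<beta>" using assms(1) unfolding facet_normal_def by blast
      then have "(x - y) \<bullet> (y - z) = 0"
        using \<open>e \<bullet> y = \<beta>\<close> by (simp add: y_def inner_diff_right)
      moreover have "x - z = (x - y) + (y - z)" by simp
      ultimately have "(norm (x - z))\<^sup>2 = (norm (x - y))\<^sup>2 + (norm (y - z))\<^sup>2"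
        by (metis norm_add_Pythagorean orthogonal_def)
      then have "(norm (x - y))\<^sup>2 \<le> (norm (x - z))\<^sup>2" by simp
      then show "dist x y \<le> dist x z" by (simp add: dist_norm power2_le_iff_abs_le)
    qed
  qed (use y in \<open>auto simp: affine_imp_convex closed_affine_hull\<close>)
  then have "reflection_in (affine hull F) x = 2 *\<^sub>R y - x" by (simp add: reflection_in_def)
  then show ?thesis by (simp add: y_def algebra_simps scaleR_2)
qed

abbreviation facet_reflection :: "'v::euclidean_space set \<Rightarrow> 'v set \<Rightarrow> 'v \<Rightarrow> 'v" where
  "facet_reflection P F \<equiv> restrict (reflection_in (affine hull F)) (affine hull P)"

lemma facet_reflection_closed:
  assumes "facet_normal P F e \<beta>" "x \<in> affine hull P"
  shows "facet_reflection P F x \<in> affine hull P"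
proof -
  have "x + (- (2 * (e \<bullet> x - \<beta>))) *\<^sub>R e \<in> affine hull P"
    using assms unfolding facet_normal_def by blast
  moreover have "x + (- (2 * (e \<bullet> x - \<beta>))) *\<^sub>R e = x - (2 * (e \<bullet> x - \<beta>)) *\<^sub>R e"
    by (simp only: scaleR_minus_left add_uminus_conv_diff)
  ultimately show ?thesis using assms(2) by (simp only: reflection_in_facet[OF assms] restrict_apply if_True)
qed

lemma facet_reflection_Bij:
  assumes "facet_normal P F e \<beta>"
  shows "facet_reflection P F \<in> Bij (affine hull P)"
proof -
  have ee: "e \<bullet> e = 1" using assms by (simp add: facet_normal_def norm_eq_1)
  have inv: "facet_reflection P F (facet_reflection P F x) = x" if "x \<in> affine hull P" for x
    using facet_reflection_closed[OF assms that] that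
    by (simp add: reflection_in_facet[OF assms] inner_diff_right ee algebra_simps)
  have "bij_betw (facet_reflection P F) (affine hull P) (affine hull P)"
    using inv facet_reflection_closed[OF assms]
    by (intro bij_betw_byWitness[where f' = "facet_reflection P F"]) blast+
  then show ?thesis by (simp add: Bij_def)
qed

lemma facet_reflections_subset_Bij:
  assumes "polytope P"
  shows "facet_reflections P \<subseteq> Bij (affine hull P)"
proof
  fix r assume "r \<in> facet_reflections P"
  then obtain F where "r = facet_reflection P F" "F facet_of P"
    by (auto simp: facet_reflections_def)
  then show "r \<in> Bij (affine hull P)"
    using facet_normal_exists[OF assms] facet_reflection_Bij by blast
qed

lemma subgroup_facet_reflection_group:
  assumes "polytope P"
  shows "subgroup (generate (BijGroup (affine hull P)) (facet_reflections P)) (BijGroup (affine hull P))"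
proof -
  interpret group "BijGroup (affine hull P)" by (rule group_BijGroup)
  show ?thesis
    using facet_reflections_subset_Bij[OF assms]
    by (intro generate_is_subgroup) (simp add: BijGroup_def)
qed

lemma group_facet_reflection_group:
  assumes "polytope P"
  shows "group (facet_reflection_group P)"
  unfolding facet_reflection_group_def
  by (rule subgroup.subgroup_is_group[OF subgroup_facet_reflection_group[OF assms] group_BijGroup])

lemma facet_reflection_group_Bij:
  "polytope P \<Longrightarrow> g \<in> carrier (facet_reflection_group P) \<Longrightarrow> g \<in> Bij (affine hull P)"
  using subgroup.subset[OF subgroup_facet_reflection_group]
  by (auto simp: facet_reflection_group_def BijGroup_def)

lemma facet_reflection_group_closed:
  assumes "polytope P" "g \<in> carrier (facet_reflection_group P)" "x \<in> affine hull P"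
  shows "g x \<in> affine hull P"
  using Bij_imp_funcset[OF facet_reflection_group_Bij[OF assms(1,2)]] assms(3) by auto

lemma facet_reflection_group_mult:
  assumes "polytope P" "g \<in> carrier (facet_reflection_group P)"
    "h \<in> carrier (facet_reflection_group P)" "x \<in> affine hull P"
  shows "(g \<otimes>\<^bsub>facet_reflection_group P\<^esub> h) x = g (h x)"
  using facet_reflection_group_Bij[OF assms(1,2)] facet_reflection_group_Bij[OF assms(1,3)] assms(4)
  by (simp add: facet_reflection_group_def BijGroup_def compose_eq)

lemma facet_reflection_group_one:
  "x \<in> affine hull P \<Longrightarrow> \<one>\<^bsub>facet_reflection_group P\<^esub> x = x"
  by (simp add: facet_reflection_group_def BijGroup_def)

lemma facet_reflection_in_group:
  "F facet_of P \<Longrightarrow> facet_reflection P F \<in> carrier (facet_reflection_group P)"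
  by (auto simp: facet_reflection_group_def facet_reflections_def intro: generate.incl)

text \<open>The chamber condition in the definition of affine subsets.\<close>

definition is_chamber :: "'v::euclidean_space set \<Rightarrow> bool" where
  "is_chamber P \<longleftrightarrow> (\<forall>g \<in> carrier (facet_reflection_group P).
    g \<noteq> \<one>\<^bsub>facet_reflection_group P\<^esub> \<longrightarrow> g ` rel_interior P \<inter> rel_interior P = {})"

text \<open>If \<open>g x\<close> lay on the mirror of the facet reflection \<open>r\<close>, then \<open>g\<^sup>-\<^sup>1 r g\<close> would fix the interior
  point \<open>x\<close> of the chamber, so it would be trivial, and so would \<open>r\<close>.\<close>

lemma chamber_avoids_mirrors:
  assumes P: "polytope P" "is_chamber P" and F: "F facet_of P" "facet_normal P F e \<beta>"
    and g: "g \<in> carrier (facet_reflection_group P)" and x: "x \<in> rel_interior P"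
  shows "e \<bullet> g x \<noteq> \<beta>"
proof
  assume on: "e \<bullet> g x = \<beta>"
  let ?K = "facet_reflection_group P" and ?r = "facet_reflection P F"
  let ?h = "inv\<^bsub>?K\<^esub> g \<otimes>\<^bsub>?K\<^esub> (?r \<otimes>\<^bsub>?K\<^esub> g)"
  interpret group ?K by (rule group_facet_reflection_group[OF P(1)])
  note mult = facet_reflection_group_mult[OF P(1)] and clo = facet_reflection_group_closed[OF P(1)]
  have rP: "rel_interior P \<subseteq> affine hull P" using rel_interior_subset[of P] hull_subset[of P affine] by blast
  have r: "?r \<in> carrier ?K" using F(1) by (rule facet_reflection_in_group)
  have xA: "x \<in> affine hull P" using x rP by auto
  have on_fix: "?r (g x) = g x" using on clo[OF g xA] by (simp add: reflection_in_facet[OF F(2)])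
  have "(inv\<^bsub>?K\<^esub> g \<otimes>\<^bsub>?K\<^esub> (?r \<otimes>\<^bsub>?K\<^esub> g)) x = (inv\<^bsub>?K\<^esub> g \<otimes>\<^bsub>?K\<^esub> g) x"
    using g r xA on_fix
    by (simp only: mult[of "inv\<^bsub>?K\<^esub> g" "?r \<otimes>\<^bsub>?K\<^esub> g" x] mult[of ?r g x] mult[of "inv\<^bsub>?K\<^esub> g" g x]
        inv_closed m_closed)
  also have "\<dots> = x" using g xA by (simp add: facet_reflection_group_one)
  finally have fixed: "?h x = x" .
  have "?h = \<one>\<^bsub>?K\<^esub>"
  proof (rule ccontr)
    assume ne: "?h \<noteq> \<one>\<^bsub>?K\<^esub>"
    have h: "?h \<in> carrier ?K" using g r by simp
    have "?h ` rel_interior P \<inter> rel_interior P = {}"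
      by (rule P(2)[unfolded is_chamber_def, rule_format, OF h ne])
    moreover have "x \<in> ?h ` rel_interior P" using x fixed by (intro image_eqI[of _ _ x]) simp_all
    ultimately show False using x by blast
  qed
  also have "\<dots> = inv\<^bsub>?K\<^esub> g \<otimes>\<^bsub>?K\<^esub> (\<one>\<^bsub>?K\<^esub> \<otimes>\<^bsub>?K\<^esub> g)" using g by simp
  finally have "?r \<otimes>\<^bsub>?K\<^esub> g = \<one>\<^bsub>?K\<^esub> \<otimes>\<^bsub>?K\<^esub> g"
    using g r Units_l_cancel[of "inv\<^bsub>?K\<^esub> g" "?r \<otimes>\<^bsub>?K\<^esub> g" "\<one>\<^bsub>?K\<^esub> \<otimes>\<^bsub>?K\<^esub> g"]
    by (simp only: Units_eq inv_closed m_closed one_closed)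
  then have "?r = \<one>\<^bsub>?K\<^esub>" using g r right_cancel[of g ?r "\<one>\<^bsub>?K\<^esub>"] by (simp only: one_closed)
  then have "?r x = x" using xA by (simp add: facet_reflection_group_one)
  then have "(2 * (e \<bullet> x - \<beta>)) *\<^sub>R e = 0" using xA by (simp add: reflection_in_facet[OF F(2)])
  moreover have "norm e = 1" "e \<bullet> x < \<beta>" using F(2) x by (auto simp: facet_normal_def)
  ultimately show False by auto
qed

lemma open_meets_closure:
  assumes "open U" "x \<in> U" "x \<in> closure C"
  shows "\<exists>u\<in>C. u \<in> U"
proof (rule ccontr)
  assume "\<not> (\<exists>u\<in>C. u \<in> U)"
  then have "U \<inter> C = {}" by auto
  then have "U \<inter> closure C = {}" using open_Int_closure_eq_empty[OF assms(1), of C] by simp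
  then show False using assms(2,3) by auto
qed

lemma convex_meets_hyperplane:
  fixes C :: "'v::euclidean_space set"
  assumes "convex C" "x \<in> closure C" "y \<in> closure C" "a \<bullet> x < b" "b < a \<bullet> y"
  shows "\<exists>z\<in>C. a \<bullet> z = b"
proof -
  from open_meets_closure[OF open_halfspace_lt, of x a b C] obtain u where u: "u \<in> C" "a \<bullet> u < b"
    using assms(2,4) by auto
  from open_meets_closure[OF open_halfspace_gt, of y b a C] obtain v where v: "v \<in> C" "b < a \<bullet> v"
    using assms(3,5) by auto
  show ?thesis
    using connected_ivt_hyperplane[OF convex_connected[OF assms(1)] u(1) v(1), of a b] u(2) v(2) by simp
qed

lemma facet_point_outside_facet:
  assumes P: "polytope P" and F: "F facet_of P" "F' facet_of P" "F \<noteq> F'"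
  shows "\<exists>x\<in>F. x \<notin> F'"
proof (rule ccontr)
  assume "\<not> (\<exists>x\<in>F. x \<notin> F')"
  then have "F \<subseteq> F'" by auto
  have "convex F'" using F(2) P by (meson face_of_imp_convex facet_of_imp_face_of polytope_imp_convex)
  moreover have "F face_of F'"
    using \<open>F \<subseteq> F'\<close> F by (meson face_of_subset facet_of_imp_face_of facet_of_imp_subset)
  ultimately have "aff_dim F < aff_dim F'" using F(3) by (intro face_of_aff_dim_lt) auto
  then show False using F by (simp add: facet_of_def)
qed

text \<open>Every image of a wall functional under the dihedral group of two walls is a combination of the two
  wall functionals, and by \<open>chamber_avoids_mirrors\<close> it has no zero inside the chamber. On points of one
  facet outside the other it takes the sign of \<open>- q\<close>, on the other facet that of \<open>- p\<close>. So roots are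
  positive or negative.\<close>

lemma chamber_root_sign:
  assumes P: "polytope P"
    and F: "F facet_of P" "facet_normal P F e \<beta>" and F': "F' facet_of P" "facet_normal P F' e' \<beta>'"
    and "F \<noteq> F'"
    and nz: "\<And>x. x \<in> rel_interior P \<Longrightarrow> p * (e \<bullet> x - \<beta>) + q * (e' \<bullet> x - \<beta>') \<noteq> 0"
  shows "0 \<le> p * q"
proof (rule ccontr)
  assume pq: "\<not> 0 \<le> p * q"
  obtain x where x: "x \<in> F" "x \<notin> F'" using facet_point_outside_facet[OF P F(1) F'(1)] assms(6) by auto
  obtain y where y: "y \<in> F'" "y \<notin> F" using facet_point_outside_facet[OF P F'(1) F(1)] assms(6) by auto
  have xP: "x \<in> P" "e \<bullet> x = \<beta>" "e' \<bullet> x < \<beta>'"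
    using x F(2) F'(2) unfolding facet_normal_def by force+
  have yP: "y \<in> P" "e' \<bullet> y = \<beta>'" "e \<bullet> y < \<beta>"
    using y F(2) F'(2) unfolding facet_normal_def by force+
  have cl: "closure (rel_interior P) = P"
    using P by (simp add: convex_closure_rel_interior polytope_imp_convex polytope_imp_closed)
  define a b where "a = p *\<^sub>R e + q *\<^sub>R e'" and "b = p * \<beta> + q * \<beta>'"
  have L: "a \<bullet> z - b = p * (e \<bullet> z - \<beta>) + q * (e' \<bullet> z - \<beta>')" for z
    by (simp add: a_def b_def inner_add_left algebra_simps)
  have Lx: "a \<bullet> x - b = q * (e' \<bullet> x - \<beta>')" and Ly: "a \<bullet> y - b = p * (e \<bullet> y - \<beta>)"
    using xP yP L by simp_all
  have conv: "convex (rel_interior P)" using P by (simp add: convex_rel_interior polytope_imp_convex)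
  have "\<exists>z\<in>rel_interior P. a \<bullet> z = b"
  proof (cases "0 < q")
    case True
    then have "p < 0" using pq by (simp add: zero_le_mult_iff)
    then have "a \<bullet> x - b < 0" "0 < a \<bullet> y - b"
      unfolding Lx Ly using True xP yP by (simp_all add: mult_pos_neg mult_neg_neg)
    then show ?thesis using convex_meets_hyperplane[OF conv, of x y a b] cl xP yP by simp
  next
    case False
    then have "q < 0" "0 < p" using pq by (auto simp: zero_le_mult_iff)
    then have "0 < a \<bullet> x - b" "a \<bullet> y - b < 0"
      unfolding Lx Ly using xP yP by (simp_all add: mult_pos_neg mult_neg_neg)
    then show ?thesis using convex_meets_hyperplane[OF conv, of y x a b] cl xP yP by simp
  qed
  then obtain z where z: "z \<in> rel_interior P" "a \<bullet> z - b = 0" by auto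
  show False using nz[OF z(1)] z(2) unfolding L by simp
qed


text \<open>In the application, \<open>r\<close> and \<open>r'\<close> are reflections with vectors \<open>e\<close> and \<open>e'\<close> of inner product \<open>- C\<close>, restricted to an
  affine subspace \<open>H\<close>. The formulas are compared with those obtained by exchanging the two reflections.\<close>

lemma alternating_reflections:
  fixes r r' :: "'v::real_vector \<Rightarrow> 'v" and f f' :: "'v \<Rightarrow> real" and C :: real
  assumes H': "\<forall>y\<in>H. r y \<in> H \<and> r' y \<in> H"
    and r': "\<forall>y\<in>H. r y = y - (2 * f y) *\<^sub>R e \<and> r' y = y - (2 * f' y) *\<^sub>R e'"
    and f': "\<forall>y\<in>H. f (r y) = - f y \<and> f (r' y) = f y + 2 * C * f' y"
      "\<forall>y\<in>H. f' (r' y) = - f' y \<and> f' (r y) = f' y + 2 * C * f y"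
    and x: "x \<in> H"
  shows "r (r' (r x)) = x - (8 * C\<^sup>2 * f x + 4 * C * f' x) *\<^sub>R e - (2 * f' x + 4 * C * f x) *\<^sub>R e'"
    and "r' (r (r' (r x))) = x - (8 * C\<^sup>2 * f x + 4 * C * f' x) *\<^sub>R e -
      (8 * C\<^sup>2 * f' x + 4 * C * (4 * C\<^sup>2 - 1) * f x) *\<^sub>R e'"
proof -
  define y1 y2 y3 where "y1 = r x" and "y2 = r' y1" and "y3 = r y2"
  note y = y1_def y2_def y3_def
  have mem: "y1 \<in> H" "y2 \<in> H" "y3 \<in> H" using x H' by (simp_all add: y)
  have f1: "f' y1 = f' x + 2 * C * f x" "f y1 = - f x" using f' x by (simp_all add: y)
  have f2: "f y2 = (4 * C\<^sup>2 - 1) * f x + 2 * C * f' x" "f' y2 = - f' x - 2 * C * f x"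
    using f' mem(1) unfolding y2_def by (simp_all add: f1 power2_eq_square algebra_simps)
  have "f' y3 = f' y2 + 2 * C * f y2" using f' mem(2) by (simp add: y3_def)
  then have f3: "f' y3 = (4 * C\<^sup>2 - 1) * f' x + 4 * C * (2 * C\<^sup>2 - 1) * f x"
    unfolding f2 by (simp add: power2_eq_square algebra_simps)
  have "y1 = x - (2 * f x) *\<^sub>R e" "y2 = y1 - (2 * f' y1) *\<^sub>R e'"
    "y3 = y2 - (2 * f y2) *\<^sub>R e" "r' y3 = y3 - (2 * f' y3) *\<^sub>R e'"
    using r' x mem by (simp_all only: y)
  then have 1: "y3 = x - (2 * f x) *\<^sub>R e - (2 * (f' x + 2 * C * f x)) *\<^sub>R e' -
      (2 * ((4 * C\<^sup>2 - 1) * f x + 2 * C * f' x)) *\<^sub>R e"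
    and 2: "r' y3 = y3 - (2 * ((4 * C\<^sup>2 - 1) * f' x + 4 * C * (2 * C\<^sup>2 - 1) * f x)) *\<^sub>R e'"
    unfolding f1 f2 f3 by simp_all
  have 3: "y3 = x - (8 * C\<^sup>2 * f x + 4 * C * f' x) *\<^sub>R e - (2 * f' x + 4 * C * f x) *\<^sub>R e'"
    unfolding 1 by (simp add: algebra_simps)
  then show "r (r' (r x)) = x - (8 * C\<^sup>2 * f x + 4 * C * f' x) *\<^sub>R e - (2 * f' x + 4 * C * f x) *\<^sub>R e'"
    by (simp only: y)
  have "r' y3 = x - (8 * C\<^sup>2 * f x + 4 * C * f' x) *\<^sub>R e -
      (8 * C\<^sup>2 * f' x + 4 * C * (4 * C\<^sup>2 - 1) * f x) *\<^sub>R e'"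
  proof -
    have "8 * C\<^sup>2 * f' x + 4 * C * (4 * C\<^sup>2 - 1) * f x = (2 * f' x + 4 * C * f x) +
        2 * ((4 * C\<^sup>2 - 1) * f' x + 4 * C * (2 * C\<^sup>2 - 1) * f x)"
      by (simp add: algebra_simps)
    then show ?thesis unfolding 2 unfolding 3 by (simp only: scaleR_add_left diff_diff_eq add.assoc)
  qed
  then show "r' (r (r' (r x))) = x - (8 * C\<^sup>2 * f x + 4 * C * f' x) *\<^sub>R e -
      (8 * C\<^sup>2 * f' x + 4 * C * (4 * C\<^sup>2 - 1) * f x) *\<^sub>R e'"
    by (simp only: y)
qed

text \<open>Along the roots \<open>f' \<circ> r\<close>, \<open>f' \<circ> r r'\<close>, \<open>f' \<circ> r r' r\<close> of the two walls, \<open>chamber_root_sign\<close> shows that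
  \<open>C \<ge> 0\<close>, then \<open>C = 0\<close> or \<open>4 C\<^sup>2 \<ge> 1\<close>, then \<open>C = 0\<close> or \<open>4 C\<^sup>2 = 1\<close> or \<open>2 C\<^sup>2 \<ge> 1\<close>. The exceptional
  values \<open>0\<close>, \<open>1 / 2\<close> and \<open>\<surd>2 / 2\<close> are the dihedral angles \<open>\<pi> / 2\<close>, \<open>\<pi> / 3\<close> and \<open>\<pi> / 4\<close>, where the
  reflections satisfy one of the two excluded relations.\<close>

lemma chamber_dihedral_angle:
  fixes P :: "'v::euclidean_space set"
  assumes P: "polytope P" "is_chamber P"
    and F: "F facet_of P" "facet_normal P F e \<beta>" and F': "F' facet_of P" "facet_normal P F' e' \<beta>'"
    and neq: "F \<noteq> F'"
  defines "r \<equiv> facet_reflection P F" and "r' \<equiv> facet_reflection P F'" and "C \<equiv> - (e \<bullet> e')"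
    and "K \<equiv> facet_reflection_group P"
  shows "0 \<le> C"
    and "r \<otimes>\<^bsub>K\<^esub> r' \<otimes>\<^bsub>K\<^esub> r \<noteq> r' \<otimes>\<^bsub>K\<^esub> r \<otimes>\<^bsub>K\<^esub> r' \<Longrightarrow>
      r \<otimes>\<^bsub>K\<^esub> r' \<otimes>\<^bsub>K\<^esub> r \<otimes>\<^bsub>K\<^esub> r' \<noteq> r' \<otimes>\<^bsub>K\<^esub> r \<otimes>\<^bsub>K\<^esub> r' \<otimes>\<^bsub>K\<^esub> r \<Longrightarrow> sqrt 2 / 2 < C"
proof -
  interpret group K unfolding K_def by (rule group_facet_reflection_group[OF P(1)])
  let ?H = "affine hull P"
  define f where "f x = e \<bullet> x - \<beta>" for x
  define f' where "f' x = e' \<bullet> x - \<beta>'" for x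
  have norms: "e \<bullet> e = 1" "e' \<bullet> e' = 1" "e \<bullet> e' = - C" "e' \<bullet> e = - C"
    using F(2) F'(2) by (simp_all add: facet_normal_def norm_eq_1 C_def inner_commute)
  have rK: "r \<in> carrier K" "r' \<in> carrier K"
    unfolding r_def r'_def K_def by (rule facet_reflection_in_group, rule F F')+
  have r: "r x = x - (2 * f x) *\<^sub>R e" "r' x = x - (2 * f' x) *\<^sub>R e'" if "x \<in> ?H" for x
    using that reflection_in_facet[OF F(2) that] reflection_in_facet[OF F'(2) that]
    by (simp_all add: r_def r'_def f_def f'_def)
  have clo: "g x \<in> ?H" if "g \<in> carrier K" "x \<in> ?H" for g x
    using facet_reflection_group_closed[OF P(1)] that unfolding K_def by blast
  have app: "(g \<otimes>\<^bsub>K\<^esub> h) x = g (h x)" if "g \<in> carrier K" "h \<in> carrier K" "x \<in> ?H" for g h x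
    using facet_reflection_group_mult[OF P(1)] that unfolding K_def by blast
  have fr: "f (r x) = - f x" "f (r' x) = f x + 2 * C * f' x"
    "f' (r' x) = - f' x" "f' (r x) = f' x + 2 * C * f x" if "x \<in> ?H" for x
    unfolding r[OF that] by (simp_all add: f_def f'_def inner_diff_right norms algebra_simps)
  have rel: "x \<in> ?H" if "x \<in> rel_interior P" for x
    using that rel_interior_subset[of P] hull_subset[of P affine] by auto
  have sign: "0 \<le> p * q"
    if "g \<in> carrier K" "\<And>x. x \<in> ?H \<Longrightarrow> f' (g x) = p * f x + q * f' x" for g p q
  proof (rule chamber_root_sign[OF P(1) F F' neq])
    fix x assume x: "x \<in> rel_interior P"
    have "e' \<bullet> g x \<noteq> \<beta>'"
      using chamber_avoids_mirrors[OF P F' _ x] that(1) unfolding K_def by blast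
    then show "p * (e \<bullet> x - \<beta>) + q * (e' \<bullet> x - \<beta>') \<noteq> 0"
      using that(2)[OF rel[OF x]] by (simp add: f_def f'_def)
  qed
  \<comment> \<open>in each of the three steps, p and q are the coefficients of the root with respect to f and f'\<close>
  have "0 \<le> (2 * C) * 1"
    by (rule sign[of r]) (simp_all add: rK fr)
  then show C: "0 \<le> C" by simp
  have "0 \<le> (2 * C) * (4 * C\<^sup>2 - 1)"
    by (rule sign[of "r \<otimes>\<^bsub>K\<^esub> r'"])
      (simp_all add: rK fr app clo power2_eq_square algebra_simps)
  then have two: "C = 0 \<or> 1 \<le> 4 * C\<^sup>2"
    using C by (auto simp: zero_le_mult_iff)
  have "0 \<le> (2 * C * (4 * C\<^sup>2 - 2)) * (4 * C\<^sup>2 - 1)"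
    by (rule sign[of "r \<otimes>\<^bsub>K\<^esub> r' \<otimes>\<^bsub>K\<^esub> r"])
      (simp_all add: rK fr app clo power2_eq_square algebra_simps)
  then have three: "C = 0 \<or> 4 * C\<^sup>2 = 1 \<or> 1 \<le> 2 * C\<^sup>2"
    using C two by (auto simp: zero_le_mult_iff)
  have ext: "g = h" if "g \<in> carrier K" "h \<in> carrier K" "\<And>x. x \<in> ?H \<Longrightarrow> g x = h x" for g h
    using that Bij_imp_extensional[OF facet_reflection_group_Bij[OF P(1)]]
    unfolding K_def by (meson extensionalityI)
  have rH: "r y \<in> ?H" "r' y \<in> ?H" if "y \<in> ?H" for y using clo rK that by blast+
  have alt: "r (r' (r x)) = x - (8 * C\<^sup>2 * f x + 4 * C * f' x) *\<^sub>R e - (2 * f' x + 4 * C * f x) *\<^sub>R e'"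
    "r' (r (r' (r x))) = x - (8 * C\<^sup>2 * f x + 4 * C * f' x) *\<^sub>R e -
      (8 * C\<^sup>2 * f' x + 4 * C * (4 * C\<^sup>2 - 1) * f x) *\<^sub>R e'" if "x \<in> ?H" for x
    by (rule alternating_reflections[where H = ?H and r = r and r' = r' and f = f and f' = f' and C = C];
        use that rH r fr in simp)+
  have alt': "r' (r (r' x)) = x - (8 * C\<^sup>2 * f' x + 4 * C * f x) *\<^sub>R e' - (2 * f x + 4 * C * f' x) *\<^sub>R e"
    "r (r' (r (r' x))) = x - (8 * C\<^sup>2 * f' x + 4 * C * f x) *\<^sub>R e' -
      (8 * C\<^sup>2 * f x + 4 * C * (4 * C\<^sup>2 - 1) * f' x) *\<^sub>R e" if "x \<in> ?H" for x
    by (rule alternating_reflections[where H = ?H and r = r' and r' = r and f = f' and f' = f and C = C];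
        use that rH r fr in simp)+
  have app3: "(r \<otimes>\<^bsub>K\<^esub> r' \<otimes>\<^bsub>K\<^esub> r) x = r (r' (r x))" "(r' \<otimes>\<^bsub>K\<^esub> r \<otimes>\<^bsub>K\<^esub> r') x = r' (r (r' x))"
    if "x \<in> ?H" for x
    using that by (simp_all add: app rK rH)
  have app4: "(r \<otimes>\<^bsub>K\<^esub> r' \<otimes>\<^bsub>K\<^esub> r \<otimes>\<^bsub>K\<^esub> r') x = r (r' (r (r' x)))"
    "(r' \<otimes>\<^bsub>K\<^esub> r \<otimes>\<^bsub>K\<^esub> r' \<otimes>\<^bsub>K\<^esub> r) x = r' (r (r' (r x)))" if "x \<in> ?H" for x
    using that by (simp_all add: app rK rH)
  assume not3: "r \<otimes>\<^bsub>K\<^esub> r' \<otimes>\<^bsub>K\<^esub> r \<noteq> r' \<otimes>\<^bsub>K\<^esub> r \<otimes>\<^bsub>K\<^esub> r'"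
    and not4: "r \<otimes>\<^bsub>K\<^esub> r' \<otimes>\<^bsub>K\<^esub> r \<otimes>\<^bsub>K\<^esub> r' \<noteq> r' \<otimes>\<^bsub>K\<^esub> r \<otimes>\<^bsub>K\<^esub> r' \<otimes>\<^bsub>K\<^esub> r"
  have "C \<noteq> 1 / 2"
  proof
    assume half: "C = 1 / 2"
    have "r \<otimes>\<^bsub>K\<^esub> r' \<otimes>\<^bsub>K\<^esub> r = r' \<otimes>\<^bsub>K\<^esub> r \<otimes>\<^bsub>K\<^esub> r'"
    proof (rule ext)
      fix x assume x: "x \<in> ?H"
      show "(r \<otimes>\<^bsub>K\<^esub> r' \<otimes>\<^bsub>K\<^esub> r) x = (r' \<otimes>\<^bsub>K\<^esub> r \<otimes>\<^bsub>K\<^esub> r') x"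
        unfolding app3[OF x] alt(1)[OF x] alt'(1)[OF x]
        by (simp add: half power2_eq_square algebra_simps)
    qed (simp_all add: rK)
    then show False using not3 by simp
  qed
  moreover have "C * (2 * C\<^sup>2 - 1) \<noteq> 0"
  proof
    assume zero: "C * (2 * C\<^sup>2 - 1) = 0"
    have "r \<otimes>\<^bsub>K\<^esub> r' \<otimes>\<^bsub>K\<^esub> r \<otimes>\<^bsub>K\<^esub> r' = r' \<otimes>\<^bsub>K\<^esub> r \<otimes>\<^bsub>K\<^esub> r' \<otimes>\<^bsub>K\<^esub> r"
    proof (rule ext)
      fix x assume x: "x \<in> ?H"
      have "C * (4 * C\<^sup>2 - 1) = C" using zero by (simp add: algebra_simps)
      \<comment> \<open>the coefficients of e and of e' in the two products agree for exactly these values of C\<close>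
      then have coeff: "4 * C * (4 * C\<^sup>2 - 1) = 4 * C" by simp
      show "(r \<otimes>\<^bsub>K\<^esub> r' \<otimes>\<^bsub>K\<^esub> r \<otimes>\<^bsub>K\<^esub> r') x = (r' \<otimes>\<^bsub>K\<^esub> r \<otimes>\<^bsub>K\<^esub> r' \<otimes>\<^bsub>K\<^esub> r) x"
        unfolding app4[OF x] alt(2)[OF x] alt'(2)[OF x] coeff by (simp add: algebra_simps)
    qed (simp_all add: rK)
    then show False using not4 by simp
  qed
  moreover have "4 * C\<^sup>2 \<noteq> 1"
  proof
    assume "4 * C\<^sup>2 = 1"
    then have "(2 * C)\<^sup>2 = 1" by (simp add: power_mult_distrib)
    then have "2 * C = 1 \<or> 2 * C = - 1" by (simp only: power2_eq_1_iff)
    then show False using C \<open>C \<noteq> 1 / 2\<close> by linarith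
  qed
  ultimately have "1 < 2 * C\<^sup>2" using three by auto
  then have "(sqrt 2 / 2)\<^sup>2 < C\<^sup>2" by (simp add: power_divide)
  then show "sqrt 2 / 2 < C" using C by (rule power_less_imp_less_base)
qed

lemma cox_gen_inj:
  fixes S :: "'a::finite set"
  assumes "coxeter_matrix S M" "s \<in> S" "t \<in> S" "cox_gen S M s = cox_gen S M t"
  shows "s = t"
proof (rule ccontr)
  assume "s \<noteq> t"
  have "word_action M [(s, True)] = word_action M [(t, True)]"
    using assms by (intro word_action_class) (simp_all add: cox_gen_def)
  then have "tits_reflection M s (axis s 1) $ s = tits_reflection M t (axis s 1) $ s"
    by (simp add: word_action_simps)
  then show False using \<open>s \<noteq> t\<close>
    by (simp add: tits_reflection_def tits_form_axis cox_coeff_self axis_one_component)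
qed

text \<open>The isomorphism transports the inequalities of \<open>cox_gens_braid_neq\<close> to the facet reflections, so the
  outward unit normals of the three facets satisfy the hypotheses of \<open>weighted_gram_sum_negative\<close>. But
  the sum there is the square of the length of a vector.\<close>

lemma affine_subset_no_hyperbolic_triple:
  fixes S :: "'a::finite set"
  assumes cox: "coxeter_matrix S M" and "affine_subset S M T"
    and T: "s \<in> T" "t \<in> T" "u \<in> T" "s \<noteq> t" "t \<noteq> u" "s \<noteq> u"
    and large: "5 \<le> M s t" "5 \<le> M t u"
  shows False
proof -
  let ?W = "coxeter_group S M"
  let ?WT = "?W\<lparr>carrier := special_subgroup S M T\<rparr>"
  interpret W: group ?W by (rule group_coxeter_group)
  obtain P :: "(real ^ 'a) set" and \<phi> where "T \<subseteq> S" and P: "polytope P" "is_chamber P"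
    and iso: "\<phi> \<in> iso ?WT (facet_reflection_group P)"
    and gens: "\<phi> ` (cox_gen S M ` T) = facet_reflections P"
    using assms(2) unfolding affine_subset_def is_chamber_def by (elim conjE exE)
  have hom: "\<phi> (x \<otimes>\<^bsub>?W\<^esub> y) = \<phi> x \<otimes>\<^bsub>facet_reflection_group P\<^esub> \<phi> y"
    if "x \<in> special_subgroup S M T" "y \<in> special_subgroup S M T" for x y
    using iso that by (auto simp: iso_def hom_def)
  have inj: "inj_on \<phi> (special_subgroup S M T)" using iso by (simp add: iso_def bij_betw_def)
  define c where "c = cox_gen S M"
  have mem: "c x \<in> special_subgroup S M T" if "x \<in> T" for x
    using that unfolding special_subgroup_def c_def by (auto intro: generate.incl)
  have mult_mem: "x \<otimes>\<^bsub>?W\<^esub> y \<in> special_subgroup S M T"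
    if "x \<in> special_subgroup S M T" "y \<in> special_subgroup S M T" for x y
    using that unfolding special_subgroup_def by (rule generate.eng)
  have facet: "\<exists>F e \<beta>. F facet_of P \<and> facet_normal P F e \<beta> \<and> \<phi> (c x) = facet_reflection P F" if "x \<in> T" for x
  proof -
    have "\<phi> (c x) \<in> facet_reflections P" using that gens unfolding c_def by blast
    then obtain F where F: "F facet_of P" "\<phi> (c x) = facet_reflection P F"
      unfolding facet_reflections_def by blast
    then show ?thesis using facet_normal_exists[OF P(1) F(1)] by blast
  qed
  obtain Fs es \<beta>s where s: "Fs facet_of P" "facet_normal P Fs es \<beta>s" "\<phi> (c s) = facet_reflection P Fs"
    using facet[OF T(1)] by (elim exE conjE)
  obtain Ft et \<beta>t where t: "Ft facet_of P" "facet_normal P Ft et \<beta>t" "\<phi> (c t) = facet_reflection P Ft"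
    using facet[OF T(2)] by (elim exE conjE)
  obtain Fu eu \<beta>u where u: "Fu facet_of P" "facet_normal P Fu eu \<beta>u" "\<phi> (c u) = facet_reflection P Fu"
    using facet[OF T(3)] by (elim exE conjE)
  have neq: "\<phi> (c x) \<noteq> \<phi> (c y)" if "x \<in> T" "y \<in> T" "x \<noteq> y" for x y
  proof
    assume "\<phi> (c x) = \<phi> (c y)"
    then have "c x = c y" using inj_onD[OF inj] mem that by blast
    then show False
      using cox_gen_inj[OF cox, of x y] \<open>T \<subseteq> S\<close> that unfolding c_def by blast
  qed
  then have facets_neq: "Fs \<noteq> Ft" "Ft \<noteq> Fu" "Fs \<noteq> Fu"
    using neq[OF T(1,2,4)] neq[OF T(2,3,5)] neq[OF T(1,3,6)] s(3) t(3) u(3) by auto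
  have braid3: "\<phi> (c x) \<otimes>\<^bsub>facet_reflection_group P\<^esub> \<phi> (c y) \<otimes>\<^bsub>facet_reflection_group P\<^esub> \<phi> (c x) \<noteq>
      \<phi> (c y) \<otimes>\<^bsub>facet_reflection_group P\<^esub> \<phi> (c x) \<otimes>\<^bsub>facet_reflection_group P\<^esub> \<phi> (c y)"
    if "x \<in> T" "y \<in> T" "x \<noteq> y" "5 \<le> M x y" for x y
  proof
    assume *: "\<phi> (c x) \<otimes>\<^bsub>facet_reflection_group P\<^esub> \<phi> (c y) \<otimes>\<^bsub>facet_reflection_group P\<^esub> \<phi> (c x) =
      \<phi> (c y) \<otimes>\<^bsub>facet_reflection_group P\<^esub> \<phi> (c x) \<otimes>\<^bsub>facet_reflection_group P\<^esub> \<phi> (c y)"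
    have "\<phi> (c x \<otimes>\<^bsub>?W\<^esub> c y \<otimes>\<^bsub>?W\<^esub> c x) = \<phi> (c y \<otimes>\<^bsub>?W\<^esub> c x \<otimes>\<^bsub>?W\<^esub> c y)"
      using * that by (simp add: hom mem mult_mem)
    then have "c x \<otimes>\<^bsub>?W\<^esub> c y \<otimes>\<^bsub>?W\<^esub> c x = c y \<otimes>\<^bsub>?W\<^esub> c x \<otimes>\<^bsub>?W\<^esub> c y"
      by (rule inj_onD[OF inj]) (simp_all add: that mem mult_mem)
    then show False
      using cox_gens_braid_neq(1)[OF cox _ _ that(3,4)] \<open>T \<subseteq> S\<close> that(1,2) unfolding c_def by auto
  qed
  have braid4: "\<phi> (c x) \<otimes>\<^bsub>facet_reflection_group P\<^esub> \<phi> (c y) \<otimes>\<^bsub>facet_reflection_group P\<^esub> \<phi> (c x)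
        \<otimes>\<^bsub>facet_reflection_group P\<^esub> \<phi> (c y) \<noteq>
      \<phi> (c y) \<otimes>\<^bsub>facet_reflection_group P\<^esub> \<phi> (c x) \<otimes>\<^bsub>facet_reflection_group P\<^esub> \<phi> (c y)
        \<otimes>\<^bsub>facet_reflection_group P\<^esub> \<phi> (c x)"
    if "x \<in> T" "y \<in> T" "x \<noteq> y" "5 \<le> M x y" for x y
  proof
    assume *: "\<phi> (c x) \<otimes>\<^bsub>facet_reflection_group P\<^esub> \<phi> (c y) \<otimes>\<^bsub>facet_reflection_group P\<^esub> \<phi> (c x)
        \<otimes>\<^bsub>facet_reflection_group P\<^esub> \<phi> (c y) =
      \<phi> (c y) \<otimes>\<^bsub>facet_reflection_group P\<^esub> \<phi> (c x) \<otimes>\<^bsub>facet_reflection_group P\<^esub> \<phi> (c y)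
        \<otimes>\<^bsub>facet_reflection_group P\<^esub> \<phi> (c x)"
    have "\<phi> (c x \<otimes>\<^bsub>?W\<^esub> c y \<otimes>\<^bsub>?W\<^esub> c x \<otimes>\<^bsub>?W\<^esub> c y) = \<phi> (c y \<otimes>\<^bsub>?W\<^esub> c x \<otimes>\<^bsub>?W\<^esub> c y \<otimes>\<^bsub>?W\<^esub> c x)"
      using * that by (simp add: hom mem mult_mem)
    then have "c x \<otimes>\<^bsub>?W\<^esub> c y \<otimes>\<^bsub>?W\<^esub> c x \<otimes>\<^bsub>?W\<^esub> c y = c y \<otimes>\<^bsub>?W\<^esub> c x \<otimes>\<^bsub>?W\<^esub> c y \<otimes>\<^bsub>?W\<^esub> c x"
      by (rule inj_onD[OF inj]) (simp_all add: that mem mult_mem)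
    then show False
      using cox_gens_braid_neq(2)[OF cox _ _ that(3,4)] \<open>T \<subseteq> S\<close> that(1,2) unfolding c_def by auto
  qed
  have st: "es \<bullet> et < - sqrt 2 / 2"
    using chamber_dihedral_angle(2)[OF P s(1,2) t(1,2) facets_neq(1)]
      braid3[OF T(1,2,4) large(1)] braid4[OF T(1,2,4) large(1)] unfolding s(3) t(3) by simp
  have tu: "et \<bullet> eu < - sqrt 2 / 2"
    using chamber_dihedral_angle(2)[OF P t(1,2) u(1,2) facets_neq(2)]
      braid3[OF T(2,3,5) large(2)] braid4[OF T(2,3,5) large(2)] unfolding t(3) u(3) by simp
  have su: "es \<bullet> eu \<le> 0"
    using chamber_dihedral_angle(1)[OF P s(1,2) u(1,2) facets_neq(3)] by simp
  have norms: "es \<bullet> es = 1" "et \<bullet> et = 1" "eu \<bullet> eu = 1"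
    using s(2) t(2) u(2) by (simp_all add: facet_normal_def norm_eq_1)
  \<comment> \<open>the weights of weighted_gram_sum_negative\<close>
  let ?v = "es + sqrt 2 *\<^sub>R et + eu"
  have sq: "sqrt 2 * (sqrt 2 * y) = 2 * y" for y by (simp flip: mult.assoc)
  have "?v \<bullet> ?v = 4 + 2 * sqrt 2 * (es \<bullet> et) + 2 * sqrt 2 * (et \<bullet> eu) + 2 * (es \<bullet> eu)"
    by (simp add: inner_add_left inner_add_right norms sq inner_commute[of et es]
        inner_commute[of eu et] inner_commute[of eu es] algebra_simps)
  then have "?v \<bullet> ?v < 0" using weighted_gram_sum_negative[OF st tu su] by simp
  then show False using inner_ge_zero[of ?v] by simp
qed


section \<open>Wide and slab subsets\<close>

text \<open>Right-angled systems and their duplexes both satisfy this condition, so the following analysis of the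
  hypergraph index applies to both.\<close>

locale coxeter_without_large_affine =
  fixes S :: "'a::finite set" and M :: "'a \<Rightarrow> 'a \<Rightarrow> enat"
  assumes coxeter: "coxeter_matrix S M"
    and no_large_affine: "irreducible_subset S M A \<Longrightarrow> affine_subset S M A \<Longrightarrow> card A < 3"

lemma disjoint_commuting_iff:
  fixes S :: "'a::finite set"
  assumes "coxeter_matrix S M"
  shows "disjoint_commuting S M A B \<longleftrightarrow>
    A \<subseteq> S \<and> B \<subseteq> S \<and> A \<inter> B = {} \<and> (\<forall>a\<in>A. \<forall>b\<in>B. M a b = 2)"
proof -
  have "cox_gen S M a \<otimes>\<^bsub>coxeter_group S M\<^esub> cox_gen S M b =
      cox_gen S M b \<otimes>\<^bsub>coxeter_group S M\<^esub> cox_gen S M a \<longleftrightarrow> M a b = 2"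
    if "A \<subseteq> S" "B \<subseteq> S" "A \<inter> B = {}" "a \<in> A" "b \<in> B" for a b
    using that by (intro cox_gens_commute_iff[OF assms]) auto
  then show ?thesis unfolding disjoint_commuting_def by blast
qed

text \<open>The largest set that forms a product with \<open>A\<close>.\<close>

definition link :: "'a set \<Rightarrow> ('a \<Rightarrow> 'a \<Rightarrow> enat) \<Rightarrow> 'a set \<Rightarrow> 'a set" where
  "link S M A = {s \<in> S. disjoint_commuting S M A {s}}"

text \<open>By \<open>slab_subsets_eq\<close> below, these are the factors \<open>A\<close> of the slabs \<open>A \<times> K\<close>.\<close>

definition slab_core :: "'a set \<Rightarrow> ('a \<Rightarrow> 'a \<Rightarrow> enat) \<Rightarrow> 'a set \<Rightarrow> bool" where
  "slab_core S M A \<longleftrightarrow>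
    minimal_nonspherical S M A \<and> link S M A \<noteq> {} \<and> spherical S M (link S M A)"

definition star :: "'a set \<Rightarrow> ('a \<Rightarrow> 'a \<Rightarrow> enat) \<Rightarrow> 'a set \<Rightarrow> 'a set" where
  "star S M A = A \<union> link S M A"

definition wide_candidates :: "'a set \<Rightarrow> ('a \<Rightarrow> 'a \<Rightarrow> enat) \<Rightarrow> 'a set set" where
  "wide_candidates S M =
    {A \<union> B | A B. disjoint_commuting S M A B \<and> nonspherical S M A \<and> nonspherical S M B}"

lemma subset_maximal_set:
  fixes \<C> :: "'a::finite set set"
  assumes "C \<in> \<C>"
  shows "\<exists>T\<in>maximal_sets \<C>. C \<subseteq> T"
  using finite_has_maximal2[of \<C> C] assms unfolding maximal_sets_def by auto

lemma nonspherical_mono: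
  "nonspherical S M A \<Longrightarrow> A \<subseteq> B \<Longrightarrow> B \<subseteq> S \<Longrightarrow> nonspherical S M B"
  using spherical_subset unfolding nonspherical_iff by blast

lemma minimal_nonspherical_exists:
  fixes T :: "'a::finite set"
  assumes "nonspherical S M T"
  shows "\<exists>A\<subseteq>T. minimal_nonspherical S M A"
proof -
  have "finite T" by simp
  then show ?thesis using assms
  proof (induction T rule: finite_psubset_induct)
    case (psubset T)
    show ?case
    proof (cases "minimal_nonspherical S M T")
      case False
      then obtain U where U: "U \<subset> T" "\<not> spherical S M U"
        using psubset.prems by (auto simp: minimal_nonspherical_def)
      then have "nonspherical S M U" using psubset.prems by (auto simp: nonspherical_iff)
      then obtain A where "A \<subseteq> U" "minimal_nonspherical S M A" using psubset.IH[OF U(1)] by auto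
      then show ?thesis using U(1) by blast
    qed auto
  qed
qed

lemma wide_subsets_eq_maximal:
  "wide_subsets S M = maximal_sets (wide_candidates S M)" if "coxeter_without_large_affine S M"
proof -
  have "\<not> (irreducible_subset S M A \<and> affine_subset S M A \<and> 3 \<le> card A)" for A
    using coxeter_without_large_affine.no_large_affine[OF that, of A] by auto
  then have "{A \<union> B | A B. disjoint_commuting S M A B \<and>
      (nonspherical S M A \<and> nonspherical S M B \<or>
       irreducible_subset S M A \<and> affine_subset S M A \<and> 3 \<le> card A \<and> spherical S M B)} =
      wide_candidates S M"
    unfolding wide_candidates_def by blast
  then show ?thesis by (simp only: wide_subsets_def)
qed

context coxeter_without_large_affine
begin

lemma commuting_iff: "disjoint_commuting S M A B \<longleftrightarrow>
    A \<subseteq> S \<and> B \<subseteq> S \<and> A \<inter> B = {} \<and> (\<forall>a\<in>A. \<forall>b\<in>B. M a b = 2)"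
  by (rule disjoint_commuting_iff[OF coxeter])

lemma commuting_sym: "disjoint_commuting S M A B \<Longrightarrow> disjoint_commuting S M B A"
  unfolding disjoint_commuting_def by auto

lemma commuting_mono:
  "disjoint_commuting S M A B \<Longrightarrow> A' \<subseteq> A \<Longrightarrow> B' \<subseteq> B \<Longrightarrow> disjoint_commuting S M A' B'"
  by (auto simp: commuting_iff subset_iff disjoint_iff)

lemma commuting_iff_link: "A \<subseteq> S \<Longrightarrow> disjoint_commuting S M A B \<longleftrightarrow> B \<subseteq> link S M A"
  unfolding link_def disjoint_commuting_def by blast

lemma link_subset: "link S M A \<subseteq> S"
  by (auto simp: link_def)

lemma minimal_nonspherical_subset: "minimal_nonspherical S M A \<Longrightarrow> A \<subseteq> S"
  by (simp add: minimal_nonspherical_def nonspherical_def)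

lemma star_subset: "minimal_nonspherical S M A \<Longrightarrow> star S M A \<subseteq> S"
  using link_subset minimal_nonspherical_subset by (auto simp: star_def)

lemma commuting_link: "minimal_nonspherical S M A \<Longrightarrow> disjoint_commuting S M A (link S M A)"
  by (simp add: commuting_iff_link minimal_nonspherical_subset)

text \<open>Minimal nonspherical sets are irreducible, since a commuting union of spherical sets is spherical.\<close>

lemma minimal_nonspherical_in_factor:
  assumes "minimal_nonspherical S M A" "disjoint_commuting S M X Y" "A \<subseteq> X \<union> Y"
  shows "A \<subseteq> X \<or> A \<subseteq> Y"
proof (rule ccontr)
  assume "\<not> (A \<subseteq> X \<or> A \<subseteq> Y)"
  then have "A \<inter> X \<subset> A" "A \<inter> Y \<subset> A" by auto
  then have "spherical S M (A \<inter> X)" "spherical S M (A \<inter> Y)"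
    using assms(1) unfolding minimal_nonspherical_def by auto
  then have "spherical S M ((A \<inter> X) \<union> (A \<inter> Y))"
    using commuting_mono[OF assms(2)] by (intro spherical_Un[OF coxeter]) auto
  moreover have "(A \<inter> X) \<union> (A \<inter> Y) = A" using assms(3) by auto
  ultimately show False using assms(1) by (simp add: minimal_nonspherical_def nonspherical_iff)
qed

lemma minimal_nonspherical_eq:
  assumes "minimal_nonspherical S M A" "minimal_nonspherical S M A'" "A \<subseteq> A'"
  shows "A = A'"
  using assms unfolding minimal_nonspherical_def nonspherical_iff by blast

lemma minimal_nonspherical_in_slab:
  assumes "minimal_nonspherical S M A" "minimal_nonspherical S M A'" "disjoint_commuting S M A' K"
    and "spherical S M K" "A \<subseteq> A' \<union> K"
  shows "A = A'"
proof -
  have "\<not> A \<subseteq> K"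
    using assms(1) spherical_subset[OF assms(4), of A]
    by (auto simp: minimal_nonspherical_def nonspherical_iff)
  then have "A \<subseteq> A'" using minimal_nonspherical_in_factor[OF assms(1,3,5)] by blast
  then show ?thesis by (rule minimal_nonspherical_eq[OF assms(1,2)])
qed

lemma minimal_nonspherical_in_star:
  assumes "minimal_nonspherical S M A" "slab_core S M A'" "A \<subseteq> star S M A'"
  shows "A = A'"
  using minimal_nonspherical_in_slab[OF assms(1), of A' "link S M A'"] assms(2,3) commuting_link
  unfolding slab_core_def star_def by blast

text \<open>A slab meets another set in a nonspherical set only if that set contains the core of the slab. This
  is what keeps slabs from joining sets that are not joined already.\<close>

lemma nonspherical_in_star:
  assumes "nonspherical S M T" "slab_core S M A" "T \<subseteq> star S M A"
  shows "A \<subseteq> T"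
  using minimal_nonspherical_exists[OF assms(1)] minimal_nonspherical_in_star[OF _ assms(2)] assms(3)
  by blast

lemmas wide_eq = wide_subsets_eq_maximal[OF coxeter_without_large_affine_axioms]

lemma star_subset_wide:
  assumes "minimal_nonspherical S M A" "\<not> spherical S M (link S M A)"
  shows "\<exists>T\<in>wide_subsets S M. star S M A \<subseteq> T"
proof -
  have "star S M A \<in> wide_candidates S M"
    unfolding wide_candidates_def star_def
    using assms commuting_link[OF assms(1)] link_subset
    by (auto simp: minimal_nonspherical_def nonspherical_iff)
  then show ?thesis unfolding wide_eq by (rule subset_maximal_set)
qed

text \<open>A core inside a wide set lies in one of its two factors, and then its link contains the other
  factor, which is nonspherical.\<close>

lemma slab_core_not_in_wide:
  assumes "slab_core S M A" "T \<in> wide_subsets S M"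
  shows "\<not> A \<subseteq> T"
proof
  assume "A \<subseteq> T"
  obtain X Y where XY: "T = X \<union> Y" "disjoint_commuting S M X Y" "nonspherical S M X" "nonspherical S M Y"
    using assms(2) unfolding wide_eq maximal_sets_def wide_candidates_def by auto
  have A: "minimal_nonspherical S M A" "spherical S M (link S M A)"
    using assms(1) by (auto simp: slab_core_def)
  note AS = minimal_nonspherical_subset[OF A(1)]
  have "A \<subseteq> X \<or> A \<subseteq> Y" using minimal_nonspherical_in_factor[OF A(1) XY(2)] \<open>A \<subseteq> T\<close> XY(1) by simp
  then have "Y \<subseteq> link S M A \<or> X \<subseteq> link S M A"
    using commuting_mono[OF XY(2), of A Y] commuting_mono[OF commuting_sym[OF XY(2)], of A X]
      commuting_iff_link[OF AS] by auto
  then show False using spherical_subset[OF A(2)] XY(3,4) by (auto simp: nonspherical_iff)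
qed

text \<open>If the link of \<open>A\<close> is nonspherical, then \<open>star S M A\<close> lies in a wide set and \<open>A\<close> carries no slab.
  If the link is spherical and nonempty, the slab candidates on \<open>A\<close> have a largest one, the star, and by
  \<open>slab_core_not_in_wide\<close> it is not contained in a wide set.\<close>

lemma slab_subsets_eq: "slab_subsets S M = star S M ` {A. slab_core S M A}"
proof -
  define \<C> where "\<C> = {A \<union> K | A K. disjoint_commuting S M A K \<and> minimal_nonspherical S M A \<and>
      K \<noteq> {} \<and> spherical S M K \<and> \<not> (\<exists>T\<in>wide_subsets S M. A \<union> K \<subseteq> T)}"
  have star: "star S M A \<in> \<C>" if "slab_core S M A" for A
    unfolding \<C>_def star_def mem_Collect_eq
    using that slab_core_not_in_wide[OF that] commuting_link
    by (intro exI[of _ A] exI[of _ "link S M A"]) (auto simp: slab_core_def)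
  have in_star: "\<exists>A. slab_core S M A \<and> T \<subseteq> star S M A" if "T \<in> \<C>" for T
  proof -
    obtain A K where AK: "T = A \<union> K" "disjoint_commuting S M A K" "minimal_nonspherical S M A"
      "K \<noteq> {}" "\<not> (\<exists>T\<in>wide_subsets S M. A \<union> K \<subseteq> T)"
      using \<open>T \<in> \<C>\<close> unfolding \<C>_def by blast
    have K: "K \<subseteq> link S M A" using AK(2,3) commuting_iff_link minimal_nonspherical_subset by blast
    then have "T \<subseteq> star S M A" unfolding star_def AK(1) by blast
    then have "spherical S M (link S M A)" using star_subset_wide[OF AK(3)] AK(1,5) by blast
    then show ?thesis using AK(3,4) K \<open>T \<subseteq> star S M A\<close> unfolding slab_core_def by blast
  qed
  have max: "star S M A' \<subseteq> star S M A" if "slab_core S M A" "slab_core S M A'" "star S M A \<subseteq> star S M A'" for A A'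
  proof -
    have "A = A'"
      using minimal_nonspherical_in_star[OF _ that(2), of A] that(1,3) by (auto simp: slab_core_def star_def)
    then show ?thesis by simp
  qed
  have "slab_subsets S M = maximal_sets \<C>" by (simp only: slab_subsets_def \<C>_def)
  also have "\<dots> = star S M ` {A. slab_core S M A}"
  proof (intro equalityI subsetI)
    fix T assume T: "T \<in> maximal_sets \<C>"
    then obtain A where A: "slab_core S M A" "T \<subseteq> star S M A"
      using in_star unfolding maximal_sets_def by blast
    then have "star S M A = T" using T star unfolding maximal_sets_def by blast
    then show "T \<in> star S M ` {A. slab_core S M A}" using A by blast
  next
    fix T assume "T \<in> star S M ` {A. slab_core S M A}"
    then obtain A where A: "T = star S M A" "slab_core S M A" by blast
    have "U = T" if U: "U \<in> \<C>" "T \<subseteq> U" for U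
    proof -
      obtain A' where "slab_core S M A'" "U \<subseteq> star S M A'" using in_star[OF U(1)] by blast
      then show ?thesis using max[of A A'] A U(2) by blast
    qed
    then show "T \<in> maximal_sets \<C>" using star A unfolding maximal_sets_def by blast
  qed
  finally show ?thesis .
qed

end

section \<open>Absorbing the slabs\<close>

text \<open>The hull adds to \<open>T\<close> whatever slabs with their core in \<open>T\<close> can add to it in one merging step.\<close>

definition hull_of :: "'a set \<Rightarrow> ('a \<Rightarrow> 'a \<Rightarrow> enat) \<Rightarrow> 'a set \<Rightarrow> 'a set" where
  "hull_of S M T = T \<union> \<Union> (link S M ` {A. minimal_nonspherical S M A \<and> A \<subseteq> T})"

definition merge_step :: "'a set \<Rightarrow> ('a \<Rightarrow> 'a \<Rightarrow> enat) \<Rightarrow> 'a set set \<Rightarrow> 'a set set" where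
  "merge_step S M \<B> = (\<lambda>C. \<Union> (hull_of S M ` C)) ` (\<B> // overlap_equiv S M \<B>)"

definition free_cores :: "'a set set \<Rightarrow> 'a set set \<Rightarrow> 'a set set" where
  "free_cores \<B> \<R> = {A \<in> \<R>. \<not> (\<exists>T\<in>\<B>. A \<subseteq> T)}"

text \<open>The invariant that makes \<open>hull_of\<close> insensitive to which slabs are still present.\<close>

definition stars_covered :: "'a set \<Rightarrow> ('a \<Rightarrow> 'a \<Rightarrow> enat) \<Rightarrow> 'a set set \<Rightarrow> 'a set set \<Rightarrow> bool" where
  "stars_covered S M \<B> \<R> \<longleftrightarrow> (\<forall>A. minimal_nonspherical S M A \<longrightarrow> link S M A \<noteq> {} \<longrightarrow>
    A \<in> \<R> \<or> (\<exists>T\<in>\<B>. star S M A \<subseteq> T))"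

text \<open>The members of \<open>\<Lambda>\<^sub>i\<close> that contain a wide subset.\<close>

fun wide_hulls :: "'a::finite set \<Rightarrow> ('a \<Rightarrow> 'a \<Rightarrow> enat) \<Rightarrow> nat \<Rightarrow> 'a set set" where
  "wide_hulls S M 0 = wide_subsets S M"
| "wide_hulls S M (Suc i) = merge_step S M (wide_hulls S M i)"

fun unmerged_cores :: "'a::finite set \<Rightarrow> ('a \<Rightarrow> 'a \<Rightarrow> enat) \<Rightarrow> nat \<Rightarrow> 'a set set" where
  "unmerged_cores S M 0 = {A. slab_core S M A}"
| "unmerged_cores S M (Suc i) = free_cores (wide_hulls S M i) (unmerged_cores S M i)"

lemma overlap_equiv_sym: "(T, U) \<in> overlap_equiv S M \<L> \<Longrightarrow> (U, T) \<in> overlap_equiv S M \<L>"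
proof -
  have "sym {(T, U). T \<in> \<L> \<and> U \<in> \<L> \<and> nonspherical S M (T \<inter> U)}"
    by (auto simp: sym_def Int_commute)
  then have "sym (overlap_equiv S M \<L>)" unfolding overlap_equiv_def by (rule sym_rtrancl)
  then show "(T, U) \<in> overlap_equiv S M \<L> \<Longrightarrow> (U, T) \<in> overlap_equiv S M \<L>" by (rule symD)
qed

lemma overlap_equiv_trans:
  "(T, U) \<in> overlap_equiv S M \<L> \<Longrightarrow> (U, V) \<in> overlap_equiv S M \<L> \<Longrightarrow> (T, V) \<in> overlap_equiv S M \<L>"
  unfolding overlap_equiv_def by (rule rtrancl_trans)

lemma overlap_equiv_refl: "(T, T) \<in> overlap_equiv S M \<L>"
  by (simp add: overlap_equiv_def)

lemma overlap_equiv_step: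
  "T \<in> \<L> \<Longrightarrow> U \<in> \<L> \<Longrightarrow> nonspherical S M (T \<inter> U) \<Longrightarrow> (T, U) \<in> overlap_equiv S M \<L>"
  unfolding overlap_equiv_def by (rule r_into_rtrancl) simp

lemma overlap_equiv_mono: "\<L> \<subseteq> \<L>' \<Longrightarrow> overlap_equiv S M \<L> \<subseteq> overlap_equiv S M \<L>'"
  unfolding overlap_equiv_def by (intro rtrancl_mono) auto

lemma overlap_equiv_induct [consumes 1, case_names refl step]:
  assumes "(T, U) \<in> overlap_equiv S M \<L>" "P T"
    and "\<And>U V. P U \<Longrightarrow> U \<in> \<L> \<Longrightarrow> V \<in> \<L> \<Longrightarrow> nonspherical S M (U \<inter> V) \<Longrightarrow> P V"
  shows "P U"
  using assms(1)[unfolded overlap_equiv_def] assms(2,3) by (induction rule: rtrancl_induct) auto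

lemma overlap_equiv_in: "(T, U) \<in> overlap_equiv S M \<L> \<Longrightarrow> T \<in> \<L> \<Longrightarrow> U \<in> \<L>"
  by (induction rule: overlap_equiv_induct)

context coxeter_without_large_affine
begin

text \<open>By \<open>nonspherical_in_star\<close>, a chain that passes through a slab can skip it: both neighbours contain the
  core and so overlap each other.\<close>

lemma overlap_classes_with_slabs:
  assumes \<R>: "\<And>A. A \<in> \<R> \<Longrightarrow> slab_core S M A" and \<B>: "\<B> \<subseteq> Pow S" and T: "T \<in> \<B>"
  defines "\<L> \<equiv> \<B> \<union> star S M ` \<R>"
  shows "overlap_equiv S M \<L> `` {T} = overlap_equiv S M \<B> `` {T} \<union>
    star S M ` {A \<in> \<R>. \<exists>U\<in>overlap_equiv S M \<B> `` {T}. A \<subseteq> U}" (is "_ = ?X")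
proof (intro equalityI subsetI)
  fix V assume "V \<in> overlap_equiv S M \<L> `` {T}"
  then have "(T, V) \<in> overlap_equiv S M \<L>" by simp
  then show "V \<in> ?X"
  proof (induction rule: overlap_equiv_induct)
    case refl
    then show ?case by (simp add: overlap_equiv_refl)
  next
    case (step U V)
    have core_in: "A \<subseteq> U'" if "A \<in> \<R>" "nonspherical S M (U' \<inter> star S M A)" for A U'
      using nonspherical_in_star[OF that(2) \<R>[OF that(1)]] by simp
    show ?case
    proof (cases "V \<in> \<B>")
      case True
      have "\<exists>W. (T, W) \<in> overlap_equiv S M \<B> \<and> nonspherical S M (W \<inter> V)"
        using step(1)
      proof
        assume "U \<in> overlap_equiv S M \<B> `` {T}"
        then show ?thesis using step(4) by auto
      next
        assume "U \<in> star S M ` {A \<in> \<R>. \<exists>U\<in>overlap_equiv S M \<B> `` {T}. A \<subseteq> U}"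
        then obtain A W where A: "U = star S M A" "A \<in> \<R>" "(T, W) \<in> overlap_equiv S M \<B>" "A \<subseteq> W"
          by auto
        then have "A \<subseteq> V" using core_in[of A V] step(4) by (simp add: Int_commute)
        moreover have "nonspherical S M A"
          using \<R>[OF A(2)] by (simp add: slab_core_def minimal_nonspherical_def)
        ultimately have "\<not> spherical S M (W \<inter> V)"
          using A(4) spherical_subset[of S M "W \<inter> V" A] by (auto simp: nonspherical_iff)
        moreover have "W \<inter> V \<subseteq> S" using True \<B> by auto
        ultimately show ?thesis using A(3) by (auto simp: nonspherical_iff Int_commute)
      qed
      then obtain W where W: "(T, W) \<in> overlap_equiv S M \<B>" "nonspherical S M (W \<inter> V)" by blast
      then have "(W, V) \<in> overlap_equiv S M \<B>"
        using overlap_equiv_in[OF W(1) T] True by (intro overlap_equiv_step)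
      then show ?thesis using overlap_equiv_trans[OF W(1)] by simp
    next
      case False
      then obtain A where A: "V = star S M A" "A \<in> \<R>" using step(3) unfolding \<L>_def by auto
      have AU: "A \<subseteq> U" using core_in[OF A(2)] step(4) A(1) by simp
      show ?thesis using step(1)
      proof
        assume "U \<in> overlap_equiv S M \<B> `` {T}"
        then show ?thesis using A AU by blast
      next
        assume U: "U \<in> star S M ` {A \<in> \<R>. \<exists>U\<in>overlap_equiv S M \<B> `` {T}. A \<subseteq> U}"
        then obtain A' where "U = star S M A'" "A' \<in> \<R>" by blast
        then have "A = A'"
          using minimal_nonspherical_in_star[of A A'] AU \<R> A(2) by (simp add: slab_core_def)
        then show ?thesis using U A(1) \<open>U = star S M A'\<close> by blast
      qed
    qed
  qed
next
  fix V assume V: "V \<in> ?X"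
  have sub: "overlap_equiv S M \<B> \<subseteq> overlap_equiv S M \<L>"
    unfolding \<L>_def by (intro overlap_equiv_mono) simp
  from V show "V \<in> overlap_equiv S M \<L> `` {T}"
  proof
    assume "V \<in> star S M ` {A \<in> \<R>. \<exists>U\<in>overlap_equiv S M \<B> `` {T}. A \<subseteq> U}"
    then obtain A U where A: "V = star S M A" "A \<in> \<R>" "(T, U) \<in> overlap_equiv S M \<B>" "A \<subseteq> U" by auto
    have min: "minimal_nonspherical S M A" using \<R>[OF A(2)] by (simp add: slab_core_def)
    have "nonspherical S M (U \<inter> V)"
    proof (rule nonspherical_mono)
      show "nonspherical S M A" using min by (simp add: minimal_nonspherical_def)
      show "A \<subseteq> U \<inter> V" using A(1,4) by (auto simp: star_def)
      show "U \<inter> V \<subseteq> S" using star_subset[OF min] A(1) by auto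
    qed
    moreover have "U \<in> \<B>" using overlap_equiv_in[OF A(3) T] .
    ultimately have "(U, V) \<in> overlap_equiv S M \<L>"
      using A(1,2) by (intro overlap_equiv_step) (auto simp: \<L>_def)
    moreover have "(T, U) \<in> overlap_equiv S M \<L>" using sub A(3) by (rule subsetD)
    ultimately have "(T, V) \<in> overlap_equiv S M \<L>" by (rule overlap_equiv_trans[rotated])
    then show ?thesis by simp
  next
    assume "V \<in> overlap_equiv S M \<B> `` {T}"
    then show ?thesis using subsetD[OF sub] by simp
  qed
qed

end


lemma hull_of_superset: "T \<subseteq> hull_of S M T"
  by (simp add: hull_of_def)

lemma star_subset_hull: "minimal_nonspherical S M A \<Longrightarrow> A \<subseteq> T \<Longrightarrow> star S M A \<subseteq> hull_of S M T"
  unfolding hull_of_def star_def by auto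

context coxeter_without_large_affine
begin

lemma slab_class_singleton:
  assumes \<R>: "\<And>A. A \<in> \<R> \<Longrightarrow> slab_core S M A" and A: "A \<in> free_cores \<B> \<R>"
  shows "overlap_equiv S M (\<B> \<union> star S M ` \<R>) `` {star S M A} = {star S M A}"
proof -
  have core: "slab_core S M A" and free: "\<And>T. T \<in> \<B> \<Longrightarrow> \<not> A \<subseteq> T"
    using A \<R> by (auto simp: free_cores_def)
  have "V = star S M A" if "(star S M A, V) \<in> overlap_equiv S M (\<B> \<union> star S M ` \<R>)" for V
    using that
  proof (induction rule: overlap_equiv_induct)
    case (step U V)
    have "A \<subseteq> V"
      using nonspherical_in_star[OF step(4) core] step(1) by simp
    then have "V \<notin> \<B>" using free by blast
    then obtain A' where A': "V = star S M A'" "A' \<in> \<R>" using step(3) by auto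
    then have "A = A'"
      using minimal_nonspherical_in_star[OF _ \<R>[OF A'(2)], of A] core \<open>A \<subseteq> V\<close>
      by (simp add: slab_core_def)
    then show ?case using A'(1) by simp
  qed simp
  then show ?thesis using overlap_equiv_refl[of "star S M A" S M] by auto
qed

text \<open>The hulls add the links of all minimal nonspherical subsets, whether or not these are cores of slabs
  in \<open>\<R>\<close>. By the covering condition nothing is lost: a star that is not among the slabs lies in a member
  of \<open>\<B>\<close>, and that member overlaps every set containing \<open>A\<close>.\<close>

lemma merged_class_union:
  assumes \<R>: "\<And>A. A \<in> \<R> \<Longrightarrow> slab_core S M A" and \<B>: "\<B> \<subseteq> Pow S" and T: "T \<in> \<B>"
    and cover: "stars_covered S M \<B> \<R>"
  shows "\<Union> (overlap_equiv S M (\<B> \<union> star S M ` \<R>) `` {T}) =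
    \<Union> (hull_of S M ` (overlap_equiv S M \<B> `` {T}))"
proof (intro equalityI Union_least)
  let ?E = "overlap_equiv S M (\<B> \<union> star S M ` \<R>) `` {T}" and ?EB = "overlap_equiv S M \<B> `` {T}"
  have E: "?E = ?EB \<union> star S M ` {A \<in> \<R>. \<exists>U\<in>?EB. A \<subseteq> U}"
    by (rule overlap_classes_with_slabs[OF \<R> \<B> T])
  fix V assume "V \<in> ?E"
  then have "V \<in> ?EB \<or> (\<exists>A U. V = star S M A \<and> A \<in> \<R> \<and> U \<in> ?EB \<and> A \<subseteq> U)"
    unfolding E by auto
  then show "V \<subseteq> \<Union> (hull_of S M ` ?EB)"
  proof (elim disjE exE conjE)
    assume "V \<in> ?EB"
    then show ?thesis using hull_of_superset[of V S M] by auto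
  next
    fix A U assume A: "V = star S M A" "A \<in> \<R>" "U \<in> ?EB" "A \<subseteq> U"
    then have "V \<subseteq> hull_of S M U"
      using star_subset_hull[of S M A U] \<R>[OF A(2)] by (simp add: slab_core_def)
    then show ?thesis using A(3) by auto
  qed
next
  let ?E = "overlap_equiv S M (\<B> \<union> star S M ` \<R>) `` {T}" and ?EB = "overlap_equiv S M \<B> `` {T}"
  have E: "?E = ?EB \<union> star S M ` {A \<in> \<R>. \<exists>U\<in>?EB. A \<subseteq> U}"
    by (rule overlap_classes_with_slabs[OF \<R> \<B> T])
  fix X assume "X \<in> hull_of S M ` ?EB"
  then obtain U where U: "X = hull_of S M U" "U \<in> ?EB" by blast
  have "link S M A \<subseteq> \<Union> ?E" if A: "minimal_nonspherical S M A" "A \<subseteq> U" for A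
  proof (cases "link S M A = {}")
    case False
    then have "A \<in> \<R> \<or> (\<exists>V\<in>\<B>. star S M A \<subseteq> V)" using cover A(1) by (simp add: stars_covered_def)
    then show ?thesis
    proof
      assume "A \<in> \<R>"
      then have "star S M A \<in> ?E" unfolding E using U(2) A(2) by auto
      then show ?thesis by (auto simp: star_def)
    next
      assume "\<exists>V\<in>\<B>. star S M A \<subseteq> V"
      then obtain V where V: "V \<in> \<B>" "star S M A \<subseteq> V" by blast
      have UB: "U \<in> \<B>" using overlap_equiv_in[OF _ T] U(2) by simp
      have "nonspherical S M (U \<inter> V)"
      proof (rule nonspherical_mono)
        show "nonspherical S M A" using A(1) by (simp add: minimal_nonspherical_def)
        show "A \<subseteq> U \<inter> V" using A(2) V(2) by (auto simp: star_def)
        show "U \<inter> V \<subseteq> S" using UB \<B> by auto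
      qed
      then have "(U, V) \<in> overlap_equiv S M \<B>" using UB V(1) by (intro overlap_equiv_step)
      then have "(T, V) \<in> overlap_equiv S M \<B>"
        using U(2) by (simp add: overlap_equiv_trans[of T U])
      then have "V \<in> ?E" unfolding E by simp
      then show ?thesis using V(2) by (auto simp: star_def)
    qed
  qed simp
  moreover have "U \<subseteq> \<Union> ?E" using U(2) unfolding E by auto
  ultimately show "X \<subseteq> \<Union> ?E" unfolding U(1) hull_of_def by auto
qed

lemma merge_with_slabs:
  assumes \<R>: "\<And>A. A \<in> \<R> \<Longrightarrow> slab_core S M A" and \<B>: "\<B> \<subseteq> Pow S"
    and cover: "stars_covered S M \<B> \<R>"
  defines "\<L> \<equiv> \<B> \<union> star S M ` \<R>"
  shows "Union ` (\<L> // overlap_equiv S M \<L>) = merge_step S M \<B> \<union> star S M ` free_cores \<B> \<R>"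
proof -
  let ?u = "\<lambda>T. \<Union> (overlap_equiv S M \<L> `` {T})"
  have "Union ` (\<L> // overlap_equiv S M \<L>) = ?u ` \<L>" by (auto simp: quotient_def)
  also have "\<dots> = ?u ` \<B> \<union> ?u ` (star S M ` free_cores \<B> \<R>)"
  proof -
    have "?u (star S M A) \<in> ?u ` \<B>" if A: "A \<in> \<R>" "A \<notin> free_cores \<B> \<R>" for A
    proof -
      obtain T where T: "T \<in> \<B>" "A \<subseteq> T" using A by (auto simp: free_cores_def)
      have min: "minimal_nonspherical S M A" using \<R>[OF A(1)] by (simp add: slab_core_def)
      have "nonspherical S M (star S M A \<inter> T)"
      proof (rule nonspherical_mono)
        show "nonspherical S M A" using min by (simp add: minimal_nonspherical_def)
        show "A \<subseteq> star S M A \<inter> T" using T(2) by (auto simp: star_def)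
        show "star S M A \<inter> T \<subseteq> S" using T(1) \<B> by auto
      qed
      then have st: "(star S M A, T) \<in> overlap_equiv S M \<L>"
        using A(1) T(1) by (intro overlap_equiv_step) (auto simp: \<L>_def)
      have "overlap_equiv S M \<L> `` {star S M A} = overlap_equiv S M \<L> `` {T}"
        using overlap_equiv_trans[OF st] overlap_equiv_trans[OF overlap_equiv_sym[OF st]] by auto
      then show ?thesis using T(1) by simp
    qed
    moreover have "free_cores \<B> \<R> \<subseteq> \<R>" by (auto simp: free_cores_def)
    ultimately show ?thesis unfolding \<L>_def image_Un by blast
  qed
  also have "?u ` \<B> = merge_step S M \<B>"
    using merged_class_union[OF \<R> \<B> _ cover] by (auto simp: merge_step_def quotient_def \<L>_def)
  also have "?u ` (star S M ` free_cores \<B> \<R>) = star S M ` free_cores \<B> \<R>"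
    unfolding image_image using slab_class_singleton[OF \<R>] by (intro image_cong) (simp_all add: \<L>_def)
  finally show ?thesis .
qed

lemma hull_in_merge_step:
  assumes "T \<in> \<B>"
  shows "\<exists>U\<in>merge_step S M \<B>. hull_of S M T \<subseteq> U"
proof -
  have "T \<in> overlap_equiv S M \<B> `` {T}" by (simp add: overlap_equiv_refl)
  then have "hull_of S M T \<subseteq> \<Union> (hull_of S M ` (overlap_equiv S M \<B> `` {T}))" by auto
  moreover have "\<Union> (hull_of S M ` (overlap_equiv S M \<B> `` {T})) \<in> merge_step S M \<B>"
    using assms by (auto simp: merge_step_def quotient_def)
  ultimately show ?thesis by auto
qed

lemma stars_covered_merge_step:
  assumes "stars_covered S M \<B> \<R>"
  shows "stars_covered S M (merge_step S M \<B>) (free_cores \<B> \<R>)"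
  unfolding stars_covered_def
proof (intro allI impI)
  fix A assume A: "minimal_nonspherical S M A" "link S M A \<noteq> {}"
  show "A \<in> free_cores \<B> \<R> \<or> (\<exists>T\<in>merge_step S M \<B>. star S M A \<subseteq> T)"
  proof (cases "A \<in> free_cores \<B> \<R>")
    case False
    then have "\<exists>T\<in>\<B>. A \<subseteq> T"
      using assms A unfolding stars_covered_def free_cores_def star_def by auto
    then obtain T where T: "T \<in> \<B>" "A \<subseteq> T" by blast
    obtain U where U: "U \<in> merge_step S M \<B>" "hull_of S M T \<subseteq> U" using hull_in_merge_step[OF T(1)] by blast
    have "star S M A \<subseteq> U" using star_subset_hull[OF A(1) T(2)] U(2) by (rule subset_trans)
    then show ?thesis using U(1) by auto
  qed simp
qed

lemma hull_of_subset: "T \<subseteq> S \<Longrightarrow> hull_of S M T \<subseteq> S"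
  using link_subset by (auto simp: hull_of_def)

lemma merge_step_subset:
  assumes "\<B> \<subseteq> Pow S"
  shows "merge_step S M \<B> \<subseteq> Pow S"
proof
  fix X assume "X \<in> merge_step S M \<B>"
  then obtain T where T: "T \<in> \<B>" "X = \<Union> (hull_of S M ` (overlap_equiv S M \<B> `` {T}))"
    by (auto simp: merge_step_def quotient_def)
  have "hull_of S M U \<subseteq> S" if "(T, U) \<in> overlap_equiv S M \<B>" for U
    using overlap_equiv_in[OF that T(1)] assms by (intro hull_of_subset) auto
  then show "X \<in> Pow S" unfolding T(2) by auto
qed

text \<open>Each \<open>\<Lambda>\<^sub>i\<close> consists of the sets grown from wide sets, which evolve by \<open>merge_step\<close> on their own, and
  of the slabs whose core has not yet been contained in one of them.\<close>

lemma Lambda_shift_decomposition: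
  "Lambda_shift S M (Suc i) = wide_hulls S M i \<union> star S M ` unmerged_cores S M i \<and>
    wide_hulls S M i \<subseteq> Pow S \<and> (\<forall>A\<in>unmerged_cores S M i. slab_core S M A) \<and>
    stars_covered S M (wide_hulls S M i) (unmerged_cores S M i)"
proof (induction i)
  case 0
  have "wide_subsets S M \<subseteq> Pow S"
    unfolding wide_eq maximal_sets_def wide_candidates_def by (auto simp: disjoint_commuting_def)
  moreover have "stars_covered S M (wide_subsets S M) {A. slab_core S M A}"
    unfolding stars_covered_def
  proof (intro allI impI)
    fix A assume "minimal_nonspherical S M A" "link S M A \<noteq> {}"
    then show "A \<in> {A. slab_core S M A} \<or> (\<exists>T\<in>wide_subsets S M. star S M A \<subseteq> T)"
      using star_subset_wide[of A] by (cases "spherical S M (link S M A)") (simp_all add: slab_core_def)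
  qed
  ultimately show ?case by (simp add: slab_subsets_eq)
next
  case (Suc i)
  let ?\<B> = "wide_hulls S M i" and ?\<R> = "unmerged_cores S M i"
  note L = conjunct1[OF Suc] and \<B> = conjunct1[OF conjunct2[OF Suc]]
    and \<R>' = conjunct1[OF conjunct2[OF conjunct2[OF Suc]]]
    and cover = conjunct2[OF conjunct2[OF conjunct2[OF Suc]]]
  note \<R> = bspec[OF \<R>']
  have "Lambda_shift S M (Suc (Suc i)) = merge_step S M ?\<B> \<union> star S M ` free_cores ?\<B> ?\<R>"
    unfolding Lambda_shift.simps(3) Let_def L by (rule merge_with_slabs[OF \<R> \<B> cover])
  moreover have "\<forall>A\<in>free_cores ?\<B> ?\<R>. slab_core S M A" using \<R>' by (simp add: free_cores_def)
  ultimately show ?case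
    using merge_step_subset[OF \<B>] stars_covered_merge_step[OF cover]
    by (simp only: wide_hulls.simps(2) unmerged_cores.simps(2) simp_thms)
qed

text \<open>A wide set contains two disjoint minimal nonspherical sets, a slab contains none besides its core.\<close>

lemma whole_set_not_slab:
  assumes "wide_subsets S M \<noteq> {}" "slab_core S M A"
  shows "star S M A \<noteq> S"
proof
  assume S: "star S M A = S"
  obtain X Y where XY: "disjoint_commuting S M X Y" "nonspherical S M X" "nonspherical S M Y"
    using assms(1) by (auto simp: wide_eq maximal_sets_def wide_candidates_def)
  then have "A \<subseteq> X" "A \<subseteq> Y"
    using nonspherical_in_star[OF _ assms(2)] S by (auto simp: disjoint_commuting_def)
  then have "A = {}" using XY(1) by (auto simp: disjoint_commuting_def)
  moreover have "link S M A \<noteq> {}" "spherical S M (link S M A)" "minimal_nonspherical S M A"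
    using assms(2) by (auto simp: slab_core_def)
  ultimately have "spherical S M A" using spherical_subset[of S M "link S M A" "{}"] by simp
  then show False using \<open>minimal_nonspherical S M A\<close>
    by (simp add: minimal_nonspherical_def nonspherical_iff)
qed

lemma whole_set_in_Lambda_iff:
  assumes "wide_subsets S M \<noteq> {}"
  shows "S \<in> Lambda_shift S M (Suc i) \<longleftrightarrow> S \<in> wide_hulls S M i"
proof -
  note dec = Lambda_shift_decomposition[of i]
  have "S \<noteq> star S M A" if "A \<in> unmerged_cores S M i" for A
    using whole_set_not_slab[OF assms bspec[OF conjunct1[OF conjunct2[OF conjunct2[OF dec]]] that]]
    by (rule not_sym)
  then show ?thesis unfolding conjunct1[OF dec] by auto
qed

end

lemma hypergraph_index_cong:
  assumes "coxeter_without_large_affine S M" "coxeter_without_large_affine S' M'"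
    and wide: "wide_subsets S M = {} \<longleftrightarrow> wide_subsets S' M' = {}"
    and hulls: "\<And>i. S \<in> wide_hulls S M i \<longleftrightarrow> S' \<in> wide_hulls S' M' i"
  shows "hypergraph_index S M = hypergraph_index S' M'"
proof (cases "wide_subsets S M = {}")
  case True
  then show ?thesis using wide by (simp add: hypergraph_index_def)
next
  case False
  then have False': "wide_subsets S' M' \<noteq> {}" using wide by simp
  have "S \<in> Lambda_shift S M (Suc i) \<longleftrightarrow> S' \<in> Lambda_shift S' M' (Suc i)" for i
    unfolding coxeter_without_large_affine.whole_set_in_Lambda_iff[OF assms(1) False]
      coxeter_without_large_affine.whole_set_in_Lambda_iff[OF assms(2) False'] by (rule hulls)
  then have "S \<in> Lambda_shift S M i \<longleftrightarrow> S' \<in> Lambda_shift S' M' i" for i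
    by (cases i) (simp_all only: Lambda_shift.simps(1) empty_iff)
  then show ?thesis using wide by (simp only: hypergraph_index_def Diff_iff)
qed


section \<open>Affine subsets and commuting sets of generators\<close>

lemma coxeter_matrix_sym: "coxeter_matrix S M \<Longrightarrow> s \<in> S \<Longrightarrow> t \<in> S \<Longrightarrow> M s t = M t s"
  by (cases "s = t") (auto simp: coxeter_matrix_def)

text \<open>An irreducible set with at least three elements contains three generators \<open>a\<close>, \<open>b\<close>, \<open>c\<close> such that \<open>b\<close>
  commutes with neither \<open>a\<close> nor \<open>c\<close>. The assumption turns them into a triple that no affine subset
  contains.\<close>

lemma without_large_affine_if_hyperbolic_paths:
  fixes S :: "'a::finite set"
  assumes cox: "coxeter_matrix S M"
    and path: "\<And>a b c. {a, b, c} \<subseteq> S \<Longrightarrow> a \<noteq> b \<Longrightarrow> b \<noteq> c \<Longrightarrow> a \<noteq> c \<Longrightarrow> M a b \<noteq> 2 \<Longrightarrow> M b c \<noteq> 2 \<Longrightarrow>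
      \<exists>x y z. {x, y, z} \<subseteq> {a, b, c} \<and> x \<noteq> y \<and> y \<noteq> z \<and> x \<noteq> z \<and> 5 \<le> M x y \<and> 5 \<le> M y z"
  shows "coxeter_without_large_affine S M"
proof (unfold_locales, rule cox)
  fix A assume irr: "irreducible_subset S M A" and aff: "affine_subset S M A"
  have A: "A \<subseteq> S" using irr by (simp add: irreducible_subset_def)
  have sym: "M s t = M t s" if "s \<in> A" "t \<in> A" for s t
    using coxeter_matrix_sym[OF cox] A that by blast
  have split: "\<exists>x\<in>X. \<exists>y\<in>A - X. M x y \<noteq> 2" if X: "X \<subseteq> A" "X \<noteq> {}" "A - X \<noteq> {}" for X
  proof (rule ccontr)
    assume "\<not> (\<exists>x\<in>X. \<exists>y\<in>A - X. M x y \<noteq> 2)"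
    then have "disjoint_commuting S M X (A - X)"
      unfolding disjoint_commuting_iff[OF cox] using A X(1) by auto
    moreover have "X \<union> (A - X) = A" using X(1) by auto
    ultimately show False using irr X(2,3) unfolding irreducible_subset_def by metis
  qed
  show "card A < 3"
  proof (rule ccontr)
    assume "\<not> card A < 3"
    then have card: "3 \<le> card A" by simp
    have not_small: "A - {x, y} \<noteq> {}" for x y
    proof
      assume "A - {x, y} = {}"
      then have "card A \<le> card {x, y}" by (intro card_mono) auto
      then show False using card card_insert_le_m1[of 2 "{y}" x] by (simp add: card_insert_if split: if_splits)
    qed
    from card obtain a where a: "a \<in> A" by fastforce
    obtain b where b: "b \<in> A" "b \<noteq> a" "M a b \<noteq> 2"
      using split[of "{a}"] a not_small[of a a] by auto
    obtain x c where c: "x \<in> {a, b}" "c \<in> A" "c \<noteq> a" "c \<noteq> b" "M x c \<noteq> 2"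
      using split[of "{a, b}"] a b(1) not_small[of a b] by auto
    have "\<exists>p q. p \<in> A \<and> q \<in> A \<and> {p, q} = {a, b} \<and> M p q \<noteq> 2 \<and> M q c \<noteq> 2"
    proof (cases "x = b")
      case True
      then show ?thesis using a b c by blast
    next
      case False
      then have "x = a" using c(1) by simp
      then show ?thesis using a b c sym[OF a b(1)] by (intro exI[of _ b] exI[of _ a]) auto
    qed
    then obtain p q where pq: "p \<in> A" "q \<in> A" "{p, q} = {a, b}" "M p q \<noteq> 2" "M q c \<noteq> 2" by blast
    have "p \<noteq> q" using pq(3) b(2) by auto
    have neq: "p \<noteq> c" "q \<noteq> c" using pq(3) c(3,4) by auto
    have "{p, q, c} \<subseteq> S" using pq(1,2) c(2) A by auto
    from path[OF this \<open>p \<noteq> q\<close> neq(2,1) pq(4,5)] obtain x y z where xyz: "{x, y, z} \<subseteq> {p, q, c}"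
      "x \<noteq> y" "y \<noteq> z" "x \<noteq> z" "5 \<le> M x y" "5 \<le> M y z"
      by (elim exE conjE)
    have "x \<in> A" "y \<in> A" "z \<in> A" using xyz(1) pq(1,2) c(2) by auto
    from affine_subset_no_hyperbolic_triple[OF cox aff this xyz(2,3,4,5,6)] show False .
  qed
qed

lemma spherical_if_pairwise_commuting:
  fixes S :: "'a::finite set"
  assumes cox: "coxeter_matrix S M" and T: "T \<subseteq> S" "\<And>s t. s \<in> T \<Longrightarrow> t \<in> T \<Longrightarrow> s \<noteq> t \<Longrightarrow> M s t = 2"
  shows "spherical S M T"
proof -
  have "finite T" by simp
  then show ?thesis using T
  proof (induction T)
    case empty
    have "special_subgroup S M {} \<subseteq> {\<one>\<^bsub>coxeter_group S M\<^esub>}"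
      by (simp only: special_subgroup_def image_empty group.generate_empty[OF group_coxeter_group]
          subset_refl)
    then show ?case by (auto simp: spherical_def intro: finite_subset)
  next
    case (insert u T)
    have "spherical S M ({u} \<union> T)"
    proof (rule spherical_Un[OF cox])
      show "spherical S M {u}" using insert.prems(1) by (intro spherical_singleton[OF cox]) simp
      show "spherical S M T" using insert.prems by (intro insert.IH) auto
      show "disjoint_commuting S M {u} T"
        unfolding disjoint_commuting_iff[OF cox] using insert.prems insert.hyps(2) by auto
    qed
    then show ?case by simp
  qed
qed

text \<open>The maps \<open>p\<close> and \<open>q\<close> form a Galois insertion of \<open>\<C>\<close> into \<open>\<C>'\<close>.\<close>

lemma maximal_sets_transfer:
  assumes "\<And>X. X \<in> \<C> \<Longrightarrow> p X \<in> \<C>'" "\<And>Y. Y \<in> \<C>' \<Longrightarrow> q Y \<in> \<C>"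
    and qp: "\<And>X. X \<in> \<C> \<Longrightarrow> q (p X) = X" and pq: "\<And>Y. Y \<in> \<C>' \<Longrightarrow> Y \<subseteq> p (q Y)"
    and mono: "mono p" "mono q"
  shows "maximal_sets \<C>' = p ` maximal_sets \<C>"
proof (intro equalityI subsetI)
  fix Y assume "Y \<in> maximal_sets \<C>'"
  then have Y: "Y \<in> \<C>'" "\<And>U. U \<in> \<C>' \<Longrightarrow> Y \<subseteq> U \<Longrightarrow> U = Y" by (auto simp: maximal_sets_def)
  have eq: "p (q Y) = Y" using Y(2)[of "p (q Y)"] pq[OF Y(1)] assms(1,2) Y(1) by simp
  have "q Y \<in> maximal_sets \<C>"
    unfolding maximal_sets_def
  proof (intro CollectI conjI ballI impI)
    show "q Y \<in> \<C>" using assms(2) Y(1) .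
    fix X assume X: "X \<in> \<C>" "q Y \<subseteq> X"
    then have "p (q Y) \<subseteq> p X" using mono(1) by (simp add: monoD)
    then have "p X = Y" using Y(2)[of "p X"] assms(1)[OF X(1)] eq by simp
    then show "X = q Y" using qp[OF X(1)] by simp
  qed
  then show "Y \<in> p ` maximal_sets \<C>" using eq by (metis imageI)
next
  fix Y assume "Y \<in> p ` maximal_sets \<C>"
  then obtain X where X: "Y = p X" "X \<in> \<C>" "\<And>U. U \<in> \<C> \<Longrightarrow> X \<subseteq> U \<Longrightarrow> U = X"
    by (auto simp: maximal_sets_def)
  show "Y \<in> maximal_sets \<C>'"
    unfolding maximal_sets_def
  proof (intro CollectI conjI ballI impI)
    show "Y \<in> \<C>'" using X(1,2) assms(1) by simp
    fix U assume U: "U \<in> \<C>'" "Y \<subseteq> U"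
    then have "q Y \<subseteq> q U" using mono(2) by (simp add: monoD)
    then have "q U = X" using X(3)[of "q U"] assms(2)[OF U(1)] qp[OF X(2)] X(1) by simp
    then show "U = Y" using pq[OF U(1)] U(2) X(1) by simp
  qed
qed

section \<open>Duplexes\<close>

locale duplex =
  fixes S :: "'a::finite set" and M :: "'a \<Rightarrow> 'a \<Rightarrow> enat" and m :: nat and n :: enat
  assumes cox: "coxeter_matrix S M" and ra: "right_angled S M" and m: "2 \<le> m" and n: "5 \<le> n"
begin

abbreviation "S2 \<equiv> duplex_gens S"
abbreviation "D \<equiv> duplex_matrix m n M"
abbreviation doubled :: "'a set \<Rightarrow> ('a \<times> bool) set" where "doubled X \<equiv> X \<times> UNIV"

lemma n_ge_2: "2 \<le> n"
  using n by (rule order_trans[rotated]) (simp add: numeral_eq_enat)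

lemma n_neq_2: "n \<noteq> 2"
  using n by (auto simp: numeral_eq_enat)

lemma cox2: "coxeter_matrix S2 D"
  by (rule coxeter_matrix_duplex[OF cox m n_ge_2])

lemma label_cases: "u \<in> S \<Longrightarrow> v \<in> S \<Longrightarrow> u \<noteq> v \<Longrightarrow> M u v = 2 \<or> M u v = \<infinity>"
  using ra by (auto simp: right_angled_def)

lemma duplex_label: "u \<noteq> v \<Longrightarrow> D (u, i) (v, j) = (if M u v = 2 then 2 else n)"
  by (simp add: duplex_matrix_def)

lemma duplex_commute: "u \<noteq> v \<Longrightarrow> D (u, i) (v, j) = 2 \<longleftrightarrow> M u v = 2"
  using n_neq_2 by (simp add: duplex_label)

lemma base_without_large_affine: "coxeter_without_large_affine S M"
proof (rule without_large_affine_if_hyperbolic_paths[OF cox])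
  fix a b c
  assume "{a, b, c} \<subseteq> S" "a \<noteq> b" "b \<noteq> c" "a \<noteq> c" "M a b \<noteq> 2" "M b c \<noteq> 2"
  then have "M a b = \<infinity>" "M b c = \<infinity>" using label_cases by auto
  then show "\<exists>x y z. {x, y, z} \<subseteq> {a, b, c} \<and> x \<noteq> y \<and> y \<noteq> z \<and> x \<noteq> z \<and> 5 \<le> M x y \<and> 5 \<le> M y z"
    using \<open>a \<noteq> b\<close> \<open>b \<noteq> c\<close> \<open>a \<noteq> c\<close> by (intro exI[of _ a] exI[of _ b] exI[of _ c]) auto
qed

text \<open>In a path of three generators two have different base points and do not commute, hence their label
  is \<open>n\<close>. If the third lies over one of them, it also has label \<open>n\<close> with the other, which becomes the
  middle of a new path; if not, both labels of the given path are \<open>n\<close>.\<close>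

lemma duplex_without_large_affine: "coxeter_without_large_affine S2 D"
proof (rule without_large_affine_if_hyperbolic_paths[OF cox2])
  fix a b c :: "'a \<times> bool"
  assume S: "{a, b, c} \<subseteq> S2" and neq: "a \<noteq> b" "b \<noteq> c" "a \<noteq> c" and path: "D a b \<noteq> 2" "D b c \<noteq> 2"
  obtain u i v j w k where abc: "a = (u, i)" "b = (v, j)" "c = (w, k)"
    by (cases a, cases b, cases c)
  have sym: "M v w = M w v" "M u v = M v u" "v \<noteq> w \<Longrightarrow> M v w \<noteq> 2" "u \<noteq> v \<Longrightarrow> M u v \<noteq> 2"
    using S cox path by (auto simp: abc duplex_gens_def coxeter_matrix_def duplex_label)
  consider "u \<noteq> v" "v \<noteq> w" | "u = v" "v \<noteq> w" | "u \<noteq> v" "v = w"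
    using neq by (auto simp: abc)
  then show "\<exists>x y z. {x, y, z} \<subseteq> {a, b, c} \<and> x \<noteq> y \<and> y \<noteq> z \<and> x \<noteq> z \<and> 5 \<le> D x y \<and> 5 \<le> D y z"
  proof cases
    case 1
    then show ?thesis using neq n sym
      by (intro exI[of _ a] exI[of _ b] exI[of _ c]) (simp add: abc duplex_label)
  next
    case 2
    then show ?thesis using neq n sym
      by (intro exI[of _ a] exI[of _ c] exI[of _ b]) (simp add: abc duplex_label)
  next
    case 3
    then show ?thesis using neq n sym
      by (intro exI[of _ b] exI[of _ a] exI[of _ c]) (simp add: abc duplex_label)
  qed
qed

sublocale base: coxeter_without_large_affine S M
  by (rule base_without_large_affine)

sublocale dup: coxeter_without_large_affine S2 D
  by (rule duplex_without_large_affine)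

lemma doubled_subset: "doubled X \<subseteq> S2 \<longleftrightarrow> X \<subseteq> S"
  by (auto simp: duplex_gens_def)

lemma fst_doubled: "fst ` doubled X = X"
  by force

lemma subset_doubled_fst: "Y \<subseteq> doubled (fst ` Y)"
  by force

lemma fst_subset: "Y \<subseteq> S2 \<Longrightarrow> fst ` Y \<subseteq> S"
  by (auto simp: duplex_gens_def)

text \<open>Two generators with label \<open>\<infinity>\<close> become the triple \<open>u'\<close>, \<open>v'\<close>, \<open>u''\<close> with labels \<open>n\<close>, \<open>n\<close>, \<open>m\<close>. For
  finite \<open>n\<close> its pairs are spherical, and \<open>n \<ge> 5\<close> makes the triple hyperbolic for every \<open>m\<close>.\<close>

lemma nonspherical_doubled:
  assumes "nonspherical S M X"
  shows "nonspherical S2 D (doubled X)"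
proof -
  have X: "X \<subseteq> S" "\<not> spherical S M X" using assms by (auto simp: nonspherical_iff)
  obtain u v where uv: "u \<in> X" "v \<in> X" "u \<noteq> v" "M u v \<noteq> 2"
    using spherical_if_pairwise_commuting[OF cox X(1)] X(2) by blast
  then have "u \<in> S" "v \<in> S" using X(1) by auto
  then have "M v u \<noteq> 2" using coxeter_matrix_sym[OF cox, of u v] uv(4) by simp
  have "\<not> spherical S2 D {(u, False), (v, False), (u, True)}"
    using uv X(1) n \<open>M v u \<noteq> 2\<close>
    by (intro nonspherical_hyperbolic_triple[OF cox2]) (auto simp: duplex_gens_def duplex_label)
  moreover have "{(u, False), (v, False), (u, True)} \<subseteq> doubled X" using uv by auto
  ultimately show ?thesis
    using spherical_subset[of S2 D "doubled X"] X(1) by (auto simp: nonspherical_iff doubled_subset)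
qed

text \<open>Pairwise commuting generators double to commuting dihedral groups of order \<open>2 m\<close>.\<close>

lemma spherical_doubled:
  assumes "T \<subseteq> S" "\<And>s t. s \<in> T \<Longrightarrow> t \<in> T \<Longrightarrow> s \<noteq> t \<Longrightarrow> M s t = 2"
  shows "spherical S2 D (doubled T)"
proof -
  have "finite T" by simp
  then show ?thesis using assms
  proof (induction T)
    case empty
    then show ?case using spherical_if_pairwise_commuting[OF cox2, of "{}"] by simp
  next
    case (insert u T)
    have "spherical S2 D (doubled {u} \<union> doubled T)"
    proof (rule spherical_Un[OF cox2])
      have "D (u, False) (u, True) \<noteq> \<infinity>" by (simp add: duplex_matrix_def)
      then have "spherical S2 D {(u, False), (u, True)}"
        using insert.prems(1) by (intro spherical_pair[OF cox2]) (auto simp: duplex_gens_def)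
      moreover have "doubled {u} = {(u, False), (u, True)}" by (auto simp: UNIV_bool)
      ultimately show "spherical S2 D (doubled {u})" by simp
      show "spherical S2 D (doubled T)" using insert.prems by (intro insert.IH) auto
      have "D (u, i) (t, j) = 2" if "t \<in> T" for t i j
      proof -
        have "u \<noteq> t" using that insert.hyps(2) by auto
        moreover have "M u t = 2" using insert.prems(2)[of u t] that \<open>u \<noteq> t\<close> by simp
        ultimately show ?thesis by (simp add: duplex_commute)
      qed
      then show "disjoint_commuting S2 D (doubled {u}) (doubled T)"
        unfolding disjoint_commuting_iff[OF cox2]
        using insert.prems(1) insert.hyps(2) by (auto simp: duplex_gens_def)
    qed
    moreover have "doubled {u} \<union> doubled T = doubled (insert u T)" by auto
    ultimately show ?case by simp
  qed
qed

lemma nonspherical_fst: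
  assumes "nonspherical S2 D Y"
  shows "nonspherical S M (fst ` Y)"
proof -
  have Y: "Y \<subseteq> S2" "\<not> spherical S2 D Y" using assms by (auto simp: nonspherical_iff)
  have "\<not> spherical S M (fst ` Y)"
  proof
    assume sph: "spherical S M (fst ` Y)"
    have "M s t = 2" if "s \<in> fst ` Y" "t \<in> fst ` Y" "s \<noteq> t" for s t
    proof (rule ccontr)
      assume "M s t \<noteq> 2"
      moreover have "s \<in> S" "t \<in> S" using that fst_subset[OF Y(1)] by auto
      ultimately have "\<not> spherical S M {s, t}"
        using label_cases that(3) by (intro nonspherical_infinite_pair[OF cox]) auto
      moreover have "spherical S M {s, t}" using spherical_subset[OF sph, of "{s, t}"] that by simp
      ultimately show False by simp
    qed
    then have "spherical S2 D (doubled (fst ` Y))" by (rule spherical_doubled[OF fst_subset[OF Y(1)]])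
    then show False using Y(2) spherical_subset[OF _ subset_doubled_fst] by metis
  qed
  then show ?thesis using fst_subset[OF Y(1)] by (simp add: nonspherical_iff)
qed

lemma nonspherical_doubled_iff: "nonspherical S2 D (doubled X) \<longleftrightarrow> nonspherical S M X"
  using nonspherical_doubled[of X] nonspherical_fst[of "doubled X"] unfolding fst_doubled by blast

lemma commuting_doubled:
  assumes "disjoint_commuting S M A B"
  shows "disjoint_commuting S2 D (doubled A) (doubled B)"
proof -
  have AB: "A \<subseteq> S" "B \<subseteq> S" "A \<inter> B = {}" "\<And>a b. a \<in> A \<Longrightarrow> b \<in> B \<Longrightarrow> M a b = 2"
    using assms unfolding base.commuting_iff by auto
  have "D (a, i) (b, j) = 2" if "a \<in> A" "b \<in> B" for a b i j
  proof -
    have "a \<noteq> b" using that AB(3) by auto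
    then show ?thesis using AB(4)[OF that] by (simp add: duplex_commute)
  qed
  then show ?thesis unfolding dup.commuting_iff using AB(1,2,3) by (auto simp: duplex_gens_def)
qed

text \<open>If \<open>m = 2\<close>, then one factor may contain \<open>u'\<close> and the other \<open>u''\<close>. In that case \<open>u'\<close> commutes with
  everything in its factor, because \<open>u''\<close> does. Removing all such generators from one factor keeps
  that factor nonspherical and makes the projections of the two factors disjoint.\<close>

lemma nonspherical_outside_shadow:
  assumes "disjoint_commuting S2 D A B" "nonspherical S2 D A"
  shows "nonspherical S2 D {a \<in> A. fst a \<notin> fst ` B}"
proof -
  let ?A1 = "{a \<in> A. fst a \<notin> fst ` B}" and ?A2 = "{a \<in> A. fst a \<in> fst ` B}"
  have AB: "A \<subseteq> S2" "A \<inter> B = {}" "\<And>a b. a \<in> A \<Longrightarrow> b \<in> B \<Longrightarrow> D a b = 2"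
    using assms(1) unfolding dup.commuting_iff by auto
  have central: "D a' a = 2" if a: "a \<in> ?A2" "a' \<in> A" "a' \<noteq> a" for a a'
  proof -
    obtain b where b: "b \<in> B" "fst b = fst a" using a(1) by auto
    have ab: "a \<noteq> b" "a' \<noteq> b" using AB(2) a b by auto
    have "fst a' \<noteq> fst a"
    proof
      assume "fst a' = fst a"
      then have "snd a' \<noteq> snd a" "snd a' \<noteq> snd b" "snd a \<noteq> snd b"
        using ab a(3) b(2) by (auto simp: prod_eq_iff)
      then show False by auto
    qed
    moreover have "D a' b = 2" using AB(3) a(2) b(1) by simp
    ultimately show ?thesis
      using b(2) duplex_commute[of "fst a'" "fst a" "snd a'"] by (metis prod.collapse)
  qed
  have "spherical S2 D ?A2" using AB(1) central by (intro spherical_if_pairwise_commuting[OF cox2]) auto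
  moreover have "D a' a = 2" if "a' \<in> ?A1" "a \<in> ?A2" for a' a
    using that by (intro central) auto
  then have "disjoint_commuting S2 D ?A1 ?A2"
    unfolding dup.commuting_iff using AB(1) by blast
  moreover have "?A1 \<union> ?A2 = A" by auto
  ultimately have "\<not> spherical S2 D ?A1"
    using spherical_Un[OF cox2, of ?A1 ?A2] assms(2) by (auto simp: nonspherical_iff)
  then show ?thesis using AB(1) by (auto simp: nonspherical_iff)
qed

text \<open>Every product in the duplex lies in the double of its projection. The projection is again a product of
  two nonspherical sets, after generators lying over the second factor have been dropped from the first
  (\<open>nonspherical_outside_shadow\<close>).\<close>

lemma wide_subsets_duplex: "wide_subsets S2 D = doubled ` wide_subsets S M"
  unfolding dup.wide_eq base.wide_eq
proof (rule maximal_sets_transfer[where q = "image fst"])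
  fix X assume "X \<in> wide_candidates S M"
  then obtain A B where X: "X = A \<union> B" "disjoint_commuting S M A B" "nonspherical S M A" "nonspherical S M B"
    by (auto simp: wide_candidates_def)
  have "doubled X = doubled A \<union> doubled B" unfolding X(1) by auto
  then show "doubled X \<in> wide_candidates S2 D"
    using commuting_doubled[OF X(2)] nonspherical_doubled X(3,4) unfolding wide_candidates_def by blast
next
  fix Y assume "Y \<in> wide_candidates S2 D"
  then obtain A B where Y: "Y = A \<union> B" "disjoint_commuting S2 D A B" "nonspherical S2 D A" "nonspherical S2 D B"
    by (auto simp: wide_candidates_def)
  let ?A1 = "{a \<in> A. fst a \<notin> fst ` B}"
  have AB: "A \<subseteq> S2" "B \<subseteq> S2" "\<And>a b. a \<in> A \<Longrightarrow> b \<in> B \<Longrightarrow> D a b = 2"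
    using Y(2) unfolding dup.commuting_iff by auto
  have "M (fst a) (fst b) = 2" if "a \<in> ?A1" "b \<in> B" for a b
  proof -
    have "fst a \<noteq> fst b" "D a b = 2" using that AB(3) by auto
    then show ?thesis using duplex_commute[of "fst a" "fst b" "snd a" "snd b"] by simp
  qed
  then have "disjoint_commuting S M (fst ` ?A1) (fst ` B)"
    unfolding base.commuting_iff using fst_subset[OF AB(1)] fst_subset[OF AB(2)] by auto
  moreover have "nonspherical S M (fst ` ?A1)" "nonspherical S M (fst ` B)"
    using nonspherical_fst nonspherical_outside_shadow[OF Y(2,3)] Y(4) by blast+
  moreover have "fst ` Y = fst ` ?A1 \<union> fst ` B" unfolding Y(1) by auto
  ultimately show "fst ` Y \<in> wide_candidates S M" unfolding wide_candidates_def by blast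
qed (use fst_doubled subset_doubled_fst in \<open>auto intro!: monoI\<close>)

text \<open>The minimal nonspherical sets of the two systems do not correspond: for \<open>n = \<infinity>\<close> a pair \<open>u\<close>, \<open>v\<close> has four
  lifts, and for finite \<open>n\<close> the minimal sets of the duplex are triples, possibly over three
  generators. But the projection of one contains a minimal nonspherical set with a link at least as
  large, and the double of one contains a minimal set with a link at least as large.\<close>

lemma hull_of_doubled:
  assumes T: "T \<subseteq> S"
  shows "hull_of S2 D (doubled T) = doubled (hull_of S M T)"
proof (intro equalityI subsetI)
  fix x assume "x \<in> hull_of S2 D (doubled T)"
  then consider "x \<in> doubled T"
    | A where "minimal_nonspherical S2 D A" "A \<subseteq> doubled T" "x \<in> link S2 D A"
    by (auto simp: hull_of_def)
  then show "x \<in> doubled (hull_of S M T)"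
  proof cases
    case 1
    then show ?thesis using hull_of_superset[of T S M] by auto
  next
    case 2
    obtain w k where x: "x = (w, k)" by (cases x)
    have "nonspherical S M (fst ` A)"
      using 2(1) by (intro nonspherical_fst) (simp add: minimal_nonspherical_def)
    then obtain A1 where A1: "A1 \<subseteq> fst ` A" "minimal_nonspherical S M A1"
      using minimal_nonspherical_exists by blast
    note A1S = base.minimal_nonspherical_subset[OF A1(2)]
    have w: "w \<in> S" using 2(3) dup.link_subset by (auto simp: x duplex_gens_def)
    have comm: "M u w = 2" if u: "u \<in> A1" "u \<noteq> w" for u
    proof -
      obtain i where i: "(u, i) \<in> A" using A1(1) u(1) by force
      have "disjoint_commuting S2 D A {(w, k)}" using 2(3) by (simp add: x link_def)
      then have "D (u, i) (w, k) = 2" unfolding dup.commuting_iff using i by simp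
      then show ?thesis using u(2) by (simp add: duplex_commute)
    qed
    have "w \<notin> A1"
    proof
      assume "w \<in> A1"
      have "disjoint_commuting S M (A1 - {w}) {w}"
        unfolding base.commuting_iff using comm A1S w by auto
      then have "A1 \<subseteq> A1 - {w} \<or> A1 \<subseteq> {w}"
        by (rule base.minimal_nonspherical_in_factor[OF A1(2)]) auto
      then have "A1 \<subseteq> {w}" using \<open>w \<in> A1\<close> by auto
      then have "spherical S M A1" by (rule spherical_subset[OF spherical_singleton[OF cox w]])
      then show False using A1(2) by (simp add: minimal_nonspherical_def nonspherical_iff)
    qed
    then have "w \<in> link S M A1"
      unfolding link_def base.commuting_iff using comm A1S w by auto
    moreover have "A1 \<subseteq> T"
      using subset_trans[OF A1(1) image_mono[OF 2(2)]] by (simp only: fst_doubled)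
    ultimately show ?thesis using A1(2) by (auto simp: x hull_of_def)
  qed
next
  fix x assume "x \<in> doubled (hull_of S M T)"
  then obtain w k where x: "x = (w, k)" "w \<in> hull_of S M T" by auto
  then consider "w \<in> T" | A1 where "minimal_nonspherical S M A1" "A1 \<subseteq> T" "w \<in> link S M A1"
    by (auto simp: hull_of_def)
  then show "x \<in> hull_of S2 D (doubled T)"
  proof cases
    case 1
    then show ?thesis using hull_of_superset[of "doubled T" S2 D] by (auto simp: x)
  next
    case 2
    have "nonspherical S2 D (doubled A1)"
      using 2(1) by (intro nonspherical_doubled) (simp add: minimal_nonspherical_def)
    then obtain A where A: "A \<subseteq> doubled A1" "minimal_nonspherical S2 D A"
      using minimal_nonspherical_exists by blast
    have "disjoint_commuting S M A1 {w}" using 2(3) by (simp add: link_def)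
    then have "disjoint_commuting S2 D (doubled A1) (doubled {w})" by (rule commuting_doubled)
    then have "disjoint_commuting S2 D A {x}"
      by (rule dup.commuting_mono) (use A(1) in \<open>auto simp: x\<close>)
    then have "x \<in> link S2 D A" by (simp add: link_def disjoint_commuting_def)
    moreover have "A \<subseteq> doubled T" using A(1) 2(2) by auto
    ultimately show ?thesis using A(2) by (auto simp: hull_of_def)
  qed
qed

lemma overlap_class_doubled:
  assumes T: "T \<in> \<B>"
  shows "overlap_equiv S2 D (doubled ` \<B>) `` {doubled T} = doubled ` (overlap_equiv S M \<B> `` {T})"
proof (intro equalityI subsetI)
  fix V assume "V \<in> overlap_equiv S2 D (doubled ` \<B>) `` {doubled T}"
  then have "(doubled T, V) \<in> overlap_equiv S2 D (doubled ` \<B>)" by simp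
  then show "V \<in> doubled ` (overlap_equiv S M \<B> `` {T})"
  proof (induction rule: overlap_equiv_induct)
    case refl
    then show ?case by (auto simp: overlap_equiv_refl)
  next
    case (step U V)
    obtain U1 where U1: "U = doubled U1" "(T, U1) \<in> overlap_equiv S M \<B>" using step(1) by auto
    obtain V1 where V1: "V = doubled V1" "V1 \<in> \<B>" using step(3) by auto
    have "doubled U1 \<inter> doubled V1 = doubled (U1 \<inter> V1)" by auto
    then have "nonspherical S M (U1 \<inter> V1)" using step(4) by (simp add: U1 V1 nonspherical_doubled_iff)
    then have "(U1, V1) \<in> overlap_equiv S M \<B>"
      using overlap_equiv_in[OF U1(2) T] V1(2) by (intro overlap_equiv_step)
    with U1(2) have "(T, V1) \<in> overlap_equiv S M \<B>" by (rule overlap_equiv_trans)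
    then show ?case using V1(1) by auto
  qed
next
  fix V assume "V \<in> doubled ` (overlap_equiv S M \<B> `` {T})"
  then obtain V1 where V1: "V = doubled V1" "(T, V1) \<in> overlap_equiv S M \<B>" by auto
  from V1(2) have "(doubled T, doubled V1) \<in> overlap_equiv S2 D (doubled ` \<B>)"
  proof (induction rule: overlap_equiv_induct)
    case (step U W)
    have "doubled U \<inter> doubled W = doubled (U \<inter> W)" by auto
    then have "nonspherical S2 D (doubled U \<inter> doubled W)" using step(4) by (simp add: nonspherical_doubled_iff)
    then have "(doubled U, doubled W) \<in> overlap_equiv S2 D (doubled ` \<B>)"
      using step(2,3) by (intro overlap_equiv_step) auto
    with step(1) show ?case by (rule overlap_equiv_trans)
  qed (rule overlap_equiv_refl)
  then show "V \<in> overlap_equiv S2 D (doubled ` \<B>) `` {doubled T}" by (simp add: V1(1))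
qed

lemma merge_step_doubled:
  assumes \<B>: "\<B> \<subseteq> Pow S"
  shows "merge_step S2 D (doubled ` \<B>) = doubled ` merge_step S M \<B>"
proof -
  have eq: "\<Union> (hull_of S2 D ` (overlap_equiv S2 D (doubled ` \<B>) `` {doubled T})) =
      doubled (\<Union> (hull_of S M ` (overlap_equiv S M \<B> `` {T})))" if T: "T \<in> \<B>" for T
  proof -
    have "hull_of S2 D (doubled U) = doubled (hull_of S M U)" if "U \<in> overlap_equiv S M \<B> `` {T}" for U
    proof (rule hull_of_doubled)
      have "U \<in> \<B>" using overlap_equiv_in[OF _ T] that by simp
      then show "U \<subseteq> S" using \<B> by auto
    qed
    then have "(\<lambda>U. hull_of S2 D (doubled U)) ` (overlap_equiv S M \<B> `` {T}) =
        (\<lambda>U. doubled (hull_of S M U)) ` (overlap_equiv S M \<B> `` {T})"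
      by (intro image_cong HOL.refl)
    then show ?thesis unfolding overlap_class_doubled[OF T] image_image by auto
  qed
  have "merge_step S2 D (doubled ` \<B>) =
      (\<lambda>T. \<Union> (hull_of S2 D ` (overlap_equiv S2 D (doubled ` \<B>) `` {doubled T}))) ` \<B>"
    by (auto simp: merge_step_def quotient_def)
  also have "\<dots> = (\<lambda>T. doubled (\<Union> (hull_of S M ` (overlap_equiv S M \<B> `` {T})))) ` \<B>"
    by (intro image_cong HOL.refl eq)
  also have "\<dots> = doubled ` merge_step S M \<B>"
    by (auto simp: merge_step_def quotient_def)
  finally show ?thesis .
qed

lemma wide_hulls_duplex: "wide_hulls S2 D i = doubled ` wide_hulls S M i"
proof (induction i)
  case 0
  then show ?case by (simp add: wide_subsets_duplex)
next
  case (Suc i)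
  have "wide_hulls S M i \<subseteq> Pow S" using base.Lambda_shift_decomposition[of i] by blast
  then show ?case by (simp add: Suc merge_step_doubled)
qed

lemma hypergraph_index_duplex: "hypergraph_index S2 D = hypergraph_index S M"
proof (rule hypergraph_index_cong[OF duplex_without_large_affine base_without_large_affine])
  show "wide_subsets S2 D = {} \<longleftrightarrow> wide_subsets S M = {}" by (simp add: wide_subsets_duplex)
  fix i
  have "inj doubled" by (auto simp: inj_def)
  then show "S2 \<in> wide_hulls S2 D i \<longleftrightarrow> S \<in> wide_hulls S M i"
    using inj_image_mem_iff[of doubled S "wide_hulls S M i"] wide_hulls_duplex[of i]
    by (simp add: duplex_gens_def)
qed

end

theorem theorem5p2:
  fixes S :: "'a::finite set" and M :: "'a \<Rightarrow> 'a \<Rightarrow> enat" and m :: nat and n :: enat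
  assumes "coxeter_matrix S M"
    and "right_angled S M"
    and "2 \<le> m"
    and "5 \<le> n"
  shows "hypergraph_index (duplex_gens S) (duplex_matrix m n M) = hypergraph_index S M"
  by (rule duplex.hypergraph_index_duplex[OF duplex.intro[OF assms]])

end
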